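(* For every $\textsc{Opt-DT-FOIL}$ formula $\Psi$, the problem $\textsc{Comp}(\Psi)$ is in $\mathrm{FP}^{\mathrm{NP}}$.
   Context: Partial instances of dimension $n$ are tuples in $\{0,1,\bot\}^n$; $\mathbf{e}_\bot=\{i\mid\mathbf{e}[i]=\bot\}$. A decision tree of dimension $n$ is a rooted binary tree with internal nodes labeled by features in $\{1,\dots,n\}$, edges labeled $0/1$, leaves labeled $\mathsf{true}/\mathsf{false}$, no feature repeated on a root-to-leaf path. For a node $u$ with root-to-$u$ path $u_1\cdots u_k$, $\mathbf{e}_u[j]$ is the label of the edge leaving the node $u_i$ ($i<k$) labeled $j$, $\bot$ if none. Interpretation over $\{0,1,\bot\}^n$: $\subseteq$ is subsumption ($\mathbf{e}_1\subseteq\mathbf{e}_2$ iff $\mathbf{e}_1[i]=\mathbf{e}_2[i]$ whenever $\mathbf{e}_1[i]\neq\bot$); $\mathbf{e}\preceq\mathbf{e}'$ iff $|\mathbf{e}_\bot|\ge|\mathbf{e}'_\bot|$; $\textsc{Node}(\mathbf{e})$ iff $\mathbf{e}=\mathbf{e}_u$ for a node $u$; $\textsc{PosLeaf}(\mathbf{e})$ iff $\mathbf{e}=\mathbf{e}_u$ for a $\mathsf{true}$ leaf $u$. Atomic $\textsc{DT-FOIL}$ formulas are first-order formulas over $\{\subseteq,\preceq\}$; $\textsc{DT-FOIL}$ is the closure of atomic formulas under Boolean combinations and guarded quantifications $\exists x(\textsc{Node}(x)\wedge\phi)$, $\forall x(\textsc{Node}(x)\to\phi)$, $\exists x(\textsc{PosLeaf}(x)\wedge\phi)$,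 $\forall x(\textsc{PosLeaf}(x)\to\phi)$. An atomic formula $\rho[v_1,\dots,v_\ell](y,z)$ represents a strict partial order if for every decision tree and every assignment to the parameters $v_i$ the relation on $y,z$ is irreflexive and transitive. An $\textsc{Opt-DT-FOIL}$ formula is $\Psi[u_1,\dots,u_k,v_1,\dots,v_\ell](x)=\min[\varphi[u_1,\dots,u_k](x),\rho[v_1,\dots,v_\ell](y,z)]$ with $\varphi(x,\bar u)$ in $\textsc{DT-FOIL}$ and $\rho$ atomic representing a strict partial order; $\mathcal{T}\models\Psi[\mathbf{e}'_1,\dots,\mathbf{e}'_k,\mathbf{e}''_1,\dots,\mathbf{e}''_\ell](\mathbf{e})$ iff $\mathcal{T}\models\varphi(\mathbf{e},\bar{\mathbf{e}}')$ and there is no $\mathbf{e}^*$ with $\mathcal{T}\models\varphi(\mathbf{e}^*,\bar{\mathbf{e}}')\wedge\rho(\mathbf{e}^*,\mathbf{e},\bar{\mathbf{e}}'')$. For fixed $\Psi$, $\textsc{Comp}(\Psi)$: given a decision tree $\mathcal{T}$ of dimension $n$ and partial instances $\mathbf{e}'_1,\dots,\mathbf{e}'_k,\mathbf{e}''_1,\dots,\mathbf{e}''_\ell$ of dimension $n$, output a partial instance $\mathbf{e}$ of dimension $n$ with $\mathcal{T}\models\Psi[\bar{\mathbf{e}}',\bar{\mathbf{e}}''](\mathbf{e})$, or No if none exists. *)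

theory Defs
  imports "HOL-Computational_Algebra.Polynomial"
begin

text \<open>Multi-tape machines over the tape alphabet $\{0,1,\mbox{blank}\}$, the blank being \<open>None\<close>.
  A two-way infinite tape is stored relative to its head, which always scans cell 0;
  moving the head to the right thus shifts the contents to the left.\<close>

type_synonym symbol = "bool option"
type_synonym tape = "int \<Rightarrow> symbol"

datatype move = Lft | Stay | Rgt

fun shift :: "move \<Rightarrow> tape \<Rightarrow> tape" where
  "shift Lft t = (\<lambda>i. t (i - 1))"
| "shift Stay t = t"
| "shift Rgt t = (\<lambda>i. t (i + 1))"

definition act :: "symbol \<times> move \<Rightarrow> tape \<Rightarrow> tape" where
  "act a t = shift (snd a) (t(0 := fst a))"

definition word_tape :: "bool list \<Rightarrow> tape" where
  "word_tape w = (\<lambda>i. if 0 \<le> i \<and> i < int (length w) then Some (w ! nat i) else None)"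

text \<open>The word on a tape is the one that starts at the head and extends to the first blank.\<close>

definition holds_word :: "tape \<Rightarrow> bool list \<Rightarrow> bool" where
  "holds_word t w \<longleftrightarrow>
     (\<forall>i < length w. t (int i) = Some (w ! i)) \<and> t (int (length w)) = None"

lemma holds_word_word_tape: "holds_word (word_tape w) w"
  by (simp add: holds_word_def word_tape_def)

lemma holds_word_unique:
  assumes "holds_word t v" "holds_word t w"
  shows "v = w"
proof -
  have "\<not> length v < length w" "\<not> length w < length v"
    using assms by (auto simp: holds_word_def)
  then show ?thesis
    using assms by (intro nth_equalityI) (auto simp: holds_word_def)
qed

text \<open>States are the numbers below \<open>states\<close>. Input words are placed on the tapes
  0, 1, ...; the output is read from tape 0, oracle queries are read from tape 1.
  \<open>delta\<close> is irrelevant in the halting state and in the query state.\<close>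

record otm =
  states :: nat
  tapes :: nat
  start :: nat
  halt :: nat
  query :: nat
  yes :: nat
  no :: nat
  delta :: "nat \<Rightarrow> symbol list \<Rightarrow> nat \<times> (symbol \<times> move) list"

definition otm :: "otm \<Rightarrow> bool" where
  "otm M \<longleftrightarrow>
     2 \<le> tapes M \<and> {start M, halt M, query M, yes M, no M} \<subseteq> {..<states M} \<and>
     halt M \<noteq> query M \<and>
     (\<forall>s < states M. \<forall>a. length a = tapes M \<longrightarrow>
        fst (delta M s a) < states M \<and> length (snd (delta M s a)) = tapes M)"

type_synonym config = "nat \<times> tape list"

definition init :: "otm \<Rightarrow> bool list list \<Rightarrow> config" where
  "init M ws =
     (start M, map (\<lambda>i. word_tape (if i < length ws then ws ! i else [])) [0..<tapes M])"

fun step :: "otm \<Rightarrow> bool list set \<Rightarrow> config \<Rightarrow> config" where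
  "step M A (s, ts) =
     (if s = halt M then (s, ts)
      else if s = query M then (if \<exists>w \<in> A. holds_word (ts ! 1) w then yes M else no M, ts)
      else let (s', as) = delta M s (map (\<lambda>t. t 0) ts) in (s', map2 act as ts))"

definition computes_within :: "otm \<Rightarrow> bool list set \<Rightarrow> bool list list \<Rightarrow> nat \<Rightarrow> bool list \<Rightarrow> bool" where
  "computes_within M A ws t w \<longleftrightarrow>
     (\<exists>t' \<le> t. \<exists>ts. (step M A ^^ t') (init M ws) = (halt M, ts) \<and> holds_word (ts ! 0) w)"

text \<open>A machine run with the empty oracle is an ordinary deterministic machine: each query
  is answered negatively.\<close>

definition polytime_decidable2 :: "(bool list \<Rightarrow> bool list \<Rightarrow> bool) \<Rightarrow> bool" where
  "polytime_decidable2 R \<longleftrightarrow>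
     (\<exists>M. \<exists>p :: nat poly. otm M \<and>
        (\<forall>x u. computes_within M {} [x, u] (poly p (length x + length u)) [R x u]))"

definition NP :: "bool list set set" where
  "NP = {L. \<exists>R. \<exists>q :: nat poly. polytime_decidable2 R \<and>
            (\<forall>x. x \<in> L \<longleftrightarrow> (\<exists>u. length u \<le> poly q (length x) \<and> R x u))}"

definition FP_with_oracle :: "bool list set \<Rightarrow> (bool list \<Rightarrow> bool list) set" where
  "FP_with_oracle A =
     {f. \<exists>M. \<exists>p :: nat poly. otm M \<and>
           (\<forall>x. computes_within M A [x] (poly p (length x)) (f x))}"

text \<open>A search problem is a relation between (encoded) inputs and admissible outputs; its
  inputs are the elements of the domain. A problem is in the class if some total function,
  computable in polynomial time with an NP oracle, maps every input to an admissible output.\<close>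

type_synonym search_problem = "(bool list \<times> bool list) set"

definition FP_NP :: "search_problem set" where
  "FP_NP = {P. \<exists>A \<in> NP. \<exists>f \<in> FP_with_oracle A. \<forall>x \<in> Domain P. (x, f x) \<in> P}"

text \<open>Features are numbered from 0, and \<open>None\<close> is the undefined value.\<close>

type_synonym inst = "bool option list"

definition insts :: "nat \<Rightarrow> inst set" where
  "insts n = {e. length e = n}"

definition bots :: "inst \<Rightarrow> nat set" where
  "bots e = {i. i < length e \<and> e ! i = None}"

definition subsumed :: "inst \<Rightarrow> inst \<Rightarrow> bool" where
  "subsumed e e' \<longleftrightarrow>
     length e = length e' \<and> (\<forall>i < length e. e ! i \<noteq> None \<longrightarrow> e ! i = e' ! i)"

definition less_defined :: "inst \<Rightarrow> inst \<Rightarrow> bool" where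
  "less_defined e e' \<longleftrightarrow> card (bots e) \<ge> card (bots e')"

text \<open>\<open>Node i l r\<close> is labeled by feature \<open>i\<close>; its 0-edge leads to \<open>l\<close> and its 1-edge to \<open>r\<close>.\<close>

datatype dtree = Leaf bool | Node nat dtree dtree

primrec features :: "dtree \<Rightarrow> nat set" where
  "features (Leaf b) = {}"
| "features (Node i l r) = insert i (features l \<union> features r)"

primrec decision_tree :: "nat \<Rightarrow> dtree \<Rightarrow> bool" where
  "decision_tree n (Leaf b) \<longleftrightarrow> True"
| "decision_tree n (Node i l r) \<longleftrightarrow>
     i < n \<and> i \<notin> features l \<union> features r \<and> decision_tree n l \<and> decision_tree n r"

text \<open>A node is addressed by the edge labels on the path from the root;
  \<open>path_inst n T u\<close> is the partial instance of node \<open>u\<close>.\<close>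

fun subtree_at :: "dtree \<Rightarrow> bool list \<Rightarrow> dtree option" where
  "subtree_at T [] = Some T"
| "subtree_at (Leaf c) (b # u) = None"
| "subtree_at (Node i l r) (b # u) = subtree_at (if b then r else l) u"

fun path_inst :: "nat \<Rightarrow> dtree \<Rightarrow> bool list \<Rightarrow> inst" where
  "path_inst n (Node i l r) (b # u) = (path_inst n (if b then r else l) u)[i := Some b]"
| "path_inst n _ _ = replicate n None"

definition node_insts :: "nat \<Rightarrow> dtree \<Rightarrow> inst set" where
  "node_insts n T = {path_inst n T u | u. subtree_at T u \<noteq> None}"

definition pos_leaf_insts :: "nat \<Rightarrow> dtree \<Rightarrow> inst set" where
  "pos_leaf_insts n T = {path_inst n T u | u. subtree_at T u = Some (Leaf True)}"

text \<open>First-order formulas (with equality) over subsumption and comparison of the number of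
  undefined features. Variables are natural numbers.\<close>

datatype atomic =
    Subs nat nat
  | Prec nat nat
  | Equal nat nat
  | ANot atomic
  | AAnd atomic atomic
  | AOr atomic atomic
  | AEx nat atomic
  | AAll nat atomic

primrec atomic_sat :: "nat \<Rightarrow> (nat \<Rightarrow> inst) \<Rightarrow> atomic \<Rightarrow> bool" where
  "atomic_sat n v (Subs x y) \<longleftrightarrow> subsumed (v x) (v y)"
| "atomic_sat n v (Prec x y) \<longleftrightarrow> less_defined (v x) (v y)"
| "atomic_sat n v (Equal x y) \<longleftrightarrow> v x = v y"
| "atomic_sat n v (ANot f) \<longleftrightarrow> \<not> atomic_sat n v f"
| "atomic_sat n v (AAnd f g) \<longleftrightarrow> atomic_sat n v f \<and> atomic_sat n v g"
| "atomic_sat n v (AOr f g) \<longleftrightarrow> atomic_sat n v f \<or> atomic_sat n v g"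
| "atomic_sat n v (AEx x f) \<longleftrightarrow> (\<exists>e \<in> insts n. atomic_sat n (v(x := e)) f)"
| "atomic_sat n v (AAll x f) \<longleftrightarrow> (\<forall>e \<in> insts n. atomic_sat n (v(x := e)) f)"

primrec atomic_fv :: "atomic \<Rightarrow> nat set" where
  "atomic_fv (Subs x y) = {x, y}"
| "atomic_fv (Prec x y) = {x, y}"
| "atomic_fv (Equal x y) = {x, y}"
| "atomic_fv (ANot f) = atomic_fv f"
| "atomic_fv (AAnd f g) = atomic_fv f \<union> atomic_fv g"
| "atomic_fv (AOr f g) = atomic_fv f \<union> atomic_fv g"
| "atomic_fv (AEx x f) = atomic_fv f - {x}"
| "atomic_fv (AAll x f) = atomic_fv f - {x}"

datatype dt_foil =
    Atomic atomic
  | DNot dt_foil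
  | DAnd dt_foil dt_foil
  | DOr dt_foil dt_foil
  | ExNode nat dt_foil
  | AllNode nat dt_foil
  | ExPosLeaf nat dt_foil
  | AllPosLeaf nat dt_foil

primrec sat :: "nat \<Rightarrow> dtree \<Rightarrow> (nat \<Rightarrow> inst) \<Rightarrow> dt_foil \<Rightarrow> bool" where
  "sat n T v (Atomic f) \<longleftrightarrow> atomic_sat n v f"
| "sat n T v (DNot f) \<longleftrightarrow> \<not> sat n T v f"
| "sat n T v (DAnd f g) \<longleftrightarrow> sat n T v f \<and> sat n T v g"
| "sat n T v (DOr f g) \<longleftrightarrow> sat n T v f \<or> sat n T v g"
| "sat n T v (ExNode x f) \<longleftrightarrow> (\<exists>e \<in> node_insts n T. sat n T (v(x := e)) f)"
| "sat n T v (AllNode x f) \<longleftrightarrow> (\<forall>e \<in> node_insts n T. sat n T (v(x := e)) f)"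
| "sat n T v (ExPosLeaf x f) \<longleftrightarrow> (\<exists>e \<in> pos_leaf_insts n T. sat n T (v(x := e)) f)"
| "sat n T v (AllPosLeaf x f) \<longleftrightarrow> (\<forall>e \<in> pos_leaf_insts n T. sat n T (v(x := e)) f)"

primrec fv :: "dt_foil \<Rightarrow> nat set" where
  "fv (Atomic f) = atomic_fv f"
| "fv (DNot f) = fv f"
| "fv (DAnd f g) = fv f \<union> fv g"
| "fv (DOr f g) = fv f \<union> fv g"
| "fv (ExNode x f) = fv f - {x}"
| "fv (AllNode x f) = fv f - {x}"
| "fv (ExPosLeaf x f) = fv f - {x}"
| "fv (AllPosLeaf x f) = fv f - {x}"

text \<open>In \<open>MinOf k \<phi> l \<rho>\<close> the free variables are numbered as follows.
  In \<open>\<phi>\<close>: 0 is $x$ and 1, ..., k are $u_1,\dots,u_k$.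
  In \<open>\<rho>\<close>: 0 is $y$, 1 is $z$ and 2, ..., l+1 are $v_1,\dots,v_l$.
  Accordingly, the lists \<open>e # us\<close> and \<open>y # z # vs\<close> serve as assignments.\<close>

datatype opt_formula = MinOf nat dt_foil nat atomic

definition represents_strict_order :: "nat \<Rightarrow> atomic \<Rightarrow> bool" where
  "represents_strict_order l \<rho> \<longleftrightarrow>
     (\<forall>n T vs. decision_tree n T \<longrightarrow> length vs = l \<longrightarrow> set vs \<subseteq> insts n \<longrightarrow>
        (let R = (\<lambda>y z. sat n T ((!) (y # z # vs)) (Atomic \<rho>))
         in irreflp_on (insts n) R \<and> transp_on (insts n) R))"

fun opt_dt_foil :: "opt_formula \<Rightarrow> bool" where
  "opt_dt_foil (MinOf k \<phi> l \<rho>) \<longleftrightarrow>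
     fv \<phi> \<subseteq> {..k} \<and> atomic_fv \<rho> \<subseteq> {..l + 1} \<and> represents_strict_order l \<rho>"

fun opt_sat :: "nat \<Rightarrow> dtree \<Rightarrow> inst list \<Rightarrow> inst list \<Rightarrow> opt_formula \<Rightarrow> inst \<Rightarrow> bool" where
  "opt_sat n T us vs (MinOf k \<phi> l \<rho>) e \<longleftrightarrow>
     sat n T ((!) (e # us)) \<phi> \<and>
     \<not> (\<exists>e' \<in> insts n. sat n T ((!) (e' # us)) \<phi> \<and> sat n T ((!) (e' # e # vs)) (Atomic \<rho>))"

text \<open>The dimension is written in unary, since an output has $n$ entries even if
  the formula has no parameters. Given this, unary and binary notation for the features
  in the tree are polynomially related.\<close>

definition enc_nat :: "nat \<Rightarrow> bool list" where
  "enc_nat m = replicate m True @ [False]"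

primrec enc_tree :: "dtree \<Rightarrow> bool list" where
  "enc_tree (Leaf b) = [False, b]"
| "enc_tree (Node i l r) = True # enc_nat i @ enc_tree l @ enc_tree r"

fun enc_entry :: "bool option \<Rightarrow> bool list" where
  "enc_entry None = [False, False]"
| "enc_entry (Some b) = [True, b]"

definition enc_inst :: "inst \<Rightarrow> bool list" where
  "enc_inst e = concat (map enc_entry e)"

definition enc_input :: "nat \<Rightarrow> dtree \<Rightarrow> inst list \<Rightarrow> inst list \<Rightarrow> bool list" where
  "enc_input n T us vs = enc_nat n @ enc_tree T @ concat (map enc_inst (us @ vs))"

text \<open>\<open>None\<close> is the answer No.\<close>

fun enc_output :: "inst option \<Rightarrow> bool list" where
  "enc_output None = [False]"
| "enc_output (Some e) = True # enc_inst e"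

fun valid_input :: "opt_formula \<Rightarrow> nat \<Rightarrow> dtree \<Rightarrow> inst list \<Rightarrow> inst list \<Rightarrow> bool" where
  "valid_input (MinOf k \<phi> l \<rho>) n T us vs \<longleftrightarrow>
     decision_tree n T \<and> length us = k \<and> length vs = l \<and> set us \<union> set vs \<subseteq> insts n"

fun correct_output :: "opt_formula \<Rightarrow> nat \<Rightarrow> dtree \<Rightarrow> inst list \<Rightarrow> inst list \<Rightarrow> inst option \<Rightarrow> bool" where
  "correct_output \<Psi> n T us vs None \<longleftrightarrow> \<not> (\<exists>e \<in> insts n. opt_sat n T us vs \<Psi> e)"
| "correct_output \<Psi> n T us vs (Some e) \<longleftrightarrow> e \<in> insts n \<and> opt_sat n T us vs \<Psi> e"

definition Comp :: "opt_formula \<Rightarrow> search_problem" where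
  "Comp \<Psi> = {(enc_input n T us vs, enc_output a) | n T us vs a.
               valid_input \<Psi> n T us vs \<and> correct_output \<Psi> n T us vs a}"

lemma enc_nat_inj: "enc_nat m @ xs = enc_nat m' @ ys \<Longrightarrow> m = m' \<and> xs = ys"
  unfolding enc_nat_def
proof (induction m arbitrary: m')
  case 0
  then show ?case by (cases m') auto
next
  case (Suc m)
  then show ?case by (cases m') auto
qed

lemma enc_tree_inj: "enc_tree T @ xs = enc_tree T' @ ys \<Longrightarrow> T = T' \<and> xs = ys"
proof (induction T arbitrary: T' xs ys)
  case (Leaf b)
  then show ?case by (cases T') auto
next
  case (Node i l r)
  show ?case
  proof (cases T')
    case (Leaf b)
    with Node.prems show ?thesis by simp
  next
    case T': (Node j l' r')
    with Node.prems
    have "enc_nat i @ (enc_tree l @ enc_tree r @ xs) = enc_nat j @ (enc_tree l' @ enc_tree r' @ ys)"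
      by simp
    from enc_nat_inj[OF this] have "i = j" and
      lr: "enc_tree l @ (enc_tree r @ xs) = enc_tree l' @ (enc_tree r' @ ys)"
      by auto
    from Node.IH(1)[OF lr] have "l = l'" and "enc_tree r @ xs = enc_tree r' @ ys"
      by auto
    with Node.IH(2) \<open>i = j\<close> T' show ?thesis by auto
  qed
qed

lemma enc_inst_inj:
  "length e = length e' \<Longrightarrow> enc_inst e @ xs = enc_inst e' @ ys \<Longrightarrow> e = e' \<and> xs = ys"
proof (induction e e' rule: list_induct2)
  case (Cons a e b e')
  then show ?case by (cases a; cases b) (auto simp: enc_inst_def)
qed (simp add: enc_inst_def)

lemma enc_insts_inj:
  "length es = length es' \<Longrightarrow> set es \<union> set es' \<subseteq> insts n \<Longrightarrow>
   concat (map enc_inst es) = concat (map enc_inst es') \<Longrightarrow> es = es'"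
proof (induction es es' rule: list_induct2)
  case (Cons e es e' es')
  then show ?case using enc_inst_inj[of e e'] by (auto simp: insts_def)
qed simp

text \<open>The next fact ensures that the outputs related to a string by \<open>Comp\<close> are those of a single input.\<close>

lemma enc_input_inj:
  assumes "valid_input \<Psi> n T us vs" "valid_input \<Psi> n' T' us' vs'"
    and "enc_input n T us vs = enc_input n' T' us' vs'"
  shows "n = n' \<and> T = T' \<and> us = us' \<and> vs = vs'"
proof -
  obtain k \<phi> l \<rho> where \<Psi>: "\<Psi> = MinOf k \<phi> l \<rho>" by (cases \<Psi>)
  from assms(3) have
    "enc_nat n @ (enc_tree T @ concat (map enc_inst (us @ vs))) =
     enc_nat n' @ (enc_tree T' @ concat (map enc_inst (us' @ vs')))"
    by (simp add: enc_input_def)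
  from enc_nat_inj[OF this] have "n = n'" and
    T: "enc_tree T @ concat (map enc_inst (us @ vs)) =
        enc_tree T' @ concat (map enc_inst (us' @ vs'))"
    by auto
  with enc_tree_inj[OF T] have eq: "n = n'" "T = T'"
    "concat (map enc_inst (us @ vs)) = concat (map enc_inst (us' @ vs'))"
    by auto
  have "us @ vs = us' @ vs'"
    by (rule enc_insts_inj[OF _ _ eq(3), of n]) (use assms(1,2) eq \<Psi> in auto)
  with eq show ?thesis using assms(1,2) \<Psi> by auto
qed

end

theory Submission
  imports Defs "HOL-Combinatorics.Permutations"
begin

text \<open>Fix an input and the order $\rho$. The relation $\rho$ is invariant under the permutations of
  the features that fix its parameters. If two instances of a $\rho$-chain had the same type, that
  is, the same number of occurrences of each entry at each pattern of parameter values, then such a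
  permutation would map one to the other, and iterating it would produce an infinite strictly
  decreasing sequence of instances. Hence the length of a chain is at most the number of types, which
  is polynomial in the dimension, and the last element of a longest chain of instances that satisfy
  $\varphi$ is an answer.

  Such a chain is found by computing, bit by bit, the greedy path through the words
  $1^m 0\,\mathit{out}^R$, where \<open>out\<close> encodes the last element of a chain of length $m$: preferring 1
  over 0 makes $m$ maximal. The queries are answered by an NP oracle. Its certificates contain a chain
  and tables that describe the tree; that the tables are correct is a first-order property
  that determines them. Guarded quantifiers of $\varphi$ then range over table entries, and quantifiers of atomic
  formulas range over one representative of each type. Everything can thus be expressed by arithmetic
  terms with bounded sums, which are compiled to machines that run in polynomial time.\<close>

section \<open>Stack programs and their machines\<close>

text \<open>Minimality of a given instance is a universal statement, so asking an oracle for the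
  bits of some minimal instance would not be an NP query. Chains avoid this: a chain is verified
  element by element, only existential queries are asked, and minimality comes from maximality of
  the length, since a better instance would prolong the chain. The certificate holds a whole chain,
  so chains must be short although there are \<open>3 ^ n\<close> instances; atomic formulas cannot
  name features, and this symmetry both shortens chains and removes the exponential range of
  unguarded quantifiers.

  The machine must stop in polynomial time on every word, encoded input or not. So the language
  itself has to bound greedy paths: every accepted word begins with a parsed dimension and tree, and
  these bound what may follow. Uniqueness of the tables matters because \<phi> may also use them
  negatively: an incomplete table of nodes could make a universal guarded quantifier true.\<close>

type_synonym instr = "nat \<times> (symbol \<Rightarrow> symbol \<times> move) \<times> (symbol \<Rightarrow> nat)"

text \<open>State \<open>length P\<close> halts. The further state \<open>length P + 1\<close> lies
  outside the code, so that a program without queries can take it as its query state and never reach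
  it.\<close>

definition machine :: "nat \<Rightarrow> instr list \<Rightarrow> nat \<Rightarrow> nat \<Rightarrow> nat \<Rightarrow> otm" where
  "machine k P q y n =
     \<lparr>states = length P + 2, tapes = k, start = 0, halt = length P, query = q, yes = y, no = n,
      delta = (\<lambda>s a. if s < length P
                 then (case P ! s of (i, f, g) \<Rightarrow> (g (a ! i), (map (\<lambda>b. (b, Stay)) a)[i := f (a ! i)]))
                 else (s, map (\<lambda>b. (b, Stay)) a))\<rparr>"

lemma otm_machine:
  assumes "2 \<le> k" "q \<le> length P + 1" "q \<noteq> length P" "y \<le> length P" "n \<le> length P"
    and "\<And>i f g s. (i, f, g) \<in> set P \<Longrightarrow> g s \<le> length P"
  shows "otm (machine k P q y n)"
proof -
  have "fst (delta (machine k P q y n) s a) < length P + 2 \<and>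
        length (snd (delta (machine k P q y n) s a)) = length a" if "s < length P + 2" for s a
  proof (cases "s < length P")
    case True
    obtain i f g where ifg: "P ! s = (i, f, g)" by (cases "P ! s")
    then have "g (a ! i) \<le> length P" using assms(6) nth_mem[OF True] by metis
    with True ifg show ?thesis by (simp add: machine_def)
  qed (use that in \<open>simp add: machine_def\<close>)
  with assms(1-5) show ?thesis
    by (simp add: otm_def) (auto simp: machine_def)
qed

declare step.simps [simp del]

lemma act_Stay: "act (t 0, Stay) t = t"
  by (simp add: act_def)

lemma step_machine:
  assumes "s < length P" "s \<noteq> q" "P ! s = (i, f, g)" "i < k" "length ts = k"
  shows "step (machine k P q y n) A (s, ts) = (g ((ts ! i) 0), ts[i := act (f ((ts ! i) 0)) (ts ! i)])"
proof -
  have "map2 act ((map (\<lambda>b. (b, Stay)) (map (\<lambda>t. t 0) ts))[i := f ((ts ! i) 0)]) ts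
      = ts[i := act (f ((ts ! i) 0)) (ts ! i)]"
    using assms(4,5) by (intro nth_equalityI) (auto simp: nth_list_update act_Stay)
  with assms show ?thesis by (simp add: machine_def step.simps)
qed

text \<open>The tapes serve as stacks of bits with the head scanning the top, so that whatever is
  left of the head is garbage.\<close>

type_synonym regs = "nat \<Rightarrow> bool list"

section \<open>Stack programs and their compilation\<close>

datatype com =
    Skip
  | Push nat bool
  | Pop nat
  | Seq com com
  | IfTop nat symbol com com
  | While nat com

definition stack_top :: "bool list \<Rightarrow> symbol" where
  "stack_top w = (case w of [] \<Rightarrow> None | b # _ \<Rightarrow> Some b)"

lemma stack_top_simps [simp]: "stack_top [] = None" "stack_top (b # w) = Some b" "stack_top w = None \<longleftrightarrow> w = []"
  by (auto simp: stack_top_def split: list.splits)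

text \<open>The time is the exact number of steps of the compiled machine.\<close>

inductive exec :: "com \<Rightarrow> regs \<Rightarrow> nat \<Rightarrow> regs \<Rightarrow> bool" where
  Skip: "exec Skip \<sigma> 0 \<sigma>"
| Push: "exec (Push i b) \<sigma> 2 (\<sigma>(i := b # \<sigma> i))"
| Pop: "exec (Pop i) \<sigma> 1 (\<sigma>(i := tl (\<sigma> i)))"
| Seq: "exec c \<sigma> t \<sigma>' \<Longrightarrow> exec c' \<sigma>' t' \<sigma>'' \<Longrightarrow> exec (Seq c c') \<sigma> (t + t') \<sigma>''"
| IfTop_True: "stack_top (\<sigma> i) = s \<Longrightarrow> exec c \<sigma> t \<sigma>' \<Longrightarrow> exec (IfTop i s c c') \<sigma> (1 + t + 1) \<sigma>'"
| IfTop_False: "stack_top (\<sigma> i) \<noteq> s \<Longrightarrow> exec c' \<sigma> t \<sigma>' \<Longrightarrow> exec (IfTop i s c c') \<sigma> (1 + t) \<sigma>'"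
| While_False: "\<sigma> i = [] \<Longrightarrow> exec (While i c) \<sigma> 1 \<sigma>"
| While_True: "\<sigma> i \<noteq> [] \<Longrightarrow> exec c \<sigma> t \<sigma>' \<Longrightarrow> exec (While i c) \<sigma>' t' \<sigma>'' \<Longrightarrow>
    exec (While i c) \<sigma> (1 + t + 1 + t') \<sigma>''"

primrec regs_of :: "com \<Rightarrow> nat set" where
  "regs_of Skip = {}"
| "regs_of (Push i b) = {i}"
| "regs_of (Pop i) = {i}"
| "regs_of (Seq c c') = regs_of c \<union> regs_of c'"
| "regs_of (IfTop i s c c') = insert i (regs_of c \<union> regs_of c')"
| "regs_of (While i c) = insert i (regs_of c)"

primrec csize :: "com \<Rightarrow> nat" where
  "csize Skip = 0"
| "csize (Push i b) = 2"
| "csize (Pop i) = 1"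
| "csize (Seq c c') = csize c + csize c'"
| "csize (IfTop i s c c') = csize c + csize c' + 2"
| "csize (While i c) = csize c + 2"

definition branch :: "nat \<Rightarrow> (symbol \<Rightarrow> nat) \<Rightarrow> instr" where
  "branch i g = (i, \<lambda>s. (s, Stay), g)"

text \<open>Jump targets are absolute, hence the start address \<open>b\<close>. As
  \<open>act\<close> writes before it moves, a push first moves left over an unchanged symbol and
  then writes. A pop stays on a blank because \<open>holds_word\<close> says nothing about the cells
  behind the end of the word.\<close>

primrec compile :: "com \<Rightarrow> nat \<Rightarrow> instr list" where
  "compile Skip b = []"
| "compile (Push i x) b = [(i, \<lambda>s. (s, Lft), \<lambda>_. b + 1), (i, \<lambda>_. (Some x, Stay), \<lambda>_. b + 2)]"
| "compile (Pop i) b = [(i, \<lambda>s. (s, if s = None then Stay else Rgt), \<lambda>_. b + 1)]"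
| "compile (Seq c c') b = compile c b @ compile c' (b + csize c)"
| "compile (IfTop i s c c') b =
     branch i (\<lambda>s'. if s' = s then b + 1 else b + 2 + csize c) # compile c (b + 1) @
     branch i (\<lambda>_. b + 2 + csize c + csize c') # compile c' (b + 2 + csize c)"
| "compile (While i c) b =
     branch i (\<lambda>s. if s = None then b + 2 + csize c else b + 1) # compile c (b + 1) @ [branch i (\<lambda>_. b)]"

lemma length_compile [simp]: "length (compile c b) = csize c"
  by (induction c arbitrary: b) auto

lemma compile_targets: "(i, f, g) \<in> set (compile c b) \<Longrightarrow> g s \<le> b + csize c"
proof (induction c arbitrary: b)
  case (Seq c1 c2)
  then consider "(i, f, g) \<in> set (compile c1 b)" | "(i, f, g) \<in> set (compile c2 (b + csize c1))" by auto
  then show ?case by cases (use Seq.IH(1)[of b] Seq.IH(2)[of "b + csize c1"] in auto)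
next
  case (IfTop j s' c1 c2)
  then consider "g = (\<lambda>s'a. if s'a = s' then b + 1 else b + 2 + csize c1)"
    | "(i, f, g) \<in> set (compile c1 (b + 1))" | "g = (\<lambda>_. b + 2 + csize c1 + csize c2)"
    | "(i, f, g) \<in> set (compile c2 (b + 2 + csize c1))" by (auto simp: branch_def)
  then show ?case
    by cases (use IfTop.IH(1)[of "b + 1"] IfTop.IH(2)[of "b + 2 + csize c1"] in auto)
next
  case (While j c)
  then consider "g = (\<lambda>s. if s = None then b + 2 + csize c else b + 1)"
    | "(i, f, g) \<in> set (compile c (b + 1))" | "g = (\<lambda>_. b)" by (auto simp: branch_def)
  then show ?case by cases (use While.IH[of "b + 1"] in auto)
qed auto

text \<open>A block must avoid \<open>q\<close>, since \<open>step\<close> ignores the instruction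
  stored at the query state.\<close>

definition code_at :: "instr list \<Rightarrow> nat \<Rightarrow> nat \<Rightarrow> instr list \<Rightarrow> bool" where
  "code_at P q b cs \<longleftrightarrow> (\<forall>j < length cs. b + j < length P \<and> P ! (b + j) = cs ! j \<and> b + j \<noteq> q)"

lemma code_at_Cons:
  "code_at P q b (c # cs) \<longleftrightarrow> b < length P \<and> P ! b = c \<and> b \<noteq> q \<and> code_at P q (b + 1) cs"
  by (auto simp: code_at_def nth_Cons less_Suc_eq_0_disj split: nat.splits)

lemma code_at_append:
  "code_at P q b (cs @ cs') \<longleftrightarrow> code_at P q b cs \<and> code_at P q (b + length cs) cs'"
proof (induction cs arbitrary: b)
  case Nil
  then show ?case by (simp add: code_at_def)
qed (auto simp: code_at_Cons)

lemma code_atI: "P = xs @ cs @ ys \<Longrightarrow> b = length xs \<Longrightarrow> q < b \<or> b + length cs \<le> q \<Longrightarrow> code_at P q b cs"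
  by (auto simp: code_at_def nth_append)

definition holds :: "nat \<Rightarrow> tape list \<Rightarrow> regs \<Rightarrow> bool" where
  "holds k ts \<sigma> \<longleftrightarrow> length ts = k \<and> (\<forall>i < k. holds_word (ts ! i) (\<sigma> i))"

lemma holds_word_stack_top: "holds_word t w \<Longrightarrow> t 0 = stack_top w"
  by (cases w) (auto simp: holds_word_def)

lemma holds_word_push:
  "holds_word t w \<Longrightarrow> holds_word (act (Some b, Stay) (act (t 0, Lft) t)) (b # w)"
  by (auto simp: holds_word_def act_def nth_Cons split: nat.splits)

lemma holds_word_pop:
  "holds_word t w \<Longrightarrow> holds_word (act (t 0, if t 0 = None then Stay else Rgt) t) (tl w)"
  by (cases w) (auto simp: holds_word_def act_def algebra_simps)

lemma holds_update:
  "holds k ts \<sigma> \<Longrightarrow> holds_word t w \<Longrightarrow> holds k (ts[i := t]) (\<sigma>(i := w))"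
  by (auto simp: holds_def nth_list_update)

lemma step_branch:
  assumes "holds k ts \<sigma>" "code_at P q b (branch i g # cs)" "i < k"
  shows "step (machine k P q y n) A (b, ts) = (g (stack_top (\<sigma> i)), ts)"
proof -
  have *: "(ts ! i) 0 = stack_top (\<sigma> i)" using assms(1,3) by (auto simp: holds_def holds_word_stack_top)
  have "act (stack_top (\<sigma> i), Stay) (ts ! i) = ts ! i"
    using act_Stay[of "ts ! i"] by (simp add: *)
  with assms * show ?thesis
    by (auto simp: code_at_Cons holds_def branch_def step_machine list_update_id)
qed

lemma funpow_trans: "(f ^^ s) x = y \<Longrightarrow> (f ^^ t) y = z \<Longrightarrow> (f ^^ (s + t)) x = z"
  by (simp add: funpow_add add.commute[of s])

text \<open>Induction on the execution. Step counts are exact so that runs compose by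
  \<open>funpow_trans\<close>; upper bounds enter only with \<open>runs\<close>. Address and tapes
  are arbitrary because a loop body is entered repeatedly, each time with other tapes.\<close>

lemma compile_correct:
  assumes "exec c \<sigma> t \<sigma>'" "code_at P q b (compile c b)" "regs_of c \<subseteq> {..<k}" "holds k ts \<sigma>"
  shows "\<exists>ts'. (step (machine k P q y n) A ^^ t) (b, ts) = (b + csize c, ts') \<and> holds k ts' \<sigma>'"
  using assms
proof (induction arbitrary: b ts rule: exec.induct)
  case (Skip \<sigma>)
  then show ?case by auto
next
  case (Push i x \<sigma>)
  let ?t = "ts ! i"
  have i: "i < k" and l: "length ts = k" and h: "holds_word ?t (\<sigma> i)"
    using Push by (auto simp: holds_def)
  have "(step (machine k P q y n) A ^^ 1) (b, ts) = (b + 1, ts[i := act (?t 0, Lft) ?t])"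
    using Push(1) i l by (simp add: code_at_Cons step_machine)
  moreover have "(step (machine k P q y n) A ^^ 1) (b + 1, ts[i := act (?t 0, Lft) ?t]) =
      (b + 2, ts[i := act (Some x, Stay) (act (?t 0, Lft) ?t)])"
    using Push(1) i l by (simp add: code_at_Cons step_machine)
  ultimately have "(step (machine k P q y n) A ^^ (1 + 1)) (b, ts) =
      (b + 2, ts[i := act (Some x, Stay) (act (?t 0, Lft) ?t)])" by (rule funpow_trans)
  then show ?case using holds_update[OF Push(3) holds_word_push[OF h], of i x]
    by (simp add: numeral_2_eq_2 del: fun_upd_apply)
next
  case (Pop i \<sigma>)
  let ?t = "ts ! i"
  have i: "i < k" and l: "length ts = k" and h: "holds_word ?t (\<sigma> i)"
    using Pop by (auto simp: holds_def)
  have "(step (machine k P q y n) A ^^ 1) (b, ts) =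
      (b + 1, ts[i := act (?t 0, if ?t 0 = None then Stay else Rgt) ?t])"
    using Pop(1) i l by (simp add: code_at_Cons step_machine)
  then show ?case using holds_update[OF Pop(3) holds_word_pop[OF h], of i]
    by (simp del: fun_upd_apply)
next
  case (Seq c \<sigma> t \<sigma>' c' t' \<sigma>'')
  let ?st = "step (machine k P q y n) A"
  from Seq.prems have c: "code_at P q b (compile c b)" "code_at P q (b + csize c) (compile c' (b + csize c))"
    "regs_of c \<subseteq> {..<k}" "regs_of c' \<subseteq> {..<k}" by (auto simp: code_at_append)
  from Seq.IH(1)[OF c(1,3) Seq.prems(3)] obtain ts' where
    1: "(?st ^^ t) (b, ts) = (b + csize c, ts')" and h: "holds k ts' \<sigma>'" by auto
  from Seq.IH(2)[OF c(2,4) h] obtain ts'' where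
    2: "(?st ^^ t') (b + csize c, ts') = (b + csize c + csize c', ts'')" and "holds k ts'' \<sigma>''" by auto
  with funpow_trans[OF 1 2] show ?case by (auto simp: add.assoc)
next
  case (IfTop_True \<sigma> i s c t \<sigma>' c')
  let ?st = "step (machine k P q y n) A"
  from IfTop_True.prems have c: "code_at P q (b + 1) (compile c (b + 1))" "regs_of c \<subseteq> {..<k}" "i < k"
    and j: "code_at P q (b + 1 + csize c) (branch i (\<lambda>_. b + 2 + csize c + csize c') # compile c' (b + 2 + csize c))"
    by (auto simp: code_at_append code_at_Cons)
  from IfTop_True.IH[OF c(1,2) IfTop_True.prems(3)] obtain ts' where
    "(?st ^^ t) (b + 1, ts) = (b + 1 + csize c, ts')" and h: "holds k ts' \<sigma>'" by auto
  moreover have "(?st ^^ 1) (b, ts) = (b + 1, ts)"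
    using step_branch[OF IfTop_True.prems(3) IfTop_True.prems(1)[unfolded compile.simps] c(3)] IfTop_True.hyps by simp
  moreover have "(?st ^^ 1) (b + 1 + csize c, ts') = (b + 2 + csize c + csize c', ts')"
    using step_branch[OF h j c(3)] by simp
  ultimately have "(?st ^^ (1 + t + 1)) (b, ts) = (b + 2 + csize c + csize c', ts')"
    by (blast intro: funpow_trans)
  with h show ?case by (auto simp: algebra_simps simp del: funpow.simps)
next
  case (IfTop_False \<sigma> i s c' t \<sigma>' c)
  let ?st = "step (machine k P q y n) A"
  from IfTop_False.prems have c: "code_at P q (b + 2 + csize c) (compile c' (b + 2 + csize c))" "regs_of c' \<subseteq> {..<k}" "i < k"
    by (auto simp: code_at_append code_at_Cons)
  from IfTop_False.IH[OF c(1,2) IfTop_False.prems(3)] obtain ts' where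
    "(?st ^^ t) (b + 2 + csize c, ts) = (b + 2 + csize c + csize c', ts')" and h: "holds k ts' \<sigma>'" by auto
  moreover have "(?st ^^ 1) (b, ts) = (b + 2 + csize c, ts)"
    using step_branch[OF IfTop_False.prems(3) IfTop_False.prems(1)[unfolded compile.simps] c(3)] IfTop_False.hyps by simp
  ultimately have "(?st ^^ (1 + t)) (b, ts) = (b + 2 + csize c + csize c', ts')"
    by (blast intro: funpow_trans)
  with h show ?case by (auto simp: algebra_simps simp del: funpow.simps)
next
  case (While_False \<sigma> i c)
  then show ?case
    using step_branch[OF While_False.prems(3) While_False.prems(1)[unfolded compile.simps]] by auto
next
  case (While_True \<sigma> i c t \<sigma>' t' \<sigma>'')
  let ?st = "step (machine k P q y n) A"
  from While_True.prems have c: "code_at P q (b + 1) (compile c (b + 1))" "regs_of c \<subseteq> {..<k}" "i < k"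
    and j: "code_at P q (b + 1 + csize c) [branch i (\<lambda>_. b)]"
    by (auto simp: code_at_append code_at_Cons)
  from While_True.IH(1)[OF c(1,2) While_True.prems(3)] obtain ts' where
    "(?st ^^ t) (b + 1, ts) = (b + 1 + csize c, ts')" and h: "holds k ts' \<sigma>'" by auto
  moreover have "(?st ^^ 1) (b, ts) = (b + 1, ts)"
    using step_branch[OF While_True.prems(3) While_True.prems(1)[unfolded compile.simps] c(3)] While_True.hyps by simp
  moreover have "(?st ^^ 1) (b + 1 + csize c, ts') = (b, ts')"
    using step_branch[OF h j c(3)] by simp
  ultimately have "(?st ^^ (1 + t + 1)) (b, ts) = (b, ts')"
    by (blast intro: funpow_trans)
  with While_True.IH(2)[OF While_True.prems(1,2) h] show ?case by (blast intro: funpow_trans)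
qed

section \<open>Running times of basic programs\<close>

definition runs :: "com \<Rightarrow> regs \<Rightarrow> nat \<Rightarrow> regs \<Rightarrow> bool" where
  "runs c \<sigma> T \<sigma>' \<longleftrightarrow> (\<exists>t \<le> T. exec c \<sigma> t \<sigma>')"

lemma runs_mono: "runs c \<sigma> T \<sigma>' \<Longrightarrow> T \<le> T' \<Longrightarrow> runs c \<sigma> T' \<sigma>'"
  unfolding runs_def by (meson le_trans)

lemma runs_Skip: "runs Skip \<sigma> 0 \<sigma>"
  unfolding runs_def by (blast intro: exec.Skip)

lemma runs_Push: "runs (Push i b) \<sigma> 2 (\<sigma>(i := b # \<sigma> i))"
  unfolding runs_def by (blast intro: exec.Push)

lemma runs_Pop: "runs (Pop i) \<sigma> 1 (\<sigma>(i := tl (\<sigma> i)))"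
  unfolding runs_def by (blast intro: exec.Pop)

lemma runs_Seq: "runs c \<sigma> T \<sigma>' \<Longrightarrow> runs c' \<sigma>' T' \<sigma>'' \<Longrightarrow> runs (Seq c c') \<sigma> (T + T') \<sigma>''"
  unfolding runs_def by (meson add_mono exec.Seq)

lemma runs_IfTop:
  assumes "stack_top (\<sigma> i) = s \<Longrightarrow> runs c \<sigma> T \<sigma>'" "stack_top (\<sigma> i) \<noteq> s \<Longrightarrow> runs c' \<sigma> T \<sigma>'"
  shows "runs (IfTop i s c c') \<sigma> (T + 2) \<sigma>'"
proof (cases "stack_top (\<sigma> i) = s")
  case True
  with assms(1) obtain t where "t \<le> T" "exec c \<sigma> t \<sigma>'" by (auto simp: runs_def)
  with exec.IfTop_True[of \<sigma> i s c t \<sigma>' c', OF True] show ?thesis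
    unfolding runs_def by (intro exI[of _ "1 + t + 1"]) auto
next
  case False
  with assms(2) obtain t where "t \<le> T" "exec c' \<sigma> t \<sigma>'" by (auto simp: runs_def)
  with exec.IfTop_False[of \<sigma> i s c' t \<sigma>' c, OF False] show ?thesis
    unfolding runs_def by (intro exI[of _ "1 + t"]) auto
qed

text \<open>Loops are analysed by giving the register contents \<open>f j\<close> after
  \<open>j\<close> rounds in closed form. Each round pays 2 extra steps for the test and the jump
  back; the last 1 is the failing test.\<close>

lemma runs_While:
  assumes "\<And>j. j < m \<Longrightarrow> f j i \<noteq> []" "f m i = []" "\<And>j. j < m \<Longrightarrow> runs c (f j) T (f (Suc j))"
  shows "runs (While i c) (f 0) (m * (T + 2) + 1) (f m)"
  using assms
proof (induction m arbitrary: f)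
  case 0
  then have "exec (While i c) (f 0) 1 (f 0)" by (intro exec.While_False) simp
  then show ?case unfolding runs_def by (intro exI[of _ 1]) simp
next
  case (Suc m)
  have "runs (While i c) (f (Suc 0)) (m * (T + 2) + 1) (f (Suc m))"
    using Suc.IH[of "\<lambda>j. f (Suc j)"] Suc.prems by simp
  then obtain t' where t': "t' \<le> m * (T + 2) + 1" "exec (While i c) (f (Suc 0)) t' (f (Suc m))"
    by (auto simp: runs_def)
  obtain t where t: "t \<le> T" "exec c (f 0) t (f (Suc 0))" using Suc.prems(3)[of 0] by (auto simp: runs_def)
  have "exec (While i c) (f 0) (1 + t + 1 + t') (f (Suc m))"
    by (rule exec.While_True[OF _ t(2) t'(2)]) (use Suc.prems(1)[of 0] in auto)
  then show ?case unfolding runs_def using t(1) t'(1) by (intro exI[of _ "1 + t + 1 + t'"]) auto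
qed

abbreviation unary :: "nat \<Rightarrow> bool list" where
  "unary n \<equiv> replicate n True"

lemma unary_pred: "j < m \<Longrightarrow> unary (m - j) = True # unary (m - Suc j)"
  by (metis Suc_diff_Suc replicate_Suc)

definition clear :: "nat \<Rightarrow> com" where
  "clear a = While a (Pop a)"

lemma runs_clear: "runs (clear a) \<sigma> (length (\<sigma> a) * 3 + 1) (\<sigma>(a := []))"
proof -
  let ?f = "\<lambda>j. \<sigma>(a := drop j (\<sigma> a))"
  have "runs (Pop a) (?f j) 1 (?f (Suc j))" for j
    using runs_Pop[of a "?f j"] by (simp add: drop_Suc tl_drop)
  then have "runs (clear a) (?f 0) (length (\<sigma> a) * (1 + 2) + 1) (?f (length (\<sigma> a)))"
    unfolding clear_def by (intro runs_While[where f = ?f]) auto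
  then have "runs (clear a) \<sigma> (length (\<sigma> a) * (1 + 2) + 1) (\<sigma>(a := []))" by simp
  then show ?thesis by (rule runs_mono) simp
qed

definition move_unary :: "nat \<Rightarrow> nat \<Rightarrow> com" where
  "move_unary a b = While a (Seq (Pop a) (Push b True))"

lemma runs_move_unary:
  assumes "a \<noteq> b" "\<sigma> a = unary m"
  shows "runs (move_unary a b) \<sigma> (m * 5 + 1) (\<sigma>(a := [], b := unary m @ \<sigma> b))"
proof -
  let ?f = "\<lambda>j. \<sigma>(a := unary (m - j), b := unary j @ \<sigma> b)"
  have "runs (Seq (Pop a) (Push b True)) (?f j) (1 + 2) (?f (Suc j))" if "j < m" for j
  proof (rule runs_Seq[OF runs_Pop])
    have "?f (Suc j) = (?f j)(a := tl ((?f j) a), b := True # (?f j) b)"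
      using assms(1) that by (auto simp: unary_pred)
    then show "runs (Push b True) ((?f j)(a := tl ((?f j) a))) 2 (?f (Suc j))"
      using runs_Push[of b True "(?f j)(a := tl ((?f j) a))"] assms(1) by simp
  qed
  then have "runs (move_unary a b) (?f 0) (m * (1 + 2 + 2) + 1) (?f m)"
    unfolding move_unary_def using assms(1) by (intro runs_While[where f = ?f]) auto
  moreover have "?f 0 = \<sigma>" "?f m = \<sigma>(a := [], b := unary m @ \<sigma> b)" using assms by auto
  ultimately have "runs (move_unary a b) \<sigma> (m * (1 + 2 + 2) + 1) (\<sigma>(a := [], b := unary m @ \<sigma> b))"
    by simp
  then show ?thesis by (rule runs_mono) simp
qed

definition move_top :: "nat \<Rightarrow> nat \<Rightarrow> com" where
  "move_top a b = IfTop a (Some True) (Seq (Pop a) (Push b True)) (Seq (Pop a) (Push b False))"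

lemma runs_move_top:
  assumes "a \<noteq> b" "\<sigma> a = x # w"
  shows "runs (move_top a b) \<sigma> 5 (\<sigma>(a := w, b := x # \<sigma> b))"
proof -
  have "runs (Seq (Pop a) (Push b x)) \<sigma> (1 + 2) (\<sigma>(a := w, b := x # \<sigma> b))"
    using runs_Seq[OF runs_Pop[of a \<sigma>] runs_Push[of b x "\<sigma>(a := tl (\<sigma> a))"]] assms by simp
  then have "runs (move_top a b) \<sigma> (1 + 2 + 2) (\<sigma>(a := w, b := x # \<sigma> b))"
    unfolding move_top_def by (cases x) (rule runs_IfTop; simp add: assms)+
  then show ?thesis by (rule runs_mono) simp
qed

definition move_all :: "nat \<Rightarrow> nat \<Rightarrow> com" where
  "move_all a b = While a (move_top a b)"

lemma runs_move_all:
  assumes "a \<noteq> b"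
  shows "runs (move_all a b) \<sigma> (length (\<sigma> a) * 7 + 1) (\<sigma>(a := [], b := rev (\<sigma> a) @ \<sigma> b))"
proof -
  let ?w = "\<sigma> a"
  let ?f = "\<lambda>j. \<sigma>(a := drop j ?w, b := rev (take j ?w) @ \<sigma> b)"
  have "runs (move_top a b) (?f j) 5 (?f (Suc j))" if "j < length ?w" for j
  proof -
    have "?f (Suc j) = (?f j)(a := drop (Suc j) ?w, b := ?w ! j # (?f j) b)"
      using assms that by (auto simp: take_Suc_conv_app_nth)
    then show ?thesis
      using runs_move_top[OF assms, of "?f j" "?w ! j" "drop (Suc j) ?w"] assms that
      by (simp add: Cons_nth_drop_Suc)
  qed
  then have "runs (move_all a b) (?f 0) (length ?w * (5 + 2) + 1) (?f (length ?w))"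
    unfolding move_all_def using assms by (intro runs_While[where f = ?f]) auto
  moreover have "?f 0 = \<sigma>" "?f (length ?w) = \<sigma>(a := [], b := rev (\<sigma> a) @ \<sigma> b)" using assms by auto
  ultimately have "runs (move_all a b) \<sigma> (length ?w * (5 + 2) + 1) (\<sigma>(a := [], b := rev (\<sigma> a) @ \<sigma> b))"
    by simp
  then show ?thesis by (rule runs_mono) simp
qed

text \<open>Reading a stack destroys it, so the number goes through the scratch register
  \<open>b + 1\<close>, from which source and copy are rebuilt together.\<close>

definition copy_unary :: "nat \<Rightarrow> nat \<Rightarrow> com" where
  "copy_unary a b =
     Seq (move_unary a (b + 1)) (While (b + 1) (Seq (Pop (b + 1)) (Seq (Push a True) (Push b True))))"

lemma runs_copy_unary:
  assumes "a < b" "\<sigma> a = unary m" "\<sigma> b = []" "\<sigma> (b + 1) = []"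
  shows "runs (copy_unary a b) \<sigma> (m * 12 + 2) (\<sigma>(b := unary m))"
proof -
  let ?f = "\<lambda>j. \<sigma>(a := unary j, b := unary j, b + 1 := unary (m - j))"
  have 1: "runs (move_unary a (b + 1)) \<sigma> (m * 5 + 1) (\<sigma>(a := [], b + 1 := unary m))"
    using runs_move_unary[of a "b + 1" \<sigma> m] assms by simp
  have "runs (Seq (Pop (b + 1)) (Seq (Push a True) (Push b True))) (?f j) (1 + (2 + 2)) (?f (Suc j))"
    if "j < m" for j
  proof -
    let ?g = "(?f j)(b + 1 := tl ((?f j) (b + 1)))"
    let ?h = "?g(a := True # ?g a)"
    have "?f (Suc j) = ?h(b := True # ?h b)"
      using assms(1) that by (auto simp: unary_pred)
    then show ?thesis
      using runs_Seq[OF runs_Pop[of "b + 1" "?f j"] runs_Seq[OF runs_Push[of a True ?g] runs_Push[of b True ?h]]]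
      by simp
  qed
  then have "runs (While (b + 1) (Seq (Pop (b + 1)) (Seq (Push a True) (Push b True)))) (?f 0)
      (m * (1 + (2 + 2) + 2) + 1) (?f m)"
    using assms(1) by (intro runs_While[where f = ?f]) auto
  moreover have "?f 0 = \<sigma>(a := [], b + 1 := unary m)" "?f m = \<sigma>(b := unary m)"
    using assms by auto
  ultimately have 2: "runs (While (b + 1) (Seq (Pop (b + 1)) (Seq (Push a True) (Push b True))))
      (\<sigma>(a := [], b + 1 := unary m)) (m * (1 + (2 + 2) + 2) + 1) (\<sigma>(b := unary m))"
    by simp
  show ?thesis unfolding copy_unary_def using runs_Seq[OF 1 2] by (rule runs_mono) simp
qed

section \<open>Arithmetic terms\<close>

text \<open>Variables are de Bruijn indices: the variable bound by \<open>Sum\<close> has index 0.\<close>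

datatype tm =
    Var nat
  | Cst nat
  | Add tm tm
  | Sub tm tm
  | Sum tm tm
  | Bit bool tm
  | Len bool

primrec eval :: "tm \<Rightarrow> (bool \<Rightarrow> bool list) \<Rightarrow> (nat \<Rightarrow> nat) \<Rightarrow> nat" where
  "eval (Var j) W \<rho> = \<rho> j"
| "eval (Cst n) W \<rho> = n"
| "eval (Add t t') W \<rho> = eval t W \<rho> + eval t' W \<rho>"
| "eval (Sub t t') W \<rho> = eval t W \<rho> - eval t' W \<rho>"
| "eval (Sum t t') W \<rho> = (\<Sum>i < eval t W \<rho>. eval t' W (case_nat i \<rho>))"
| "eval (Bit k t) W \<rho> = of_bool (eval t W \<rho> < length (W k) \<and> W k ! eval t W \<rho>)"
| "eval (Len k) W \<rho> = length (W k)"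

section \<open>Polynomial bounds on values\<close>

definition env_le :: "(bool \<Rightarrow> bool list) \<Rightarrow> (nat \<Rightarrow> nat) \<Rightarrow> nat \<Rightarrow> bool" where
  "env_le W \<rho> s \<longleftrightarrow> (\<forall>k. length (W k) \<le> s) \<and> (\<forall>j. \<rho> j \<le> s)"

lemma env_le_push: "env_le W \<rho> s \<Longrightarrow> i \<le> m \<Longrightarrow> env_le W (case_nat i \<rho>) (m + s)"
  by (auto simp: env_le_def split: nat.splits intro: trans_le_add2)

definition value_bound :: "tm \<Rightarrow> nat poly \<Rightarrow> bool" where
  "value_bound t V \<longleftrightarrow> (\<forall>W \<rho> s. env_le W \<rho> s \<longrightarrow> eval t W \<rho> \<le> poly V s)"

lemma value_boundD: "value_bound t V \<Longrightarrow> env_le W \<rho> s \<Longrightarrow> eval t W \<rho> \<le> poly V s"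
  by (simp add: value_bound_def)

text \<open>The only construct that enlarges environments is \<open>Sum\<close>: its index is below
  a polynomial \<open>V s\<close>, so the body is evaluated at size \<open>V s + s\<close>. Nesting
  thus composes polynomials, and its depth is fixed by the term. Since \<open>env_le\<close> asks
  only for upper bounds, the one size \<open>V s + s\<close> serves all indices.\<close>

lemma value_bound_exists: "\<exists>V. value_bound t V"
proof (induction t)
  case (Var j)
  show ?case by (intro exI[of _ "[:0, 1:]"]) (auto simp: value_bound_def env_le_def)
next
  case (Cst n)
  show ?case by (intro exI[of _ "[:n:]"]) (simp add: value_bound_def)
next
  case (Add t t')
  then obtain V V' where "value_bound t V" "value_bound t' V'" by blast
  then show ?case by (intro exI[of _ "V + V'"]) (auto simp: value_bound_def intro: add_mono)
next
  case (Sub t t')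
  then obtain V where "value_bound t V" by blast
  then show ?case by (intro exI[of _ V]) (auto simp: value_bound_def intro: le_trans[OF diff_le_self])
next
  case (Sum t t')
  then obtain V V' where V: "value_bound t V" "value_bound t' V'" by blast
  have "eval (Sum t t') W \<rho> \<le> poly (V * pcompose V' (V + [:0, 1:])) s" if "env_le W \<rho> s" for W \<rho> s
  proof -
    have "eval (Sum t t') W \<rho> \<le> (\<Sum>i < eval t W \<rho>. poly V' (poly V s + s))"
      unfolding eval.simps using value_boundD[OF V(1) that]
      by (intro sum_mono value_boundD[OF V(2)] env_le_push[OF that]) auto
    also have "\<dots> \<le> poly V s * poly V' (poly V s + s)"
      using value_boundD[OF V(1) that] by simp
    finally show ?thesis by (simp add: poly_pcompose)
  qed
  then show ?case unfolding value_bound_def by blast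
next
  case (Bit k t)
  show ?case by (intro exI[of _ 1]) (simp add: value_bound_def)
next
  case (Len k)
  show ?case by (intro exI[of _ "[:0, 1:]"]) (auto simp: value_bound_def env_le_def)
qed

section \<open>Programs that evaluate terms\<close>

definition word_reg :: "bool \<Rightarrow> nat" where
  "word_reg k = of_bool k"

text \<open>The bits before the position are parked in \<open>r + 2\<close> and put back afterwards.
  Doing nothing on an empty stack makes positions beyond the end read as false, as in
  \<open>eval\<close>.\<close>

definition lookup :: "nat \<Rightarrow> nat \<Rightarrow> com" where
  "lookup a r =
     Seq (While (r + 1) (Seq (Pop (r + 1)) (IfTop a None Skip (move_top a (r + 2)))))
    (Seq (IfTop a (Some True) (Push r True) Skip)
         (move_all (r + 2) a))"

definition put_length :: "nat \<Rightarrow> nat \<Rightarrow> com" where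
  "put_length a r =
     Seq (While a (Seq (move_top a (r + 1)) (Push r True)))
         (move_all (r + 1) a)"

text \<open>\<open>ct t vs r\<close> stores the value in register \<open>r\<close> in unary, where \<open>vs\<close> are the registers of
  the variables and all registers from \<open>r\<close> on are initially empty.\<close>

primrec ct :: "tm \<Rightarrow> nat list \<Rightarrow> nat \<Rightarrow> com" where
  "ct (Var j) vs r = (if j < length vs then copy_unary (vs ! j) r else Skip)"
| "ct (Cst n) vs r = ((Seq (Push r True)) ^^ n) Skip"
| "ct (Add t t') vs r = Seq (ct t vs r) (Seq (ct t' vs (r + 1)) (move_unary (r + 1) r))"
| "ct (Sub t t') vs r = Seq (ct t vs r) (Seq (ct t' vs (r + 1)) (While (r + 1) (Seq (Pop (r + 1)) (Pop r))))"
| "ct (Sum t t') vs r =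
     Seq (ct t vs (r + 1))
    (Seq (While (r + 1) (Seq (Pop (r + 1)) (Seq (ct t' ((r + 2) # vs) (r + 3))
           (Seq (move_unary (r + 3) r) (Push (r + 2) True)))))
         (clear (r + 2)))"
| "ct (Bit k t) vs r = Seq (ct t vs (r + 1)) (lookup (word_reg k) r)"
| "ct (Len k) vs r = put_length (word_reg k) r"

text \<open>Variables without a register have value 0, which matches the \<open>Skip\<close> in
  \<open>ct\<close> and the initial environment. Registers 0 and 1 are reserved for the two words,
  hence \<open>2 \<le> r\<close>.\<close>

definition stored :: "(bool \<Rightarrow> bool list) \<Rightarrow> (nat \<Rightarrow> nat) \<Rightarrow> nat list \<Rightarrow> nat \<Rightarrow> regs \<Rightarrow> bool" where
  "stored W \<rho> vs r \<sigma> \<longleftrightarrow> 2 \<le> r \<and> (\<forall>i \<ge> r. \<sigma> i = []) \<and> (\<forall>k. \<sigma> (word_reg k) = W k) \<and>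
     (\<forall>v \<in> set vs. v < r) \<and> (\<forall>j < length vs. \<sigma> (vs ! j) = unary (\<rho> j)) \<and>
     (\<forall>j \<ge> length vs. \<rho> j = 0)"

lemma word_reg_less: "word_reg k < 2"
  by (auto simp: word_reg_def)

lemma stored_Suc: "stored W \<rho> vs r \<sigma> \<Longrightarrow> stored W \<rho> vs (Suc r) (\<sigma>(r := w))"
  using word_reg_less
  by (auto simp: stored_def nth_mem less_SucI) (metis less_le_trans less_irrefl nth_mem)+

lemma stored_push:
  assumes "stored W \<rho> vs r \<sigma>"
  shows "stored W (case_nat i \<rho>) ((r + 2) # vs) (r + 3) (\<sigma>(r := w, r + 1 := w', r + 2 := unary i))"
proof -
  have "stored W \<rho> vs (Suc (Suc (Suc r))) (\<sigma>(r := w, Suc r := w', Suc (Suc r) := unary i))"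
    using assms by (intro stored_Suc)
  then show ?thesis
    by (auto simp: stored_def nth_Cons numeral_eq_Suc split: nat.splits)
qed

lemma runs_lookup:
  assumes "a < r" "\<sigma> (r + 1) = unary m" "\<sigma> r = []" "\<sigma> (r + 2) = []"
  shows "runs (lookup a r) \<sigma> (m * 10 + length (\<sigma> a) * 7 + 6)
     (\<sigma>(r + 1 := [], r := unary (of_bool (m < length (\<sigma> a) \<and> \<sigma> a ! m))))"
proof -
  let ?w = "\<sigma> a"
  let ?f = "\<lambda>j. \<sigma>(r + 1 := unary (m - j), a := drop j ?w, r + 2 := rev (take j ?w))"
  have "runs (Seq (Pop (r + 1)) (IfTop a None Skip (move_top a (r + 2)))) (?f j) (1 + (5 + 2)) (?f (Suc j))"
    if "j < m" for j
  proof (rule runs_Seq[OF runs_Pop])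
    let ?g = "(?f j)(r + 1 := tl ((?f j) (r + 1)))"
    have g: "?g = \<sigma>(r + 1 := unary (m - Suc j), a := drop j ?w, r + 2 := rev (take j ?w))"
      using assms(1) that by (auto simp: unary_pred)
    show "runs (IfTop a None Skip (move_top a (r + 2))) ?g (5 + 2) (?f (Suc j))"
    proof (rule runs_IfTop)
      assume "stack_top (?g a) = None"
      then have "?f (Suc j) = ?g" using assms(1) by (auto simp: g)
      then show "runs Skip ?g 5 (?f (Suc j))" using runs_mono[OF runs_Skip[of ?g]] by simp
    next
      assume "stack_top (?g a) \<noteq> None"
      then have j: "j < length ?w" using assms(1) by auto
      then have "?f (Suc j) = ?g(a := drop (Suc j) ?w, r + 2 := ?w ! j # ?g (r + 2))"
        using assms(1) by (auto simp: g take_Suc_conv_app_nth)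
      then show "runs (move_top a (r + 2)) ?g 5 (?f (Suc j))"
        using runs_move_top[of a "r + 2" ?g "?w ! j" "drop (Suc j) ?w"] assms(1) j
        by (simp add: Cons_nth_drop_Suc)
    qed
  qed
  then have 1: "runs (While (r + 1) (Seq (Pop (r + 1)) (IfTop a None Skip (move_top a (r + 2))))) (?f 0)
      (m * (1 + (5 + 2) + 2) + 1) (?f m)"
    using assms(1) by (intro runs_While[where f = ?f]) auto
  have f0: "?f 0 = \<sigma>" using assms by auto
  let ?h = "(?f m)(r := unary (of_bool (m < length ?w \<and> ?w ! m)))"
  have top: "stack_top ((?f m) a) = Some True \<longleftrightarrow> m < length ?w \<and> ?w ! m"
    using assms(1) by (cases "m < length ?w") (auto simp: Cons_nth_drop_Suc[symmetric])
  have 2: "runs (IfTop a (Some True) (Push r True) Skip) (?f m) (2 + 2) ?h"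
  proof (rule runs_IfTop)
    assume "stack_top ((?f m) a) = Some True"
    then have "?h = (?f m)(r := True # (?f m) r)" using top assms by auto
    then show "runs (Push r True) (?f m) 2 ?h" using runs_Push[of r True "?f m"] by simp
  next
    assume "stack_top ((?f m) a) \<noteq> Some True"
    then have "?h = ?f m" using top assms by auto
    then show "runs Skip (?f m) 2 ?h" using runs_mono[OF runs_Skip[of "?f m"]] by simp
  qed
  have "runs (move_all (r + 2) a) ?h (length (?h (r + 2)) * 7 + 1) (?h(r + 2 := [], a := rev (?h (r + 2)) @ ?h a))"
    using runs_move_all[of "r + 2" a ?h] assms(1) by simp
  moreover have "?h(r + 2 := [], a := rev (?h (r + 2)) @ ?h a) =
     \<sigma>(r + 1 := [], r := unary (of_bool (m < length (\<sigma> a) \<and> \<sigma> a ! m)))"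
    using assms by (auto simp: fun_eq_iff)
  moreover have "length (?h (r + 2)) * 7 + 1 \<le> length ?w * 7 + 1" by simp
  ultimately have 3: "runs (move_all (r + 2) a) ?h (length ?w * 7 + 1)
     (\<sigma>(r + 1 := [], r := unary (of_bool (m < length (\<sigma> a) \<and> \<sigma> a ! m))))"
    by (simp only: runs_mono)
  show ?thesis unfolding lookup_def using runs_Seq[OF 1[unfolded f0] runs_Seq[OF 2 3]]
    by (rule runs_mono) simp
qed

lemma runs_put_length:
  assumes "a < r" "\<sigma> r = []" "\<sigma> (r + 1) = []"
  shows "runs (put_length a r) \<sigma> (length (\<sigma> a) * 16 + 2) (\<sigma>(r := unary (length (\<sigma> a))))"
proof -
  let ?w = "\<sigma> a"
  let ?f = "\<lambda>j. \<sigma>(r := unary j, a := drop j ?w, r + 1 := rev (take j ?w))"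
  have "runs (Seq (move_top a (r + 1)) (Push r True)) (?f j) (5 + 2) (?f (Suc j))" if "j < length ?w" for j
  proof -
    let ?g = "(?f j)(a := drop (Suc j) ?w, r + 1 := ?w ! j # (?f j) (r + 1))"
    have "?f (Suc j) = ?g(r := True # ?g r)"
      using assms(1) that by (auto simp: take_Suc_conv_app_nth)
    moreover have "runs (move_top a (r + 1)) (?f j) 5 ?g"
      using runs_move_top[of a "r + 1" "?f j" "?w ! j" "drop (Suc j) ?w"] assms(1) that
      by (simp add: Cons_nth_drop_Suc)
    ultimately show ?thesis using runs_Seq[OF _ runs_Push[of r True ?g], of _ "?f j" 5] by (simp only:)
  qed
  then have 1: "runs (While a (Seq (move_top a (r + 1)) (Push r True))) (?f 0)
      (length ?w * (5 + 2 + 2) + 1) (?f (length ?w))"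
    using assms(1) by (intro runs_While[where f = ?f]) auto
  have f0: "?f 0 = \<sigma>" using assms by auto
  let ?h = "?f (length ?w)"
  have "runs (move_all (r + 1) a) ?h (length (?h (r + 1)) * 7 + 1) (?h(r + 1 := [], a := rev (?h (r + 1)) @ ?h a))"
    using runs_move_all[of "r + 1" a ?h] assms(1) by simp
  moreover have "?h(r + 1 := [], a := rev (?h (r + 1)) @ ?h a) = \<sigma>(r := unary (length (\<sigma> a)))"
    using assms by (auto simp: fun_eq_iff)
  moreover have "length (?h (r + 1)) = length ?w" by simp
  ultimately have 2: "runs (move_all (r + 1) a) ?h (length ?w * 7 + 1) (\<sigma>(r := unary (length (\<sigma> a))))"
    by metis
  show ?thesis unfolding put_length_def using runs_Seq[OF 1[unfolded f0] 2] by (rule runs_mono) simp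
qed

lemma stored_empty: "stored W \<rho> vs r \<sigma> \<Longrightarrow> r \<le> i \<Longrightarrow> \<sigma> i = []"
  by (simp add: stored_def)

lemma stored_word: "stored W \<rho> vs r \<sigma> \<Longrightarrow> \<sigma> (word_reg k) = W k \<and> word_reg k < r"
  using word_reg_less[of k] by (auto simp: stored_def)

lemma runs_Cst: "runs ((Seq (Push r True) ^^ n) Skip) \<sigma> (n * 2) (\<sigma>(r := unary n @ \<sigma> r))"
proof (induction n arbitrary: \<sigma>)
  case 0
  then show ?case by (simp add: runs_Skip)
next
  case (Suc n)
  have "(\<sigma>(r := True # \<sigma> r))(r := unary n @ (\<sigma>(r := True # \<sigma> r)) r) = \<sigma>(r := unary (Suc n) @ \<sigma> r)"
    by (simp add: replicate_app_Cons_same)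
  then have "runs (Seq (Push r True) ((Seq (Push r True) ^^ n) Skip)) \<sigma> (Suc n * 2) (\<sigma>(r := unary (Suc n) @ \<sigma> r))"
    using runs_Seq[OF runs_Push[of r True \<sigma>] Suc.IH[of "\<sigma>(r := True # \<sigma> r)"]]
    by (simp only: mult_Suc)
  then show ?case unfolding funpow.simps o_apply .
qed

definition time_bound :: "tm \<Rightarrow> nat poly \<Rightarrow> bool" where
  "time_bound t Q \<longleftrightarrow> (\<forall>W \<rho> s vs r \<sigma>. env_le W \<rho> s \<longrightarrow> stored W \<rho> vs r \<sigma> \<longrightarrow>
     runs (ct t vs r) \<sigma> (poly Q s) (\<sigma>(r := unary (eval t W \<rho>))))"

lemma time_boundD:
  "time_bound t Q \<Longrightarrow> env_le W \<rho> s \<Longrightarrow> stored W \<rho> vs r \<sigma> \<Longrightarrow>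
    runs (ct t vs r) \<sigma> (poly Q s) (\<sigma>(r := unary (eval t W \<rho>)))"
  by (simp add: time_bound_def)

text \<open>As for values, the body of a \<open>Sum\<close> runs at size \<open>V s + s\<close>, and
  it is repeated at most \<open>V s\<close> times. So the value bounds, which count the rounds of
  loops, make the times polynomial by the same composition.\<close>

lemma time_bound_exists: "\<exists>Q. time_bound t Q"
proof (induction t)
  case (Var j)
  have "runs (ct (Var j) vs r) \<sigma> (poly [:2, 12:] s) (\<sigma>(r := unary (eval (Var j) W \<rho>)))"
    if "env_le W \<rho> s" "stored W \<rho> vs r \<sigma>" for W \<rho> s vs r \<sigma>
  proof (cases "j < length vs")
    case True
    have "runs (copy_unary (vs ! j) r) \<sigma> (\<rho> j * 12 + 2) (\<sigma>(r := unary (\<rho> j)))"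
      using that(2) True by (intro runs_copy_unary) (auto simp: stored_def)
    then show ?thesis using that(1) True by (auto simp: env_le_def elim: runs_mono)
  next
    case False
    then have "\<sigma>(r := unary (eval (Var j) W \<rho>)) = \<sigma>" using that(2) by (auto simp: stored_def)
    then show ?thesis using False runs_mono[OF runs_Skip[of \<sigma>]] by simp
  qed
  then show ?case unfolding time_bound_def by blast
next
  case (Cst n)
  have "runs (ct (Cst n) vs r) \<sigma> (poly [:n * 2:] s) (\<sigma>(r := unary (eval (Cst n) W \<rho>)))"
    if "stored W \<rho> vs r \<sigma>" for W \<rho> s vs r \<sigma>
    using runs_Cst[of n r \<sigma>] stored_empty[OF that, of r] by simp
  then show ?case unfolding time_bound_def by blast
next
  case (Add t t')
  then obtain Q Q' where "time_bound t Q" "time_bound t' Q'" by blast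
  note Q = time_boundD[OF this(1)] and Q' = time_boundD[OF this(2)]
  obtain V where "value_bound t' V" using value_bound_exists by blast
  note V = value_boundD[OF this]
  have "runs (ct (Add t t') vs r) \<sigma> (poly (Q + Q' + V * [:5:] + 1) s) (\<sigma>(r := unary (eval (Add t t') W \<rho>)))"
    if e: "env_le W \<rho> s" and st: "stored W \<rho> vs r \<sigma>" for W \<rho> s vs r \<sigma>
  proof -
    let ?n = "eval t W \<rho>" and ?m = "eval t' W \<rho>"
    let ?g = "\<sigma>(r := unary ?n)"
    let ?h = "?g(r + 1 := unary ?m)"
    have 2: "runs (ct t' vs (r + 1)) ?g (poly Q' s) ?h"
      using Q'[OF e stored_Suc[OF st]] by simp
    have "runs (move_unary (r + 1) r) ?h (?m * 5 + 1) (?h(r + 1 := [], r := unary ?m @ ?h r))"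
      by (intro runs_move_unary) auto
    moreover have "?h(r + 1 := [], r := unary ?m @ ?h r) = \<sigma>(r := unary (eval (Add t t') W \<rho>))"
      using stored_empty[OF st, of "r + 1"] by (auto simp: fun_eq_iff replicate_add[symmetric] add.commute)
    ultimately have 3: "runs (move_unary (r + 1) r) ?h (?m * 5 + 1) (\<sigma>(r := unary (eval (Add t t') W \<rho>)))"
      by (simp only:)
    show ?thesis unfolding ct.simps using runs_Seq[OF Q[OF e st] runs_Seq[OF 2 3]]
      by (rule runs_mono) (use V[OF e] in simp)
  qed
  then show ?case unfolding time_bound_def by blast
next
  case (Sub t t')
  then obtain Q Q' where "time_bound t Q" "time_bound t' Q'" by blast
  note Q = time_boundD[OF this(1)] and Q' = time_boundD[OF this(2)]
  obtain V where "value_bound t' V" using value_bound_exists by blast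
  note V = value_boundD[OF this]
  have "runs (ct (Sub t t') vs r) \<sigma> (poly (Q + Q' + V * [:4:] + 1) s) (\<sigma>(r := unary (eval (Sub t t') W \<rho>)))"
    if e: "env_le W \<rho> s" and st: "stored W \<rho> vs r \<sigma>" for W \<rho> s vs r \<sigma>
  proof -
    let ?n = "eval t W \<rho>" and ?m = "eval t' W \<rho>"
    let ?g = "\<sigma>(r := unary ?n)"
    \<comment> \<open>Popping an empty register leaves it empty, which is exactly truncated
      subtraction.\<close>
    let ?f = "\<lambda>j. \<sigma>(r := unary (?n - j), r + 1 := unary (?m - j))"
    have f0: "?g(r + 1 := unary ?m) = ?f 0" by simp
    have 2: "runs (ct t' vs (r + 1)) ?g (poly Q' s) (?f 0)"
      using Q'[OF e stored_Suc[OF st]] by simp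
    have "runs (Seq (Pop (r + 1)) (Pop r)) (?f j) (1 + 1) (?f (Suc j))" for j
    proof (rule runs_Seq[OF runs_Pop])
      let ?k = "(?f j)(r + 1 := tl ((?f j) (r + 1)))"
      have "?f (Suc j) = ?k(r := tl (?k r))" by (auto simp: fun_eq_iff)
      then show "runs (Pop r) ?k 1 (?f (Suc j))" using runs_Pop[of r ?k] by (simp only:)
    qed
    then have "runs (While (r + 1) (Seq (Pop (r + 1)) (Pop r))) (?f 0) (?m * (1 + 1 + 2) + 1) (?f ?m)"
      by (intro runs_While[where f = ?f]) auto
    moreover have "?f ?m = \<sigma>(r := unary (eval (Sub t t') W \<rho>))"
      using stored_empty[OF st, of "r + 1"] by (auto simp: fun_eq_iff)
    ultimately have 3: "runs (While (r + 1) (Seq (Pop (r + 1)) (Pop r))) (?f 0) (?m * (1 + 1 + 2) + 1)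
        (\<sigma>(r := unary (eval (Sub t t') W \<rho>)))"
      by (simp only:)
    show ?thesis unfolding ct.simps using runs_Seq[OF Q[OF e st] runs_Seq[OF 2 3]]
      by (rule runs_mono) (use V[OF e] in simp)
  qed
  then show ?case unfolding time_bound_def by blast
next
  case (Sum t t')
  then obtain Q Q' where "time_bound t Q" "time_bound t' Q'" by blast
  note Q = time_boundD[OF this(1)] and Q' = time_boundD[OF this(2)]
  obtain V where "value_bound t V" using value_bound_exists by blast
  note V = value_boundD[OF this]
  obtain V' where "value_bound t' V'" using value_bound_exists by blast
  note V' = value_boundD[OF this]
  let ?P = "Q + V * (pcompose (Q' + V' * [:5:]) (V + [:0, 1:]) + [:6:]) + V * [:3:] + [:2:]"
  have "runs (ct (Sum t t') vs r) \<sigma> (poly ?P s) (\<sigma>(r := unary (eval (Sum t t') W \<rho>)))"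
    if e: "env_le W \<rho> s" and st: "stored W \<rho> vs r \<sigma>" for W \<rho> s vs r \<sigma>
  proof -
    let ?n = "eval t W \<rho>" and ?v = "\<lambda>j. eval t' W (case_nat j \<rho>)" and ?s = "poly V s + s"
    \<comment> \<open>Register \<open>r\<close> accumulates the sum, \<open>r + 1\<close> counts the
      remaining rounds and \<open>r + 2\<close> holds the bound variable; the body works from
      \<open>r + 3\<close> on.\<close>
    let ?f = "\<lambda>j. \<sigma>(r := unary (\<Sum>i<j. ?v i), r + 1 := unary (?n - j), r + 2 := unary j)"
    let ?body = "Seq (Pop (r + 1)) (Seq (ct t' ((r + 2) # vs) (r + 3))
           (Seq (move_unary (r + 3) r) (Push (r + 2) True)))"
    have \<sigma>: "\<sigma> r = []" "\<sigma> (Suc r) = []" "\<sigma> (Suc (Suc r)) = []" "\<sigma> (Suc (Suc (Suc r))) = []"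
      using stored_empty[OF st] by auto
    have "runs ?body (?f j) (1 + (poly Q' ?s + ((poly V' ?s * 5 + 1) + 2))) (?f (Suc j))" if j: "j < ?n" for j
    proof -
      let ?g1 = "\<sigma>(r := unary (\<Sum>i<j. ?v i), r + 1 := unary (?n - Suc j), r + 2 := unary j)"
      let ?g2 = "?g1(r + 3 := unary (?v j))"
      let ?g3 = "?g2(r + 3 := [], r := unary (?v j) @ ?g2 r)"
      have e': "env_le W (case_nat j \<rho>) ?s" using env_le_push[OF e] j V[OF e] by simp
      have "?g1 = (?f j)(r + 1 := tl ((?f j) (r + 1)))" using j by (auto simp: fun_eq_iff)
      then have 1: "runs (Pop (r + 1)) (?f j) 1 ?g1" using runs_Pop[of "r + 1" "?f j"] by (simp only:)
      have 2: "runs (ct t' ((r + 2) # vs) (r + 3)) ?g1 (poly Q' ?s) ?g2"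
        by (rule Q'[OF e' stored_push[OF st]])
      have 3: "runs (move_unary (r + 3) r) ?g2 (poly V' ?s * 5 + 1) ?g3"
        by (rule runs_mono[OF runs_move_unary]) (use V'[OF e'] in auto)
      have "?f (Suc j) = ?g3(r + 2 := True # ?g3 (r + 2))"
        using \<sigma> by (auto simp: fun_eq_iff replicate_add[symmetric] add.commute numeral_eq_Suc)
      then have 4: "runs (Push (r + 2) True) ?g3 2 (?f (Suc j))"
        using runs_Push[of "r + 2" True ?g3] by (simp only:)
      show ?thesis by (intro runs_Seq[OF 1] runs_Seq[OF 2] runs_Seq[OF 3] 4)
    qed
    then have 2: "runs (While (r + 1) ?body) (?f 0)
        (?n * ((1 + (poly Q' ?s + ((poly V' ?s * 5 + 1) + 2))) + 2) + 1) (?f ?n)"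
      by (intro runs_While[where f = ?f]) auto
    have "\<sigma>(r + 1 := unary ?n) = ?f 0" using \<sigma> by (auto simp: fun_eq_iff)
    moreover have "stored W \<rho> vs (r + 1) \<sigma>"
      using stored_Suc[OF st, of "[]"] \<sigma>(1) by (simp add: fun_upd_idem)
    ultimately have 1: "runs (ct t vs (r + 1)) \<sigma> (poly Q s) (?f 0)"
      using Q[OF e] by metis
    have "(?f ?n)(r + 2 := []) = \<sigma>(r := unary (eval (Sum t t') W \<rho>))"
      using \<sigma> by (auto simp: fun_eq_iff)
    moreover have "(?f ?n) (r + 2) = unary ?n" by simp
    ultimately have 3: "runs (clear (r + 2)) (?f ?n) (?n * 3 + 1) (\<sigma>(r := unary (eval (Sum t t') W \<rho>)))"
      using runs_clear[of "r + 2" "?f ?n"] by (metis length_replicate)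
    have "?n * (poly Q' ?s + poly V' ?s * 5 + 6) \<le> poly V s * (poly Q' ?s + poly V' ?s * 5 + 6)"
      using V[OF e] by (rule mult_le_mono1)
    then show ?thesis unfolding ct.simps using runs_Seq[OF 1 runs_Seq[OF 2 3]]
      by (elim runs_mono) (use V[OF e] in \<open>simp add: poly_pcompose algebra_simps\<close>)
  qed
  then show ?case unfolding time_bound_def by blast
next
  case (Bit k t)
  then obtain Q where "time_bound t Q" by blast
  note Q = time_boundD[OF this]
  obtain V where "value_bound t V" using value_bound_exists by blast
  note V = value_boundD[OF this]
  have "runs (ct (Bit k t) vs r) \<sigma> (poly (Q + V * [:10:] + [:6, 7:]) s) (\<sigma>(r := unary (eval (Bit k t) W \<rho>)))"
    if e: "env_le W \<rho> s" and st: "stored W \<rho> vs r \<sigma>" for W \<rho> s vs r \<sigma>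
  proof -
    let ?n = "eval t W \<rho>" and ?a = "word_reg k"
    let ?g = "\<sigma>(r + 1 := unary ?n)"
    have \<sigma>: "\<sigma> r = []" "\<sigma> (Suc r) = []" "\<sigma> (Suc (Suc r)) = []" "\<sigma> ?a = W k" "?a < r"
      using stored_empty[OF st] stored_word[OF st] by auto
    have "stored W \<rho> vs (r + 1) \<sigma>"
      using stored_Suc[OF st, of "[]"] \<sigma>(1) by (simp add: fun_upd_idem)
    then have 1: "runs (ct t vs (r + 1)) \<sigma> (poly Q s) ?g" by (rule Q[OF e])
    have g: "?g ?a = W k" using \<sigma> by simp
    have "runs (lookup ?a r) ?g (?n * 10 + length (?g ?a) * 7 + 6)
        (?g(r + 1 := [], r := unary (of_bool (?n < length (?g ?a) \<and> ?g ?a ! ?n))))"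
      by (rule runs_lookup) (use \<sigma> in auto)
    moreover have "?g(r + 1 := [], r := unary (of_bool (?n < length (?g ?a) \<and> ?g ?a ! ?n))) =
        \<sigma>(r := unary (eval (Bit k t) W \<rho>))"
      unfolding g using \<sigma>(2) by (auto simp: fun_eq_iff)
    ultimately have 2: "runs (lookup ?a r) ?g (?n * 10 + length (W k) * 7 + 6) (\<sigma>(r := unary (eval (Bit k t) W \<rho>)))"
      by (simp only: g)
    have "length (W k) \<le> s" using e by (auto simp: env_le_def)
    then show ?thesis unfolding ct.simps using runs_Seq[OF 1 2] V[OF e] by (elim runs_mono) simp
  qed
  then show ?case unfolding time_bound_def by blast
next
  case (Len k)
  have "runs (ct (Len k) vs r) \<sigma> (poly [:2, 16:] s) (\<sigma>(r := unary (eval (Len k) W \<rho>)))"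
    if e: "env_le W \<rho> s" and st: "stored W \<rho> vs r \<sigma>" for W \<rho> s vs r \<sigma>
  proof -
    have "runs (put_length (word_reg k) r) \<sigma> (length (\<sigma> (word_reg k)) * 16 + 2) (\<sigma>(r := unary (length (\<sigma> (word_reg k)))))"
      by (rule runs_put_length) (use stored_empty[OF st] stored_word[OF st] in auto)
    moreover have "length (W k) \<le> s" using e by (auto simp: env_le_def)
    ultimately show ?thesis using stored_word[OF st, of k] by (auto elim: runs_mono)
  qed
  then show ?case unfolding time_bound_def by blast
qed

section \<open>From terms to polynomial-time predicates\<close>

lemma holds_init:
  "2 \<le> k \<Longrightarrow> holds k (snd (init (machine k P q y n) ws)) (\<lambda>i. if i < length ws then ws ! i else [])"
  by (auto simp: holds_def init_def machine_def holds_word_word_tape)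

text \<open>The 1 is inserted because a machine has at least two tapes.\<close>

definition reg_bound :: "com \<Rightarrow> nat" where
  "reg_bound c = Max (insert 1 (regs_of c)) + 1"

lemma finite_regs_of [simp]: "finite (regs_of c)"
  by (induction c) auto

lemma reg_bound: "2 \<le> reg_bound c" "regs_of c \<subseteq> {..<reg_bound c}"
proof -
  have "1 \<le> Max (insert 1 (regs_of c))" by (intro Max_ge) auto
  then show "2 \<le> reg_bound c" by (simp add: reg_bound_def)
  have "i \<le> Max (insert 1 (regs_of c))" if "i \<in> regs_of c" for i
    using that by (intro Max_ge) auto
  then show "regs_of c \<subseteq> {..<reg_bound c}" by (auto simp: reg_bound_def less_Suc_eq_le)
qed

text \<open>The oracle is arbitrary because the query state \<open>csize c + 1\<close> lies outside
  the code.\<close>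

lemma computes_within_com:
  assumes "runs c (\<lambda>i. if i < length ws then ws ! i else []) T \<sigma>'" "\<sigma>' 0 = w"
  shows "computes_within (machine (reg_bound c) (compile c 0) (csize c + 1) 0 0) A ws T w"
proof -
  let ?k = "reg_bound c"
  let ?M = "machine ?k (compile c 0) (csize c + 1) 0 0"
  obtain t where t: "t \<le> T" "exec c (\<lambda>i. if i < length ws then ws ! i else []) t \<sigma>'"
    using assms(1) by (auto simp: runs_def)
  have "code_at (compile c 0) (csize c + 1) 0 (compile c 0)" by (auto simp: code_at_def)
  from compile_correct[OF t(2) this reg_bound(2) holds_init[OF reg_bound(1)],
      of 0 0 A "compile c 0" "csize c + 1" 0 0] obtain ts where
    ts: "(step ?M A ^^ t) (0, snd (init ?M ws)) = (csize c, ts)" "holds ?k ts \<sigma>'" by auto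
  have "init ?M ws = (0, snd (init ?M ws))" by (simp add: init_def machine_def)
  with ts(1) have "(step ?M A ^^ t) (init ?M ws) = (halt ?M, ts)" by (simp add: machine_def)
  moreover have "holds_word (ts ! 0) w" using ts(2) assms(2) reg_bound(1)[of c] by (auto simp: holds_def)
  ultimately show ?thesis using t(1) by (auto simp: computes_within_def)
qed

lemma otm_com: "otm (machine (reg_bound c) (compile c 0) (csize c + 1) 0 0)"
  by (rule otm_machine) (use reg_bound(1) compile_targets in force)+

definition words :: "bool list \<Rightarrow> bool list \<Rightarrow> bool \<Rightarrow> bool list" where
  "words x u = (\<lambda>k. if k then u else x)"

lemma polytime_decidable2_eval: "polytime_decidable2 (\<lambda>x u. eval t (words x u) (\<lambda>_. 0) \<noteq> 0)"
proof -
  obtain Q where "time_bound t Q" using time_bound_exists by blast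
  note Q = time_boundD[OF this]
  let ?c = "Seq (ct t [] 2) (Seq (clear 0) (IfTop 2 None (Push 0 False) (Push 0 True)))"
  let ?M = "machine (reg_bound ?c) (compile ?c 0) (csize ?c + 1) 0 0"
  \<comment> \<open>The output is read from tape 0, so the input there is erased first: 3 steps per
    bit and 1 to stop. The final test adds 4.\<close>
  have "computes_within ?M {} [x, u] (poly (Q + [:5, 3:]) (length x + length u))
      [eval t (words x u) (\<lambda>_. 0) \<noteq> 0]" for x u
  proof -
    let ?\<sigma> = "\<lambda>i. if i < length [x, u] then [x, u] ! i else []"
    let ?s = "length x + length u" and ?n = "eval t (words x u) (\<lambda>_. 0)"
    let ?g = "?\<sigma>(2 := unary ?n)"
    let ?h = "?g(0 := [])"
    have "stored (words x u) (\<lambda>_. 0) [] 2 ?\<sigma>" by (auto simp: stored_def word_reg_def words_def)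
    moreover have "env_le (words x u) (\<lambda>_. 0) ?s" by (auto simp: env_le_def words_def)
    ultimately have 1: "runs (ct t [] 2) ?\<sigma> (poly Q ?s) ?g" using Q by blast
    have 2: "runs (clear 0) ?g (length x * 3 + 1) ?h" using runs_clear[of 0 ?g] by simp
    have 3: "runs (IfTop 2 None (Push 0 False) (Push 0 True)) ?h (2 + 2) (?h(0 := [?n \<noteq> 0]))"
    proof (rule runs_IfTop)
      assume "stack_top (?h 2) = None"
      then show "runs (Push 0 False) ?h 2 (?h(0 := [?n \<noteq> 0]))" using runs_Push[of 0 False ?h] by simp
    next
      assume "stack_top (?h 2) \<noteq> None"
      then show "runs (Push 0 True) ?h 2 (?h(0 := [?n \<noteq> 0]))" using runs_Push[of 0 True ?h] by simp
    qed
    have "runs ?c ?\<sigma> (poly (Q + [:5, 3:]) ?s) (?h(0 := [?n \<noteq> 0]))"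
      by (rule runs_mono[OF runs_Seq[OF 1 runs_Seq[OF 2 3]]]) simp
    then show ?thesis by (rule computes_within_com) simp
  qed
  then show ?thesis unfolding polytime_decidable2_def using otm_com[of ?c] by blast
qed

section \<open>Greedy search with an oracle\<close>

text \<open>Queries are reversed because the machine extends them at the head.\<close>

inductive greedy :: "bool list set \<Rightarrow> bool list \<Rightarrow> bool list \<Rightarrow> bool" for A x where
  greedy_Nil: "greedy A x []"
| greedy_True: "greedy A x p \<Longrightarrow> rev (x @ p @ [True]) \<in> A \<Longrightarrow> greedy A x (p @ [True])"
| greedy_False: "greedy A x p \<Longrightarrow> rev (x @ p @ [True]) \<notin> A \<Longrightarrow> rev (x @ p @ [False]) \<in> A \<Longrightarrow>
    greedy A x (p @ [False])"

definition greedy_max :: "bool list set \<Rightarrow> bool list \<Rightarrow> bool list \<Rightarrow> bool" where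
  "greedy_max A x p \<longleftrightarrow> greedy A x p \<and> (\<forall>b. rev (x @ p @ [b]) \<notin> A)"

text \<open>Reads \<open>out\<close> off a word \<open>1^m 0 out^R\<close>; a word that has not yet
  reached its separator gives the empty word.\<close>

definition result :: "bool list \<Rightarrow> bool list" where
  "result p = rev (tl (dropWhile id p))"

lemma dropWhile_id_Nil: "dropWhile id p = [] \<longleftrightarrow> False \<notin> set p"
  by (auto simp: dropWhile_eq_Nil_conv) (metis (full_types))

text \<open>Behind the separator, an accepted bit is simply pushed on the output stack. This is why
  outputs are searched for in reverse order.\<close>

lemma result_snoc:
  "result (p @ [b]) = (if False \<in> set p then b # result p else [])"
proof (cases "False \<in> set p")
  case True
  then have "dropWhile id (p @ [b]) = dropWhile id p @ [b]"
    by (metis (full_types) dropWhile_append1 id_apply)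
  then show ?thesis using True dropWhile_id_Nil[of p] by (simp add: result_def)
next
  case False
  then have "dropWhile id (p @ [b]) = dropWhile id [b]" by (intro dropWhile_append2) (metis (full_types) id_apply)
  then show ?thesis using False by (simp add: result_def)
qed

text \<open>Register 0 collects the output, 1 holds the query, 2 is nonempty when the search has ended,
  and 3 is nonempty when \<open>False\<close> occurs in the accepted word.\<close>

definition prepare :: com where
  "prepare = Seq (move_all 0 1) (Push 1 True)"

definition on_yes :: com where
  "on_yes = Seq (IfTop 3 None (IfTop 1 (Some True) Skip (Push 3 True))
                              (IfTop 1 (Some True) (Push 0 True) (Push 0 False)))
                (Push 1 True)"

definition on_no :: com where
  "on_no = IfTop 1 (Some True) (Seq (Pop 1) (Push 1 False)) (Push 2 True)"

text \<open>The first \<open>branch\<close> only fills the address of the query state, where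
  \<open>step\<close> consults the oracle instead. The two answers enter the two blocks behind it:
  one ends with a jump back to the query, the other with a jump either there or to the end of the
  code, which is the halting state.\<close>

definition greedy_code :: "instr list" where
  "greedy_code = compile prepare 0 @ branch 0 (\<lambda>_. 0) # compile on_yes (csize prepare + 1) @
     branch 0 (\<lambda>_. csize prepare) # compile on_no (csize prepare + csize on_yes + 2) @
     [branch 2 (\<lambda>s. if s = None then csize prepare else csize prepare + csize on_yes + csize on_no + 3)]"

definition greedy_machine :: otm where
  "greedy_machine = machine 4 greedy_code (csize prepare) (csize prepare + 1) (csize prepare + csize on_yes + 2)"

lemma length_greedy_code: "length greedy_code = csize prepare + csize on_yes + csize on_no + 3"
  by (simp add: greedy_code_def)

lemma otm_greedy_machine: "otm greedy_machine"
  unfolding greedy_machine_def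
proof (rule otm_machine)
  fix i f g s
  assume "(i, f, g) \<in> set greedy_code"
  then consider "(i, f, g) \<in> set (compile prepare 0)" | "g = (\<lambda>_. 0)"
    | "(i, f, g) \<in> set (compile on_yes (csize prepare + 1))" | "g = (\<lambda>_. csize prepare)"
    | "(i, f, g) \<in> set (compile on_no (csize prepare + csize on_yes + 2))"
    | "g = (\<lambda>s. if s = None then csize prepare else csize prepare + csize on_yes + csize on_no + 3)"
    unfolding greedy_code_def by (auto simp: branch_def)
  then show "g s \<le> length greedy_code"
    by cases (auto simp: length_greedy_code dest: compile_targets[where s = s])
qed (auto simp: length_greedy_code)

lemma code_at_greedy:
  "code_at greedy_code (csize prepare) 0 (compile prepare 0)"
  "code_at greedy_code (csize prepare) (csize prepare + 1)
     (compile on_yes (csize prepare + 1) @ [branch 0 (\<lambda>_. csize prepare)])"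
  "code_at greedy_code (csize prepare) (csize prepare + csize on_yes + 2)
     (compile on_no (csize prepare + csize on_yes + 2) @
     [branch 2 (\<lambda>s. if s = None then csize prepare else csize prepare + csize on_yes + csize on_no + 3)])"
proof -
  let ?q = "csize prepare"
  let ?y = "compile on_yes (?q + 1) @ [branch 0 (\<lambda>_. ?q)]"
  let ?n = "compile on_no (?q + csize on_yes + 2) @
    [branch 2 (\<lambda>s. if s = None then ?q else ?q + csize on_yes + csize on_no + 3)]"
  let ?d = "branch 0 (\<lambda>_. 0)"
  show "code_at greedy_code ?q 0 (compile prepare 0)"
    by (rule code_atI[of _ "[]" _ "?d # ?y @ ?n"]) (auto simp: greedy_code_def)
  show "code_at greedy_code ?q (?q + 1) ?y"
    by (rule code_atI[of _ "compile prepare 0 @ [?d]" _ ?n]) (auto simp: greedy_code_def)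
  show "code_at greedy_code ?q (?q + csize on_yes + 2) ?n"
    by (rule code_atI[of _ "compile prepare 0 @ ?d # ?y" _ "[]"]) (auto simp: greedy_code_def)
qed

lemma regs_of_greedy: "regs_of prepare \<subseteq> {..<4}" "regs_of on_yes \<subseteq> {..<4}" "regs_of on_no \<subseteq> {..<4}"
  by (auto simp: prepare_def on_yes_def on_no_def move_all_def move_top_def)

text \<open>The invariant at the query state: \<open>p\<close> is accepted and \<open>b\<close> is
  the bit under trial. It is the top of the query stack, so it can be replaced when refused.\<close>

definition trying :: "bool list \<Rightarrow> bool list \<Rightarrow> bool \<Rightarrow> regs \<Rightarrow> bool" where
  "trying x p b \<sigma> \<longleftrightarrow> \<sigma> 0 = result p \<and> \<sigma> 1 = rev (x @ p @ [b]) \<and> \<sigma> 2 = [] \<and>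
     \<sigma> 3 = (if False \<in> set p then [True] else [])"

lemma runs_on_yes:
  assumes "trying x p b \<sigma>"
  shows "\<exists>\<sigma>'. runs on_yes \<sigma> 8 \<sigma>' \<and> trying x (p @ [b]) True \<sigma>'"
proof -
  let ?g = "\<sigma>(0 := result (p @ [b]), 3 := (if False \<in> set (p @ [b]) then [True] else []))"
  have \<sigma>: "\<sigma> 0 = result p" "stack_top (\<sigma> 1) = Some b" "\<sigma> 3 = (if False \<in> set p then [True] else [])"
    using assms by (auto simp: trying_def)
  have "runs (IfTop 3 None (IfTop 1 (Some True) Skip (Push 3 True))
      (IfTop 1 (Some True) (Push 0 True) (Push 0 False))) \<sigma> (2 + 2 + 2) ?g"
  proof (rule runs_IfTop)
    assume "stack_top (\<sigma> 3) = None"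
    then have p: "False \<notin> set p" by (cases "False \<in> set p") (simp_all add: \<sigma>(3))
    then have "dropWhile id p = []" using dropWhile_id_Nil by blast
    then have r: "result p = []" by (simp only: result_def list.sel rev.simps)
    show "runs (IfTop 1 (Some True) Skip (Push 3 True)) \<sigma> (2 + 2) ?g"
    proof (rule runs_IfTop)
      assume "stack_top (\<sigma> 1) = Some True"
      then have "?g = \<sigma>" using \<sigma> p r by (auto simp: fun_eq_iff result_snoc)
      then show "runs Skip \<sigma> 2 ?g" using runs_mono[OF runs_Skip[of \<sigma>]] by simp
    next
      assume "stack_top (\<sigma> 1) \<noteq> Some True"
      then have "?g = \<sigma>(3 := True # \<sigma> 3)" using \<sigma> p r by (auto simp: fun_eq_iff result_snoc)
      then show "runs (Push 3 True) \<sigma> 2 ?g" using runs_Push[of 3 True \<sigma>] by (simp only:)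
    qed
  next
    assume "stack_top (\<sigma> 3) \<noteq> None"
    then have p: "False \<in> set p" by (cases "False \<in> set p") (simp_all add: \<sigma>(3))
    then have g: "?g = \<sigma>(0 := b # \<sigma> 0)" using \<sigma> by (auto simp: fun_eq_iff result_snoc)
    show "runs (IfTop 1 (Some True) (Push 0 True) (Push 0 False)) \<sigma> (2 + 2) ?g"
    proof (rule runs_IfTop)
      assume "stack_top (\<sigma> 1) = Some True"
      then show "runs (Push 0 True) \<sigma> 2 ?g" unfolding g using runs_Push[of 0 True \<sigma>] \<sigma>(2) by simp
    next
      assume "stack_top (\<sigma> 1) \<noteq> Some True"
      then show "runs (Push 0 False) \<sigma> 2 ?g" unfolding g using runs_Push[of 0 False \<sigma>] \<sigma>(2) by simp
    qed
  qed
  from runs_Seq[OF this runs_Push[of 1 True]] have "runs on_yes \<sigma> 8 (?g(1 := True # ?g 1))"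
    unfolding on_yes_def by (rule runs_mono) simp
  moreover have "trying x (p @ [b]) True (?g(1 := True # ?g 1))"
    using assms by (auto simp: trying_def)
  ultimately show ?thesis by blast
qed

lemma runs_on_no_True:
  assumes "trying x p True \<sigma>"
  shows "\<exists>\<sigma>'. runs on_no \<sigma> 5 \<sigma>' \<and> trying x p False \<sigma>'"
proof -
  let ?g = "\<sigma>(1 := tl (\<sigma> 1))"
  let ?h = "?g(1 := False # ?g 1)"
  have "runs on_no \<sigma> (1 + 2 + 2) ?h" unfolding on_no_def
    by (rule runs_IfTop) (use assms runs_Seq[OF runs_Pop[of 1 \<sigma>] runs_Push[of 1 False ?g]] in \<open>auto simp: trying_def\<close>)
  then have "runs on_no \<sigma> 5 ?h" by (rule runs_mono) simp
  moreover have "trying x p False ?h" using assms by (auto simp: trying_def)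
  ultimately show ?thesis by blast
qed

lemma runs_on_no_False:
  assumes "trying x p False \<sigma>"
  shows "runs on_no \<sigma> 4 (\<sigma>(2 := True # \<sigma> 2))"
proof -
  have "runs on_no \<sigma> (2 + 2) (\<sigma>(2 := True # \<sigma> 2))" unfolding on_no_def
    by (rule runs_IfTop) (use assms runs_Push[of 2 True \<sigma>] in \<open>auto simp: trying_def\<close>)
  then show ?thesis by (rule runs_mono) simp
qed

section \<open>Runs of the oracle machine\<close>

definition reaches :: "bool list set \<Rightarrow> nat \<Rightarrow> config \<Rightarrow> config \<Rightarrow> bool" where
  "reaches A T c c' \<longleftrightarrow> (\<exists>t \<le> T. (step greedy_machine A ^^ t) c = c')"

lemma reaches_trans: "reaches A T c c' \<Longrightarrow> reaches A T' c' c'' \<Longrightarrow> reaches A (T + T') c c''"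
  unfolding reaches_def by (meson add_mono funpow_trans)

lemma reaches_mono: "reaches A T c c' \<Longrightarrow> T \<le> T' \<Longrightarrow> reaches A T' c c'"
  unfolding reaches_def using le_trans by blast

lemma reaches_step: "step greedy_machine A c = c' \<Longrightarrow> reaches A 1 c c'"
  unfolding reaches_def by (intro exI[of _ 1]) simp

lemma reaches_runs:
  assumes "runs c \<sigma> T \<sigma>'" "code_at greedy_code (csize prepare) b (compile c b)"
    "regs_of c \<subseteq> {..<4}" "holds 4 ts \<sigma>"
  shows "\<exists>ts'. reaches A T (b, ts) (b + csize c, ts') \<and> holds 4 ts' \<sigma>'"
proof -
  from assms(1) obtain t where "t \<le> T" "exec c \<sigma> t \<sigma>'" by (auto simp: runs_def)
  with compile_correct[OF _ assms(2-4)] show ?thesis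
    unfolding reaches_def greedy_machine_def by metis
qed

lemma step_query:
  assumes "holds 4 ts \<sigma>"
  shows "step greedy_machine A (csize prepare, ts) =
     (if \<sigma> 1 \<in> A then csize prepare + 1 else csize prepare + csize on_yes + 2, ts)"
proof -
  have "holds_word (ts ! 1) (\<sigma> 1)" using assms by (auto simp: holds_def)
  then have "(\<exists>w \<in> A. holds_word (ts ! 1) w) \<longleftrightarrow> \<sigma> 1 \<in> A" using holds_word_unique by blast
  then show ?thesis by (simp add: step.simps greedy_machine_def machine_def length_greedy_code)
qed

lemma reaches_yes:
  assumes "holds 4 ts \<sigma>" "trying x p b \<sigma>" "rev (x @ p @ [b]) \<in> A"
  shows "\<exists>ts' \<sigma>'. reaches A 10 (csize prepare, ts) (csize prepare, ts') \<and> holds 4 ts' \<sigma>' \<and> trying x (p @ [b]) True \<sigma>'"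
proof -
  let ?q = "csize prepare"
  have 1: "reaches A 1 (?q, ts) (?q + 1, ts)"
    using assms by (intro reaches_step) (auto simp: step_query trying_def)
  obtain \<sigma>' where \<sigma>': "runs on_yes \<sigma> 8 \<sigma>'" "trying x (p @ [b]) True \<sigma>'" using runs_on_yes[OF assms(2)] by blast
  have c: "code_at greedy_code ?q (?q + 1) (compile on_yes (?q + 1))"
    "code_at greedy_code ?q (?q + 1 + csize on_yes) [branch 0 (\<lambda>_. ?q)]"
    using code_at_greedy(2) by (auto simp: code_at_append)
  obtain ts' where ts': "reaches A 8 (?q + 1, ts) (?q + 1 + csize on_yes, ts')" "holds 4 ts' \<sigma>'"
    using reaches_runs[OF \<sigma>'(1) c(1) regs_of_greedy(2) assms(1)] by blast
  have "reaches A 1 (?q + 1 + csize on_yes, ts') (?q, ts')"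
    by (rule reaches_step) (use step_branch[OF ts'(2) c(2)] in \<open>simp add: greedy_machine_def\<close>)
  from reaches_trans[OF 1 reaches_trans[OF ts'(1) this]] show ?thesis
    using \<sigma>'(2) ts'(2) by (auto intro: reaches_mono)
qed

lemma reaches_no_True:
  assumes "holds 4 ts \<sigma>" "trying x p True \<sigma>" "rev (x @ p @ [True]) \<notin> A"
  shows "\<exists>ts' \<sigma>'. reaches A 7 (csize prepare, ts) (csize prepare, ts') \<and> holds 4 ts' \<sigma>' \<and> trying x p False \<sigma>'"
proof -
  let ?q = "csize prepare" and ?n = "csize prepare + csize on_yes + 2"
  have 1: "reaches A 1 (?q, ts) (?n, ts)"
    using assms by (intro reaches_step) (auto simp: step_query trying_def)
  obtain \<sigma>' where \<sigma>': "runs on_no \<sigma> 5 \<sigma>'" "trying x p False \<sigma>'" using runs_on_no_True[OF assms(2)] by blast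
  have c: "code_at greedy_code ?q ?n (compile on_no ?n)"
    "code_at greedy_code ?q (?n + csize on_no)
       [branch 2 (\<lambda>s. if s = None then ?q else ?q + csize on_yes + csize on_no + 3)]"
    using code_at_greedy(3) by (auto simp: code_at_append)
  obtain ts' where ts': "reaches A 5 (?n, ts) (?n + csize on_no, ts')" "holds 4 ts' \<sigma>'"
    using reaches_runs[OF \<sigma>'(1) c(1) regs_of_greedy(3) assms(1)] by blast
  have "reaches A 1 (?n + csize on_no, ts') (?q, ts')"
    by (rule reaches_step)
      (use step_branch[OF ts'(2) c(2)] \<sigma>'(2) in \<open>simp add: greedy_machine_def trying_def\<close>)
  from reaches_trans[OF 1 reaches_trans[OF ts'(1) this]] show ?thesis
    using \<sigma>'(2) ts'(2) by (auto intro: reaches_mono)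
qed

lemma reaches_no_False:
  assumes "holds 4 ts \<sigma>" "trying x p False \<sigma>" "rev (x @ p @ [False]) \<notin> A"
  shows "\<exists>ts'. reaches A 6 (csize prepare, ts) (halt greedy_machine, ts') \<and> holds_word (ts' ! 0) (result p)"
proof -
  let ?q = "csize prepare" and ?n = "csize prepare + csize on_yes + 2"
  let ?h = "\<sigma>(2 := True # \<sigma> 2)"
  have 1: "reaches A 1 (?q, ts) (?n, ts)"
    using assms by (intro reaches_step) (auto simp: step_query trying_def)
  have c: "code_at greedy_code ?q ?n (compile on_no ?n)"
    "code_at greedy_code ?q (?n + csize on_no)
       [branch 2 (\<lambda>s. if s = None then ?q else ?q + csize on_yes + csize on_no + 3)]"
    using code_at_greedy(3) by (auto simp: code_at_append)
  obtain ts' where ts': "reaches A 4 (?n, ts) (?n + csize on_no, ts')" "holds 4 ts' ?h"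
    using reaches_runs[OF runs_on_no_False[OF assms(2)] c(1) regs_of_greedy(3) assms(1)] by blast
  have "halt greedy_machine = ?q + csize on_yes + csize on_no + 3"
    by (simp add: greedy_machine_def machine_def length_greedy_code)
  then have "reaches A 1 (?n + csize on_no, ts') (halt greedy_machine, ts')"
    by (intro reaches_step)
      (use step_branch[OF ts'(2) c(2)] in \<open>simp add: greedy_machine_def\<close>)
  from reaches_trans[OF 1 reaches_trans[OF ts'(1) this]]
  have "reaches A 6 (?q, ts) (halt greedy_machine, ts')" by (rule reaches_mono) simp
  moreover have "holds_word (ts' ! 0) (?h 0)" using ts'(2) unfolding holds_def by (metis zero_less_numeral)
  ultimately show ?thesis using assms(2) by (auto simp: trying_def)
qed

text \<open>An accepted bit lengthens the greedy path, so \<open>B - length p\<close> decreases. A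
  round costs at most 7 + 10 steps, for a refused 1 followed by an accepted 0, and the final double
  refusal 7 + 6; the factor 20 covers both.\<close>

lemma reaches_greedy:
  assumes B: "\<And>p. p \<noteq> [] \<Longrightarrow> greedy A x p \<Longrightarrow> length p \<le> B"
    and "greedy A x p" "holds 4 ts \<sigma>" "trying x p True \<sigma>"
  shows "\<exists>p' ts'. greedy_max A x p' \<and> reaches A ((B - length p) * 20 + 20) (csize prepare, ts) (halt greedy_machine, ts') \<and>
     holds_word (ts' ! 0) (result p')"
  using assms(2-4)
proof (induction "B - length p" arbitrary: p ts \<sigma> rule: less_induct)
  case less
  show ?case
  proof (cases "rev (x @ p @ [True]) \<in> A")
    case True
    then have l: "Suc (length p) \<le> B" using B[of "p @ [True]"] greedy_True[OF less.prems(1)] by simp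
    obtain ts1 \<sigma>1 where 1: "reaches A 10 (csize prepare, ts) (csize prepare, ts1)"
      and h1: "holds 4 ts1 \<sigma>1" "trying x (p @ [True]) True \<sigma>1"
      using reaches_yes[OF less.prems(2,3) True] by blast
    have "B - length (p @ [True]) < B - length p" using l by simp
    from less.hyps[OF this greedy_True[OF less.prems(1) True] h1]
    obtain p' ts' where p': "greedy_max A x p'" "holds_word (ts' ! 0) (result p')"
      and "reaches A ((B - Suc (length p)) * 20 + 20) (csize prepare, ts1) (halt greedy_machine, ts')"
      by auto
    from reaches_trans[OF 1 this(3)] have
      "reaches A ((B - length p) * 20 + 20) (csize prepare, ts) (halt greedy_machine, ts')"
      by (rule reaches_mono) (use l in simp)
    with p' show ?thesis by blast
  next
    case nT: False
    obtain ts1 \<sigma>1 where 1: "reaches A 7 (csize prepare, ts) (csize prepare, ts1)"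
      and h1: "holds 4 ts1 \<sigma>1" "trying x p False \<sigma>1"
      using reaches_no_True[OF less.prems(2,3) nT] by blast
    show ?thesis
    proof (cases "rev (x @ p @ [False]) \<in> A")
      case True
      then have l: "Suc (length p) \<le> B" using B[of "p @ [False]"] greedy_False[OF less.prems(1) nT] by simp
      obtain ts2 \<sigma>2 where 2: "reaches A 10 (csize prepare, ts1) (csize prepare, ts2)"
        and h2: "holds 4 ts2 \<sigma>2" "trying x (p @ [False]) True \<sigma>2"
        using reaches_yes[OF h1 True] by blast
      have "B - length (p @ [False]) < B - length p" using l by simp
      from less.hyps[OF this greedy_False[OF less.prems(1) nT True] h2]
      obtain p' ts' where p': "greedy_max A x p'" "holds_word (ts' ! 0) (result p')"
        and "reaches A ((B - Suc (length p)) * 20 + 20) (csize prepare, ts2) (halt greedy_machine, ts')"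
        by auto
      from reaches_trans[OF 1 reaches_trans[OF 2 this(3)]] have
        "reaches A ((B - length p) * 20 + 20) (csize prepare, ts) (halt greedy_machine, ts')"
        by (rule reaches_mono) (use l in simp)
      with p' show ?thesis by blast
    next
      case False
      then obtain ts' where 2: "reaches A 6 (csize prepare, ts1) (halt greedy_machine, ts')"
        and h: "holds_word (ts' ! 0) (result p)" using reaches_no_False[OF h1] by blast
      have "rev (x @ p @ [b]) \<notin> A" for b by (cases b) (use nT False in simp_all)
      then have g: "greedy_max A x p" using less.prems(1) by (simp only: greedy_max_def simp_thms)
      from reaches_trans[OF 1 2] have
        "reaches A ((B - length p) * 20 + 20) (csize prepare, ts) (halt greedy_machine, ts')"
        by (rule reaches_mono) simp
      with g h show ?thesis by blast
    qed
  qed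
qed

text \<open>The bound is assumed for every word \<open>x\<close>, since the machine has to meet its
  time bound on all of them. The summand \<open>[:23, 7:]\<close> pays for reversing the input onto
  the query tape and for the last round.\<close>

lemma greedy_in_FP:
  assumes B: "\<And>x p. p \<noteq> [] \<Longrightarrow> greedy A x p \<Longrightarrow> length p \<le> poly B (length x)"
  shows "\<exists>f \<in> FP_with_oracle A. \<forall>x. \<exists>p. greedy_max A x p \<and> f x = result p"
proof -
  let ?T = "[:23, 7:] + B * [:20:]"
  have "\<exists>p. greedy_max A x p \<and> computes_within greedy_machine A [x] (poly ?T (length x)) (result p)" for x
  proof -
    let ?\<sigma> = "\<lambda>i. if i < length [x] then [x] ! i else []"
    have i: "init greedy_machine [x] = (0, snd (init greedy_machine [x]))"
      by (simp add: init_def greedy_machine_def machine_def)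
    have h: "holds 4 (snd (init greedy_machine [x])) ?\<sigma>"
      unfolding greedy_machine_def by (rule holds_init) simp
    let ?g = "?\<sigma>(0 := [], 1 := rev x)"
    have "runs (move_all 0 1) ?\<sigma> (length x * 7 + 1) ?g"
      using runs_move_all[of 0 1 ?\<sigma>] by simp
    from runs_Seq[OF this runs_Push[of 1 True]]
    have "runs prepare ?\<sigma> (length x * 7 + 1 + 2) (?g(1 := True # ?g 1))" unfolding prepare_def .
    from reaches_runs[OF this code_at_greedy(1) regs_of_greedy(1) h] obtain ts where
      1: "reaches A (length x * 7 + 1 + 2) (0, snd (init greedy_machine [x])) (csize prepare, ts)"
      and ts: "holds 4 ts (?g(1 := True # ?g 1))" by auto
    have "trying x [] True (?g(1 := True # ?g 1))" by (auto simp: trying_def result_def)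
    from reaches_greedy[of A x "poly B (length x)", OF B greedy_Nil ts this] obtain p ts' where
      p: "greedy_max A x p" "holds_word (ts' ! 0) (result p)" and
      2: "reaches A (poly B (length x) * 20 + 20) (csize prepare, ts) (halt greedy_machine, ts')" by auto
    from reaches_trans[OF 1 2] have "reaches A (poly ?T (length x)) (init greedy_machine [x]) (halt greedy_machine, ts')"
      unfolding i[symmetric] by (rule reaches_mono) simp
    with p show ?thesis unfolding computes_within_def reaches_def by blast
  qed
  then obtain P where P: "\<And>x. greedy_max A x (P x)"
    "\<And>x. computes_within greedy_machine A [x] (poly ?T (length x)) (result (P x))" by metis
  then have "(\<lambda>x. result (P x)) \<in> FP_with_oracle A"
    unfolding FP_with_oracle_def using otm_greedy_machine by blast
  with P(1) show ?thesis by (intro bexI[of _ "\<lambda>x. result (P x)"]) auto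
qed

section \<open>Properties of greedy paths\<close>

lemma greedy_query: "greedy A x p \<Longrightarrow> p \<noteq> [] \<Longrightarrow> rev (x @ p) \<in> A"
  by (cases rule: greedy.cases) auto

text \<open>For the time bound: the first accepted query extends \<open>x\<close> by a single bit,
  so the input part is parsed before anything long is appended.\<close>

lemma greedy_first: "greedy A x p \<Longrightarrow> p \<noteq> [] \<Longrightarrow> rev (x @ take 1 p) \<in> A"
proof (induction rule: greedy.induct)
  case (greedy_True p)
  then show ?case by (cases p) auto
next
  case (greedy_False p)
  then show ?case by (cases p) auto
qed simp

text \<open>False is appended only after True was refused at the same place. Applied to the
  separator, this rules out longer chains.\<close>

lemma greedy_refused: "greedy A x p \<Longrightarrow> p = p1 @ False # p2 \<Longrightarrow> rev (x @ p1 @ [True]) \<notin> A"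
proof (induction arbitrary: p2 rule: greedy.induct)
  case (greedy_True p)
  then show ?case by (cases p2 rule: rev_cases) auto
next
  case (greedy_False p)
  then show ?case by (cases p2 rule: rev_cases) auto
qed simp

section \<open>Functions and predicates given by terms\<close>

type_synonym env = "(bool \<Rightarrow> bool list) \<times> (nat \<Rightarrow> nat)"

definition len :: "bool \<Rightarrow> env \<Rightarrow> nat" where
  "len k e = length (fst e k)"

definition bit :: "bool \<Rightarrow> env \<Rightarrow> nat \<Rightarrow> bool" where
  "bit k e i \<longleftrightarrow> i < length (fst e k) \<and> fst e k ! i"

definition hd_env :: "env \<Rightarrow> nat" where
  "hd_env e = snd e 0"

definition tl_env :: "env \<Rightarrow> env" where
  "tl_env e = (fst e, \<lambda>j. snd e (Suc j))"

definition push :: "nat \<Rightarrow> env \<Rightarrow> env" where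
  "push i e = (fst e, case_nat i (snd e))"

lemma hd_push [simp]: "hd_env (push i e) = i" and tl_push [simp]: "tl_env (push i e) = e"
  by (auto simp: hd_env_def tl_env_def push_def)

text \<open>Long terms are never written out: a function of environments is shown to be denoted by
  some term, using closure rules that follow its HOL definition.\<close>

definition pt :: "(env \<Rightarrow> nat) \<Rightarrow> bool" where
  "pt F \<longleftrightarrow> (\<exists>t. \<forall>W \<rho>. F (W, \<rho>) = eval t W \<rho>)"

definition pb :: "(env \<Rightarrow> bool) \<Rightarrow> bool" where
  "pb P \<longleftrightarrow> pt (\<lambda>e. of_bool (P e))"

text \<open>The changes of environment under which these classes are closed.\<close>

definition sub :: "(env \<Rightarrow> env) \<Rightarrow> bool" where
  "sub G \<longleftrightarrow> (\<exists>F. (\<forall>j. pt (F j)) \<and> (\<forall>W \<rho>. G (W, \<rho>) = (W, \<lambda>j. F j (W, \<rho>))))"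

section \<open>Substitution into terms\<close>

primrec rename :: "(nat \<Rightarrow> nat) \<Rightarrow> tm \<Rightarrow> tm" where
  "rename r (Var j) = Var (r j)"
| "rename r (Cst n) = Cst n"
| "rename r (Add t t') = Add (rename r t) (rename r t')"
| "rename r (Sub t t') = Sub (rename r t) (rename r t')"
| "rename r (Sum t t') = Sum (rename r t) (rename (case_nat 0 (\<lambda>j. Suc (r j))) t')"
| "rename r (Bit k t) = Bit k (rename r t)"
| "rename r (Len k) = Len k"

lemma eval_rename: "eval (rename r t) W \<rho> = eval t W (\<lambda>j. \<rho> (r j))"
proof (induction t arbitrary: r \<rho>)
  case (Sum t t')
  have "(\<lambda>j. case_nat i \<rho> (case_nat 0 (\<lambda>j. Suc (r j)) j)) = case_nat i (\<lambda>j. \<rho> (r j))" for i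
    by (auto simp: fun_eq_iff split: nat.splits)
  with Sum show ?case by simp
qed auto

primrec subst :: "(nat \<Rightarrow> tm) \<Rightarrow> tm \<Rightarrow> tm" where
  "subst \<theta> (Var j) = \<theta> j"
| "subst \<theta> (Cst n) = Cst n"
| "subst \<theta> (Add t t') = Add (subst \<theta> t) (subst \<theta> t')"
| "subst \<theta> (Sub t t') = Sub (subst \<theta> t) (subst \<theta> t')"
| "subst \<theta> (Sum t t') = Sum (subst \<theta> t) (subst (case_nat (Var 0) (\<lambda>j. rename Suc (\<theta> j))) t')"
| "subst \<theta> (Bit k t) = Bit k (subst \<theta> t)"
| "subst \<theta> (Len k) = Len k"

lemma eval_subst: "eval (subst \<theta> t) W \<rho> = eval t W (\<lambda>j. eval (\<theta> j) W \<rho>)"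
proof (induction t arbitrary: \<theta> \<rho>)
  case (Sum t t')
  have "(\<lambda>j. eval (case_nat (Var 0) (\<lambda>j. rename Suc (\<theta> j)) j) W (case_nat i \<rho>)) =
      case_nat i (\<lambda>j. eval (\<theta> j) W \<rho>)" for i
    by (auto simp: fun_eq_iff eval_rename split: nat.splits)
  with Sum show ?case by simp
qed auto

lemma pt_comp: assumes "pt F" "sub G" shows "pt (\<lambda>e. F (G e))"
proof -
  obtain t where t: "\<And>W \<rho>. F (W, \<rho>) = eval t W \<rho>" using assms(1) by (auto simp: pt_def)
  obtain H where H: "\<And>j. pt (H j)" "\<And>W \<rho>. G (W, \<rho>) = (W, \<lambda>j. H j (W, \<rho>))"
    using assms(2) by (auto simp: sub_def)
  then obtain \<theta> where "\<And>j W \<rho>. H j (W, \<rho>) = eval (\<theta> j) W \<rho>" unfolding pt_def by metis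
  then show ?thesis unfolding pt_def by (intro exI[of _ "subst \<theta> t"]) (simp add: eval_subst t H(2))
qed

lemma pb_comp: "pb P \<Longrightarrow> sub G \<Longrightarrow> pb (\<lambda>e. P (G e))"
  unfolding pb_def by (rule pt_comp)

lemma pt_var: "pt (\<lambda>e. snd e j)"
  unfolding pt_def by (intro exI[of _ "Var j"]) simp

lemma sub_id: "sub (\<lambda>e. e)"
  unfolding sub_def by (intro exI[of _ "\<lambda>j e. snd e j"]) (simp add: pt_var)

lemma sub_tl: assumes "sub G" shows "sub (\<lambda>e. tl_env (G e))"
proof -
  obtain F where "\<And>j. pt (F j)" "\<And>W \<rho>. G (W, \<rho>) = (W, \<lambda>j. F j (W, \<rho>))"
    using assms by (auto simp: sub_def)
  then show ?thesis unfolding sub_def by (intro exI[of _ "\<lambda>j. F (Suc j)"]) (simp add: tl_env_def)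
qed

lemma sub_push: assumes "pt a" "sub G" shows "sub (\<lambda>e. push (a e) (G e))"
proof -
  obtain F where "\<And>j. pt (F j)" "\<And>W \<rho>. G (W, \<rho>) = (W, \<lambda>j. F j (W, \<rho>))"
    using assms by (auto simp: sub_def)
  with assms(1) show ?thesis unfolding sub_def
    by (intro exI[of _ "case_nat a F"]) (auto simp: push_def fun_eq_iff split: nat.splits)
qed

lemma pt_hd: "sub G \<Longrightarrow> pt (\<lambda>e. hd_env (G e))"
  using pt_comp[OF pt_var[of 0]] by (simp add: hd_env_def)

lemma sub_words: "sub G \<Longrightarrow> fst (G e) = fst e"
  by (cases e) (auto simp: sub_def)

section \<open>Closure under arithmetic, logic and bounded quantifiers\<close>

lemma pt_const: "pt (\<lambda>e. n)"
  unfolding pt_def by (intro exI[of _ "Cst n"]) simp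

lemma pt_add: assumes "pt f" "pt g" shows "pt (\<lambda>e. f e + g e)"
proof -
  obtain t t' where "\<forall>W \<rho>. f (W, \<rho>) = eval t W \<rho>" "\<forall>W \<rho>. g (W, \<rho>) = eval t' W \<rho>"
    using assms by (auto simp: pt_def)
  then show ?thesis unfolding pt_def by (intro exI[of _ "Add t t'"]) simp
qed

lemma pt_diff: assumes "pt f" "pt g" shows "pt (\<lambda>e. f e - g e)"
proof -
  obtain t t' where "\<forall>W \<rho>. f (W, \<rho>) = eval t W \<rho>" "\<forall>W \<rho>. g (W, \<rho>) = eval t' W \<rho>"
    using assms by (auto simp: pt_def)
  then show ?thesis unfolding pt_def by (intro exI[of _ "Sub t t'"]) simp
qed

text \<open>The index of a sum is the head of an extended environment. The body must therefore be
  definable with \<open>tl_env\<close> in place of the outer environment and \<open>hd_env\<close>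
  in place of the index; all rules for binders have this form.\<close>

lemma pt_sum:
  assumes "pt f" "pt (\<lambda>e. g (tl_env e) (hd_env e))"
  shows "pt (\<lambda>e. \<Sum>i < f e. g e i)"
proof -
  obtain t where t: "\<And>W \<rho>. f (W, \<rho>) = eval t W \<rho>" using assms by (auto simp: pt_def)
  obtain t' where "\<And>W \<rho>. g (tl_env (W, \<rho>)) (hd_env (W, \<rho>)) = eval t' W \<rho>"
    using assms(2) unfolding pt_def by blast
  from this[of _ "case_nat i \<rho>" for i \<rho>] have "g (W, \<rho>) i = eval t' W (case_nat i \<rho>)" for W \<rho> i
    by (simp add: tl_env_def hd_env_def)
  with t show ?thesis unfolding pt_def by (intro exI[of _ "Sum t t'"]) simp
qed

lemma pt_mult: assumes "pt f" "pt g" shows "pt (\<lambda>e. f e * g e)"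
proof -
  have "pt (\<lambda>e. \<Sum>i < f e. g e)"
    by (rule pt_sum[OF assms(1) pt_comp[OF assms(2) sub_tl[OF sub_id]]])
  then show ?thesis by simp
qed

lemma pt_power: "pt f \<Longrightarrow> pt (\<lambda>e. f e ^ k)"
  by (induction k) (auto intro: pt_const pt_mult)

lemma pt_fixed_sum: "(\<And>c. pt (\<lambda>e. f e c)) \<Longrightarrow> pt (\<lambda>e. \<Sum>c < (C :: nat). f e c)"
  by (induction C) (auto intro: pt_const pt_add)

lemma pt_len: "sub G \<Longrightarrow> pt (\<lambda>e. len k (G e))"
  unfolding pt_def by (intro exI[of _ "Len k"]) (simp add: len_def sub_words)

lemma pb_bit: assumes "sub G" "pt f" shows "pb (\<lambda>e. bit k (G e) (f e))"
proof -
  obtain t where "\<forall>W \<rho>. f (W, \<rho>) = eval t W \<rho>" using assms by (auto simp: pt_def)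
  then show ?thesis unfolding pb_def pt_def
    by (intro exI[of _ "Bit k t"]) (simp add: bit_def sub_words[OF assms(1)])
qed

lemma pt_of_bool: "pb P \<Longrightarrow> pt (\<lambda>e. of_bool (P e))"
  by (simp add: pb_def)

lemma pb_less: assumes "pt f" "pt g" shows "pb (\<lambda>e. f e < g e)"
proof -
  have "pt (\<lambda>e. 1 - (1 - (g e - f e)))" by (intro pt_diff pt_const assms)
  moreover have "(\<lambda>e. 1 - (1 - (g e - f e))) = (\<lambda>e. of_bool (f e < g e))" by auto
  ultimately show ?thesis by (simp add: pb_def)
qed

lemma pb_not: assumes "pb P" shows "pb (\<lambda>e. \<not> P e)"
proof -
  have "pt (\<lambda>e. 1 - of_bool (P e))" by (intro pt_diff pt_const assms[unfolded pb_def])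
  moreover have "(\<lambda>e. 1 - of_bool (P e)) = (\<lambda>e. of_bool (\<not> P e) :: nat)" by auto
  ultimately show ?thesis by (simp add: pb_def)
qed

lemma pb_conj: assumes "pb P" "pb Q" shows "pb (\<lambda>e. P e \<and> Q e)"
  using pt_mult[OF assms[unfolded pb_def]] by (simp add: pb_def of_bool_conj)

lemma pb_const: "pb (\<lambda>e. c)"
  unfolding pb_def by (rule pt_const)

lemma pb_disj: assumes "pb P" "pb Q" shows "pb (\<lambda>e. P e \<or> Q e)"
  using pb_not[OF pb_conj[OF pb_not[OF assms(1)] pb_not[OF assms(2)]]] by simp

lemma pb_imp: assumes "pb P" "pb Q" shows "pb (\<lambda>e. P e \<longrightarrow> Q e)"
  using pb_disj[OF pb_not[OF assms(1)] assms(2)] by (simp only: imp_conv_disj)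

lemma pb_iff: assumes "pb P" "pb Q" shows "pb (\<lambda>e. P e = Q e)"
  using pb_conj[OF pb_imp[OF assms] pb_imp[OF assms(2,1)]] by (simp only: iff_conv_conj_imp)

lemma pb_le: "pt f \<Longrightarrow> pt g \<Longrightarrow> pb (\<lambda>e. f e \<le> g e)"
  using pb_not[OF pb_less[of g f]] by (simp add: not_less)

lemma pb_eq: "pt f \<Longrightarrow> pt g \<Longrightarrow> pb (\<lambda>e. f e = g e)"
  using pb_conj[OF pb_le[of f g] pb_le[of g f]] by (simp add: eq_iff)

lemma pb_ex:
  assumes "pt f" "pb (\<lambda>e. P (tl_env e) (hd_env e))"
  shows "pb (\<lambda>e. \<exists>i < f e. P e i)"
proof -
  have "pb (\<lambda>e. 0 < (\<Sum>i < f e. of_bool (P e i) :: nat))"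
    by (intro pb_less pt_sum pt_const assms(1) assms(2)[unfolded pb_def])
  moreover have "0 < (\<Sum>i < f e. of_bool (P e i) :: nat) \<longleftrightarrow> (\<exists>i < f e. P e i)" for e
    using sum_eq_0_iff[of "{..<f e}" "\<lambda>i. of_bool (P e i) :: nat"] by (auto simp: card_gt_0_iff)
  ultimately show ?thesis by (simp only:)
qed

lemma pb_all:
  assumes "pt f" "pb (\<lambda>e. P (tl_env e) (hd_env e))"
  shows "pb (\<lambda>e. \<forall>i < f e. P e i)"
  using pb_not[OF pb_ex[of f "\<lambda>e i. \<not> P e i", OF assms(1) pb_not[OF assms(2)]]] by simp

lemma pb_ex_le:
  assumes "pt f" "pb (\<lambda>e. P (tl_env e) (hd_env e))"
  shows "pb (\<lambda>e. \<exists>i \<le> f e. P e i)"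
  using pb_ex[OF pt_add[OF assms(1) pt_const[of 1]], of P] assms(2) by (simp add: less_Suc_eq_le)

lemma pb_all_le:
  assumes "pt f" "pb (\<lambda>e. P (tl_env e) (hd_env e))"
  shows "pb (\<lambda>e. \<forall>i \<le> f e. P e i)"
  using pb_all[OF pt_add[OF assms(1) pt_const[of 1]], of P] assms(2) by (simp add: less_Suc_eq_le)

lemma pt_if: assumes "pb P" "pt f" "pt g" shows "pt (\<lambda>e. if P e then f e else g e)"
proof -
  have "pt (\<lambda>e. of_bool (P e) * f e + of_bool (\<not> P e) * g e)"
    by (intro pt_add pt_mult pt_of_bool pb_not assms)
  moreover have "(\<lambda>e. of_bool (P e) * f e + of_bool (\<not> P e) * g e) = (\<lambda>e. if P e then f e else g e)"
    by (rule ext) simp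
  ultimately show ?thesis by (simp only:)
qed

definition pt2 :: "(env \<Rightarrow> nat \<Rightarrow> nat) \<Rightarrow> bool" where
  "pt2 J \<longleftrightarrow> pt (\<lambda>e. J (tl_env e) (hd_env e))"

lemma pt2_app: assumes "pt2 J" "sub G" "pt a" shows "pt (\<lambda>e. J (G e) (a e))"
  using pt_comp[OF assms(1)[unfolded pt2_def] sub_push[OF assms(3,2)]] by simp

lemma sub_comp: assumes "sub G" "sub H" shows "sub (\<lambda>e. G (H e))"
proof -
  obtain F where F: "\<And>j. pt (F j)" "\<And>W \<rho>. G (W, \<rho>) = (W, \<lambda>j. F j (W, \<rho>))"
    using assms(1) by (auto simp: sub_def)
  have "G (H (W, \<rho>)) = (W, \<lambda>j. F j (H (W, \<rho>)))" for W \<rho>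
    using F(2)[of W "snd (H (W, \<rho>))"] sub_words[OF assms(2), of "(W, \<rho>)"]
    by (metis fst_conv prod.collapse)
  then show ?thesis unfolding sub_def
    using F(1) assms(2) by (intro exI[of _ "\<lambda>j e. F j (H e)"]) (simp add: pt_comp)
qed

lemma pt2_comp: assumes "pt2 J" "sub G" shows "pt2 (\<lambda>e. J (G e))"
  unfolding pt2_def by (intro pt2_app[OF assms(1)] sub_comp[OF assms(2)] sub_tl sub_id pt_hd)

lemmas pt_intros = pt_const pt_add pt_diff pt_mult pt_power pt_sum pt_len pt_hd pt_of_bool pt_if
  pb_const pb_bit pb_less pb_le pb_eq pb_not pb_conj pb_disj pb_imp pb_iff pb_ex pb_all pb_ex_le pb_all_le
  sub_id sub_tl sub_push

text \<open>As \<open>C\<close> is a constant, a bounded function on \<open>{..<C}\<close> amounts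
  to \<open>C\<close> nested bounded quantifiers. The premise speaks of arbitrary \<open>G\<close>
  and \<open>\<tau>\<close> so that the induction can supply the components one at a time. The value
  0 from \<open>C\<close> on makes the function determined by its components.\<close>

lemma pb_ex_fun:
  fixes C :: nat
  assumes "pt B" "\<And>G \<tau>. sub G \<Longrightarrow> (\<And>c. pt (\<tau> c)) \<Longrightarrow> pb (\<lambda>e. Q (G e) (\<lambda>c. \<tau> c e))"
  shows "pb (\<lambda>e. \<exists>s. (\<forall>c < C. s c \<le> B e) \<and> (\<forall>c \<ge> C. s c = 0) \<and> Q e s)"
  using assms
proof (induction C arbitrary: B Q)
  case 0
  have "pb (\<lambda>e. Q e (\<lambda>c. 0))" by (rule 0(2)[OF sub_id pt_const])
  moreover have "(\<exists>s. (\<forall>c \<ge> 0. s c = 0) \<and> Q e s) \<longleftrightarrow> Q e (\<lambda>c. 0)" for e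
    by (auto simp: fun_eq_iff) (metis ext)
  ultimately show ?case by simp
next
  case (Suc C)
  let ?Q = "\<lambda>e s. Q (tl_env e) (s(C := hd_env e))"
  have "pb (\<lambda>e. \<exists>s. (\<forall>c < C. s c \<le> B (tl_env e)) \<and> (\<forall>c \<ge> C. s c = 0) \<and> ?Q e s)"
  proof (rule Suc.IH)
    show "pt (\<lambda>e. B (tl_env e))" by (intro pt_comp[OF Suc.prems(1)] pt_intros)
    fix G and \<tau> :: "nat \<Rightarrow> env \<Rightarrow> nat"
    assume G: "sub G" and \<tau>: "\<And>c. pt (\<tau> c)"
    have "pb (\<lambda>e. Q (tl_env (G e)) (\<lambda>c. (\<tau>(C := \<lambda>e. hd_env (G e))) c e))"
      by (rule Suc.prems(2)) (use G \<tau> in \<open>auto intro: pt_intros\<close>)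
    moreover have "(\<lambda>c. (\<tau>(C := \<lambda>e. hd_env (G e))) c e) = (\<lambda>c. \<tau> c e)(C := hd_env (G e))" for e
      by auto
    ultimately show "pb (\<lambda>e. ?Q (G e) (\<lambda>c. \<tau> c e))" by simp
  qed
  then have "pb (\<lambda>e. \<exists>a \<le> B e. \<exists>s. (\<forall>c < C. s c \<le> B e) \<and> (\<forall>c \<ge> C. s c = 0) \<and> Q e (s(C := a)))"
    by (rule pb_ex_le[OF Suc.prems(1)])
  moreover have "(\<exists>a \<le> B e. \<exists>s. (\<forall>c < C. s c \<le> B e) \<and> (\<forall>c \<ge> C. s c = 0) \<and> Q e (s(C := a))) \<longleftrightarrow>
      (\<exists>s. (\<forall>c < Suc C. s c \<le> B e) \<and> (\<forall>c \<ge> Suc C. s c = 0) \<and> Q e s)" for e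
  proof safe
    fix a s assume *: "a \<le> B e" "\<forall>c < C. s c \<le> B e" "\<forall>c \<ge> C. s c = 0" "Q e (s(C := a))"
    then show "\<exists>s. (\<forall>c < Suc C. s c \<le> B e) \<and> (\<forall>c \<ge> Suc C. s c = 0) \<and> Q e s"
      by (intro exI[of _ "s(C := a)"]) (auto simp: less_Suc_eq)
  next
    fix s assume *: "\<forall>c < Suc C. s c \<le> B e" "\<forall>c \<ge> Suc C. s c = 0" "Q e s"
    have "(s(C := 0))(C := s C) = s" by simp
    with * show "\<exists>a \<le> B e. \<exists>s. (\<forall>c < C. s c \<le> B e) \<and> (\<forall>c \<ge> C. s c = 0) \<and> Q e (s(C := a))"
      by (intro exI[of _ "s C"] conjI exI[of _ "s(C := 0)"]) auto
  qed
  ultimately show ?case by simp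
qed

section \<open>Types of instances\<close>

definition code :: "bool option \<Rightarrow> nat" where
  "code b = (case b of None \<Rightarrow> 0 | Some c \<Rightarrow> if c then 2 else 1)"

text \<open>Total: every number other than 0 and 2 stands for \<open>Some False\<close>, so any
  function on features describes an instance by \<open>inst\<close>.\<close>

definition dec :: "nat \<Rightarrow> bool option" where
  "dec c = (if c = 0 then None else Some (c = 2))"

definition inst :: "nat \<Rightarrow> (nat \<Rightarrow> nat) \<Rightarrow> inst" where
  "inst n d = map (\<lambda>i. dec (d i)) [0..<n]"

lemma dec_code [simp]: "dec (code b) = b"
  by (auto simp: dec_def code_def split: option.splits)

lemma code_less: "code b < 3"
  by (auto simp: code_def split: option.splits)

lemma code_inj: "code b = code b' \<longleftrightarrow> b = b'"
  by (metis dec_code)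

lemma inst_in [simp]: "inst n d \<in> insts n"
  by (simp add: inst_def insts_def)

lemma inst_nth [simp]: "i < n \<Longrightarrow> inst n d ! i = dec (d i)"
  by (simp add: inst_def)

lemma insts_nth_eq: "e \<in> insts n \<Longrightarrow> e' \<in> insts n \<Longrightarrow> (\<And>i. i < n \<Longrightarrow> e ! i = e' ! i) \<Longrightarrow> e = e'"
  by (auto simp: insts_def intro: nth_equalityI)

lemma finite_insts: "finite (insts n)"
proof -
  have "insts n = {e. set e \<subseteq> UNIV \<and> length e = n}" by (auto simp: insts_def)
  then show ?thesis using finite_lists_length_eq[of "UNIV :: bool option set" n] by simp
qed

text \<open>In the sequel, \<open>pc i\<close> encodes the values of the parameters at feature \<open>i\<close>.\<close>

definition same_type :: "nat \<Rightarrow> (nat \<Rightarrow> nat) \<Rightarrow> inst \<Rightarrow> inst \<Rightarrow> bool" where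
  "same_type n pc e e' \<longleftrightarrow>
     (\<forall>c b. card {i. i < n \<and> pc i = c \<and> e ! i = b} = card {i. i < n \<and> pc i = c \<and> e' ! i = b})"

lemma count_map_upt: "count (mset (map f [0..<n])) a = card {i. i < n \<and> f i = a}"
proof (induction n)
  case (Suc n)
  have "{i. i < Suc n \<and> f i = a} = (if f n = a then insert n {i. i < n \<and> f i = a} else {i. i < n \<and> f i = a})"
    by (auto simp: less_Suc_eq)
  with Suc show ?case by simp
qed simp

text \<open>The lists of pairs (parameter code, entry) have the same multiset, so one is a
  permutation of the other. The first components make this permutation respect the
  parameters.\<close>

lemma same_type_perm:
  assumes "same_type n pc e e'"
  shows "\<exists>\<pi>. \<pi> permutes {..<n} \<and> (\<forall>i < n. pc (\<pi> i) = pc i \<and> e' ! i = e ! \<pi> i)"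
proof -
  let ?l = "\<lambda>e. map (\<lambda>i. (pc i, e ! i)) [0..<n]"
  have "mset (?l e') = mset (?l e)"
    by (rule multiset_eqI) (use assms in \<open>auto simp only: count_map_upt same_type_def prod.inject split: prod.splits\<close>)
  then obtain \<pi> where \<pi>: "\<pi> permutes {..<length (?l e)}" "permute_list \<pi> (?l e) = ?l e'"
    by (rule mset_eq_permutation)
  have "?l e' ! i = ?l e ! \<pi> i" if "i < n" for i
    using permute_list_nth[OF \<pi>(1), of i] \<pi>(2) that by simp
  moreover have "\<pi> i < n" if "i < n" for i using permutes_in_image[OF \<pi>(1), of i] that by simp
  ultimately have "pc (\<pi> i) = pc i \<and> e' ! i = e ! \<pi> i" if "i < n" for i using that by fastforce
  with \<pi>(1) show ?thesis by auto
qed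

section \<open>Invariance under permutations of the features\<close>

lemma atomic_sat_cong:
  "(\<And>x. x \<in> atomic_fv f \<Longrightarrow> v x = v' x) \<Longrightarrow> atomic_sat n v f = atomic_sat n v' f"
proof (induction f arbitrary: v v')
  case (AEx x f)
  have "atomic_sat n (v(x := e)) f = atomic_sat n (v'(x := e)) f" for e
    by (rule AEx.IH) (use AEx.prems in auto)
  then show ?case by simp
next
  case (AAll x f)
  have "atomic_sat n (v(x := e)) f = atomic_sat n (v'(x := e)) f" for e
    by (rule AAll.IH) (use AAll.prems in auto)
  then show ?case by simp
next
  case (AAnd f g)
  then show ?case by (metis UnCI atomic_fv.simps(5) atomic_sat.simps(5))
next
  case (AOr f g)
  then show ?case by (metis UnCI atomic_fv.simps(6) atomic_sat.simps(6))
next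
  case (ANot f)
  then show ?case by (metis atomic_fv.simps(4) atomic_sat.simps(4))
qed auto

lemma permute_insts: "e \<in> insts n \<Longrightarrow> permute_list \<pi> e \<in> insts n"
  by (simp add: insts_def)

lemma permute_insts_nth:
  "\<pi> permutes {..<n} \<Longrightarrow> e \<in> insts n \<Longrightarrow> i < n \<Longrightarrow> permute_list \<pi> e ! i = e ! \<pi> i"
  by (simp add: insts_def permute_list_nth)

lemma all_permutes: "\<pi> permutes {..<n :: nat} \<Longrightarrow> (\<forall>i < n. P (\<pi> i)) \<longleftrightarrow> (\<forall>i < n. P i)"
  by (metis lessThan_iff permutes_in_image permutes_surj surjD)

lemma permute_insts_inverse:
  assumes "\<pi> permutes {..<n}" "e \<in> insts n"
  shows "permute_list \<pi> (permute_list (inv \<pi>) e) = e"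
  using permute_list_compose[of \<pi> e "inv \<pi>"] assms by (simp add: insts_def permutes_inv_o)

text \<open>Subsumption, equality and the number of undefined features are insensitive to a common
  renaming of features. At a quantifier, every instance is the permuted image of one, by the inverse
  permutation.\<close>

lemma atomic_sat_permute:
  assumes \<pi>: "\<pi> permutes {..<n}" and "\<And>x. v x \<in> insts n"
  shows "atomic_sat n (\<lambda>x. permute_list \<pi> (v x)) f = atomic_sat n v f"
  using assms(2)
proof (induction f arbitrary: v)
  case (Subs x y)
  have l: "length (v x) = n" "length (v y) = n" using Subs by (auto simp: insts_def)
  have "subsumed (permute_list \<pi> (v x)) (permute_list \<pi> (v y)) \<longleftrightarrow>
     (\<forall>i < n. v x ! \<pi> i \<noteq> None \<longrightarrow> v x ! \<pi> i = v y ! \<pi> i)"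
    using permute_insts_nth[OF \<pi> Subs] by (simp add: subsumed_def l)
  also have "\<dots> \<longleftrightarrow> (\<forall>i < n. v x ! i \<noteq> None \<longrightarrow> v x ! i = v y ! i)"
    by (rule all_permutes[OF \<pi>])
  finally show ?case by (simp add: subsumed_def l)
next
  case (Prec x y)
  have "card (bots (permute_list \<pi> e)) = card (bots e)" if "e \<in> insts n" for e
  proof -
    have "\<pi> ` bots (permute_list \<pi> e) = bots e"
    proof safe
      fix i assume "i \<in> bots (permute_list \<pi> e)"
      then show "\<pi> i \<in> bots e" using that permutes_in_image[OF \<pi>, of i] permute_insts_nth[OF \<pi> that, of i]
        by (auto simp: bots_def insts_def)
    next
      fix i assume i: "i \<in> bots e"
      moreover obtain j where "i = \<pi> j" using permutes_surj[OF \<pi>] by blast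
      ultimately show "i \<in> \<pi> ` bots (permute_list \<pi> e)"
        using that permutes_in_image[OF \<pi>, of j] permute_insts_nth[OF \<pi> that, of j]
        by (auto simp: bots_def insts_def intro!: imageI)
    qed
    moreover have "inj_on \<pi> (bots (permute_list \<pi> e))"
      using permutes_inj[OF \<pi>] by (rule inj_on_subset) simp
    ultimately show ?thesis by (metis card_image)
  qed
  with Prec show ?case by (simp add: less_defined_def)
next
  case (Equal x y)
  have "(permute_list \<pi> (v x) = permute_list \<pi> (v y)) \<longleftrightarrow> v x = v y"
  proof
    assume eq: "permute_list \<pi> (v x) = permute_list \<pi> (v y)"
    have "\<forall>i < n. v x ! \<pi> i = v y ! \<pi> i" using permute_insts_nth[OF \<pi> Equal] eq by metis
    then have "\<forall>i < n. v x ! i = v y ! i" using all_permutes[OF \<pi>, of "\<lambda>i. v x ! i = v y ! i"] by simp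
    then show "v x = v y" by (intro insts_nth_eq[OF Equal Equal]) simp
  qed simp
  then show ?case by simp
next
  case (AEx x f)
  have upd: "(\<lambda>y. permute_list \<pi> (v y))(x := permute_list \<pi> e) = (\<lambda>y. permute_list \<pi> ((v(x := e)) y))" for e
    by auto
  have *: "atomic_sat n ((\<lambda>y. permute_list \<pi> (v y))(x := permute_list \<pi> e)) f = atomic_sat n (v(x := e)) f"
    if "e \<in> insts n" for e
    unfolding upd by (rule AEx.IH) (use AEx.prems that in auto)
  then show ?case
    using permute_insts permute_insts_inverse[OF \<pi>] by (metis atomic_sat.simps(7))
next
  case (AAll x f)
  have upd: "(\<lambda>y. permute_list \<pi> (v y))(x := permute_list \<pi> e) = (\<lambda>y. permute_list \<pi> ((v(x := e)) y))" for e
    by auto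
  have *: "atomic_sat n ((\<lambda>y. permute_list \<pi> (v y))(x := permute_list \<pi> e)) f = atomic_sat n (v(x := e)) f"
    if "e \<in> insts n" for e
    unfolding upd by (rule AAll.IH) (use AAll.prems that in auto)
  then show ?case
    using permute_insts permute_insts_inverse[OF \<pi>] by (metis atomic_sat.simps(8))
qed auto

lemma atomic_sat_same_orbit:
  assumes \<pi>: "\<pi> permutes {..<n}"
    and v: "\<And>x. x \<in> atomic_fv f \<Longrightarrow> v x \<in> insts n \<and> v' x \<in> insts n"
    and eq: "\<And>x i. x \<in> atomic_fv f \<Longrightarrow> i < n \<Longrightarrow> v' x ! i = v x ! \<pi> i"
  shows "atomic_sat n v' f = atomic_sat n v f"
proof -
  \<comment> \<open>\<open>atomic_sat_permute\<close> wants instances at all variables; those that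
    are not free get a default.\<close>
  let ?v = "\<lambda>x. if x \<in> atomic_fv f then v x else inst n (\<lambda>_. 0)"
  have "atomic_sat n v' f = atomic_sat n (\<lambda>x. permute_list \<pi> (?v x)) f"
  proof (rule atomic_sat_cong)
    fix x assume x: "x \<in> atomic_fv f"
    show "v' x = permute_list \<pi> (?v x)"
      by (rule insts_nth_eq[of _ n]) (use x v[OF x] eq[OF x] permute_insts_nth[OF \<pi>] permute_insts in auto)
  qed
  also have "\<dots> = atomic_sat n ?v f" by (rule atomic_sat_permute[OF \<pi>]) (use v in auto)
  also have "\<dots> = atomic_sat n v f" by (rule atomic_sat_cong) simp
  finally show ?thesis .
qed

section \<open>Sorted representatives\<close>

definition pattern :: "(nat \<Rightarrow> nat) \<Rightarrow> nat \<Rightarrow> nat" where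
  "pattern a K = (\<Sum>y < K. a y * 3 ^ y)"

lemma pattern_Suc: "pattern a (Suc K) = a 0 + 3 * pattern (\<lambda>y. a (Suc y)) K"
  by (simp add: pattern_def sum.lessThan_Suc_shift sum_distrib_left algebra_simps del: sum.lessThan_Suc)

lemma pattern_inj:
  "pattern a K = pattern b K \<Longrightarrow> (\<And>y. a y < 3) \<Longrightarrow> (\<And>y. b y < 3) \<Longrightarrow> y < K \<Longrightarrow> a y = b y"
proof (induction K arbitrary: a b y)
  case (Suc K)
  have "a 0 = (a 0 + 3 * pattern (\<lambda>y. a (Suc y)) K) mod 3" "b 0 = (b 0 + 3 * pattern (\<lambda>y. b (Suc y)) K) mod 3"
    using Suc.prems(2)[of 0] Suc.prems(3)[of 0] by auto
  then have 0: "a 0 = b 0" using Suc.prems(1)[unfolded pattern_Suc] by metis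
  then have "pattern (\<lambda>y. a (Suc y)) K = pattern (\<lambda>y. b (Suc y)) K"
    using Suc.prems(1) by (simp add: pattern_Suc)
  from Suc.IH[OF this] Suc.prems 0 show ?case by (cases y) auto
qed simp

lemma pattern_less: "(\<And>y. a y < 3) \<Longrightarrow> pattern a K < 3 ^ K"
proof (induction K arbitrary: a)
  case (Suc K)
  have "pattern (\<lambda>y. a (Suc y)) K < 3 ^ K" by (rule Suc.IH) (rule Suc.prems)
  then show ?case using Suc.prems[of 0] by (simp add: pattern_Suc)
qed (simp add: pattern_def)

text \<open>A discrete intermediate value property: it lets cut points realize prescribed numbers of
  entries within a pattern class.\<close>

lemma threshold:
  fixes n :: nat
  assumes "a \<le> card {i. i < n \<and> P i}"
  shows "\<exists>s \<le> n. card {i. i < n \<and> P i \<and> i < s} = a"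
  using assms
proof (induction n)
  case (Suc n)
  show ?case
  proof (cases "a \<le> card {i. i < n \<and> P i}")
    case True
    then obtain s where "s \<le> n" "card {i. i < n \<and> P i \<and> i < s} = a" using Suc.IH by blast
    moreover from this(1) have "{i. i < Suc n \<and> P i \<and> i < s} = {i. i < n \<and> P i \<and> i < s}" by auto
    ultimately show ?thesis by (intro exI[of _ s]) simp
  next
    case False
    have "{i. i < Suc n \<and> P i} = (if P n then insert n {i. i < n \<and> P i} else {i. i < n \<and> P i})"
      by (auto simp: less_Suc_eq)
    then have "card {i. i < Suc n \<and> P i} \<le> Suc (card {i. i < n \<and> P i})" by simp
    with False Suc.prems have "card {i. i < Suc n \<and> P i} = a" by simp
    moreover have "{i. i < Suc n \<and> P i \<and> i < Suc n} = {i. i < Suc n \<and> P i}" by auto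
    ultimately show ?thesis by (intro exI[of _ "Suc n"]) simp
  qed
qed simp

text \<open>Representatives of the types: within each pattern class, the entries are sorted.\<close>

definition sorted_digit :: "nat \<Rightarrow> (nat \<Rightarrow> nat) \<Rightarrow> (nat \<Rightarrow> nat) \<Rightarrow> nat \<Rightarrow> nat" where
  "sorted_digit C pc s i = (if i < s (pc i) then 1 else if i < s (C + pc i) then 2 else 0)"

text \<open>In each class, one cut encloses as many positions as \<open>e\<close> has zeros there,
  and a second one as many as \<open>e\<close> has zeros and ones. Sorting thus keeps all counts,
  and two numbers per class describe the result.\<close>

lemma sorted_representative:
  assumes pc: "\<And>i. i < n \<Longrightarrow> pc i < C"
  shows "\<exists>s. (\<forall>c < 2 * C. s c \<le> n) \<and> (\<forall>c \<ge> 2 * C. s c = 0) \<and>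
     same_type n pc e (inst n (sorted_digit C pc s))"
proof -
  let ?S = "\<lambda>c b. {i. i < n \<and> pc i = c \<and> e ! i = b}"
  have fin: "finite (?S c b)" for c b by simp
  have all: "card {i. i < n \<and> pc i = c} = card (?S c (Some False)) + card (?S c (Some True)) + card (?S c None)" for c
  proof -
    have "card {i. i < n \<and> pc i = c} = card (?S c (Some False) \<union> ?S c (Some True) \<union> ?S c None)"
      by (rule arg_cong[of _ _ card]) auto
    also have "\<dots> = card (?S c (Some False) \<union> ?S c (Some True)) + card (?S c None)"
      by (rule card_Un_disjoint) auto
    also have "card (?S c (Some False) \<union> ?S c (Some True)) = card (?S c (Some False)) + card (?S c (Some True))"
      by (rule card_Un_disjoint) auto
    finally show ?thesis .
  qed
  have "\<forall>c. \<exists>s. s \<le> n \<and> card {i. i < n \<and> pc i = c \<and> i < s} = card (?S c (Some False))"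
  proof
    fix c
    show "\<exists>s. s \<le> n \<and> card {i. i < n \<and> pc i = c \<and> i < s} = card (?S c (Some False))"
      using threshold[of "card (?S c (Some False))" n "\<lambda>i. pc i = c"] by (simp add: all)
  qed
  from choice[OF this] obtain s where
    s: "\<And>c. s c \<le> n" "\<And>c. card {i. i < n \<and> pc i = c \<and> i < s c} = card (?S c (Some False))" by blast
  have "\<forall>c. \<exists>t. t \<le> n \<and> card {i. i < n \<and> pc i = c \<and> i < t} =
      card (?S c (Some False)) + card (?S c (Some True))"
  proof
    fix c
    show "\<exists>t. t \<le> n \<and> card {i. i < n \<and> pc i = c \<and> i < t} = card (?S c (Some False)) + card (?S c (Some True))"
      using threshold[of "card (?S c (Some False)) + card (?S c (Some True))" n "\<lambda>i. pc i = c"] by (simp add: all)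
  qed
  from choice[OF this] obtain t where t: "\<And>c. t c \<le> n"
    "\<And>c. card {i. i < n \<and> pc i = c \<and> i < t c} = card (?S c (Some False)) + card (?S c (Some True))"
    by blast
  \<comment> \<open>The first cuts are stored below \<open>C\<close>, the second ones from
    \<open>C\<close> on; 0 elsewhere is the normal form that \<open>pb_ex_fun\<close>
    expects.\<close>
  let ?r = "\<lambda>c. if c < C then s c else if c < 2 * C then t (c - C) else 0"
  let ?e = "inst n (sorted_digit C pc ?r)"
  have e: "?e ! i = (if i < s (pc i) then Some False else if i < t (pc i) then Some True else None)" if "i < n" for i
    using pc[OF that] that by (simp add: sorted_digit_def dec_def)
  have eq: "card {i. i < n \<and> pc i = c \<and> ?e ! i = b} = card (?S c b)" for c b
  proof -
    let ?A = "{i. i < n \<and> pc i = c \<and> i < s c}" and ?B = "{i. i < n \<and> pc i = c \<and> i < t c}"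
    have F: "{i. i < n \<and> pc i = c \<and> ?e ! i = Some False} = ?A" using e by (auto split: if_splits)
    have T: "{i. i < n \<and> pc i = c \<and> ?e ! i = Some True} = ?B - ?A" using e by (auto split: if_splits)
    have N: "{i. i < n \<and> pc i = c \<and> ?e ! i = None} = {i. i < n \<and> pc i = c} - (?A \<union> ?B)" using e by (auto split: if_splits)
    \<comment> \<open>The cuts are chosen independently, so they may come in the wrong order. Then
      the second encloses no more positions of the class than the first, so there are no
      ones.\<close>
    consider "s c \<le> t c" | "t c < s c" by linarith
    then have "card (?B - ?A) = card (?S c (Some True)) \<and> card (?A \<union> ?B) = card (?S c (Some False)) + card (?S c (Some True))"
    proof cases
      case 1
      then have "?A \<subseteq> ?B" by auto
      then show ?thesis using s(2)[of c] t(2)[of c] by (simp add: card_Diff_subset Un_absorb1)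
    next
      case 2
      then have AB: "?B \<subseteq> ?A" by auto
      then have "card ?B \<le> card ?A" by (intro card_mono) auto
      then have 0: "card (?S c (Some True)) = 0" using s(2)[of c] t(2)[of c] by linarith
      have "?B - ?A = {}" "?A \<union> ?B = ?A" using AB by blast+
      with 0 s(2)[of c] show ?thesis by (simp only: card.empty add_0_right simp_thms)
    qed
    then have BA: "card (?B - ?A) = card (?S c (Some True))"
      and U: "card (?A \<union> ?B) = card (?S c (Some False)) + card (?S c (Some True))" by blast+
    have R: "card ({i. i < n \<and> pc i = c} - (?A \<union> ?B)) = card (?S c None)"
      by (subst card_Diff_subset) (use U all[of c] in auto)
    consider "b = None" | "b = Some False" | "b = Some True" by (cases b) auto
    then show ?thesis
    proof cases
      case 1
      show ?thesis unfolding 1 N R ..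
    next
      case 2
      show ?thesis unfolding 2 F s(2) ..
    next
      case 3
      show ?thesis unfolding 3 T BA ..
    qed
  qed
  have "same_type n pc e ?e" unfolding same_type_def by (intro allI eq[symmetric])
  moreover have "(\<forall>c < 2 * C. ?r c \<le> n) \<and> (\<forall>c \<ge> 2 * C. ?r c = 0)" using s(1) t(1) by simp
  ultimately show ?thesis by (intro exI[of _ ?r] conjI) simp_all
qed

section \<open>Length of chains\<close>

lemma no_descent:
  assumes "irreflp_on (insts n) R" "transp_on (insts n) R" "e \<in> insts n"
    and g: "\<And>a. a \<in> insts n \<Longrightarrow> g a \<in> insts n"
    and mono: "\<And>a b. a \<in> insts n \<Longrightarrow> b \<in> insts n \<Longrightarrow> R a b \<Longrightarrow> R (g a) (g b)"
  shows "\<not> R (g e) e"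
proof
  assume R: "R (g e) e"
  let ?h = "\<lambda>k. (g ^^ k) e"
  have h: "?h k \<in> insts n" for k by (induction k) (auto simp: assms(3) g)
  have step: "R (?h (Suc k)) (?h k)" for k
  proof (induction k)
    case (Suc k)
    show ?case using mono[OF h h Suc] by simp
  qed (use R in simp)
  have less: "i < j \<Longrightarrow> R (?h j) (?h i)" for i j
  proof (induction j)
    case (Suc j)
    then show ?case
      using step[of j] transp_onD[OF assms(2) h h h, of "Suc j" j i] by (cases "i = j") auto
  qed simp
  \<comment> \<open>There are only finitely many instances, so two iterates coincide, against
    irreflexivity.\<close>
  have "\<not> inj ?h"
    using finite_subset[OF _ finite_insts[of n], of "range ?h"] h finite_imageD[of ?h UNIV] infinite_UNIV_nat by blast
  then obtain i j where "i < j" "?h i = ?h j" unfolding inj_def by (metis linorder_neqE_nat)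
  with less[of i j] show False using irreflp_onD[OF assms(1) h] by metis
qed

text \<open>Pigeonhole on the vectors of \<open>3 * C\<close> counts, each between 0 and
  \<open>n\<close>.\<close>

lemma chain_bound:
  assumes ir: "irreflp_on (insts n) R" and tr: "transp_on (insts n) R"
    and E: "\<And>j. j < m \<Longrightarrow> E j \<in> insts n" "\<And>j. Suc j < m \<Longrightarrow> R (E (Suc j)) (E j)"
    and pc: "\<And>i. i < n \<Longrightarrow> pc i < C"
    and inv: "\<And>\<pi> a b. \<pi> permutes {..<n} \<Longrightarrow> (\<And>i. i < n \<Longrightarrow> pc (\<pi> i) = pc i) \<Longrightarrow> a \<in> insts n \<Longrightarrow>
       b \<in> insts n \<Longrightarrow> R a b \<Longrightarrow> R (permute_list \<pi> a) (permute_list \<pi> b)"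
  shows "m \<le> (n + 1) ^ (3 * C)"
proof -
  have less: "i < j \<Longrightarrow> j < m \<Longrightarrow> R (E j) (E i)" for i j
  proof (induction j)
    case (Suc j)
    then show ?case
      using E(2)[of j] transp_onD[OF tr E(1) E(1) E(1), of "Suc j" j i] by (cases "i = j") auto
  qed simp
  \<comment> \<open>Component \<open>k\<close> counts the entry with code \<open>k mod 3\<close> in
    class \<open>k div 3\<close>.\<close>
  let ?ty = "\<lambda>e. map (\<lambda>k. card {i. i < n \<and> pc i = k div 3 \<and> code (e ! i) = k mod 3}) [0..<3 * C]"
  have ty: "same_type n pc e e'" if eq: "?ty e = ?ty e'" for e e'
    unfolding same_type_def
  proof safe
    fix c b
    have k: "(3 * c + code b) div 3 = c" "(3 * c + code b) mod 3 = code b" using code_less[of b] by auto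
    show "card {i. i < n \<and> pc i = c \<and> e ! i = b} = card {i. i < n \<and> pc i = c \<and> e' ! i = b}"
    proof (cases "c < C")
      case True
      then have "3 * c + code b < 3 * C" using code_less[of b] by simp
      then have "?ty e ! (3 * c + code b) = card {i. i < n \<and> pc i = c \<and> e ! i = b}"
        "?ty e' ! (3 * c + code b) = card {i. i < n \<and> pc i = c \<and> e' ! i = b}"
        by (simp_all add: k[simplified] code_inj code_less)
      then show ?thesis using eq by metis
    next
      case False
      then have none: "{i. i < n \<and> pc i = c \<and> P i} = {}" for P using pc by auto
      show ?thesis unfolding none ..
    qed
  qed
  have "inj_on (\<lambda>j. ?ty (E j)) {..<m}"
  proof (rule linorder_inj_onI)
    fix i j assume ij: "i < j" "i \<in> {..<m}" "j \<in> {..<m}"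
    show "?ty (E i) \<noteq> ?ty (E j)"
    proof
      assume "?ty (E i) = ?ty (E j)"
      from same_type_perm[OF ty[OF this]] obtain \<pi> where
        \<pi>: "\<pi> permutes {..<n}" "\<And>i. i < n \<Longrightarrow> pc (\<pi> i) = pc i" "\<And>k. k < n \<Longrightarrow> E j ! k = E i ! \<pi> k" by blast
      have Eij: "E i \<in> insts n" "E j \<in> insts n" using E(1) ij by auto
      have "permute_list \<pi> (E i) = E j"
        by (rule insts_nth_eq[of _ n]) (use Eij \<pi> in \<open>auto simp: permute_insts permute_insts_nth\<close>)
      \<comment> \<open>A permutation never maps an instance below itself, while the later element
        \<open>E j\<close> is below \<open>E i\<close>.\<close>
      moreover have "\<not> R (permute_list \<pi> (E i)) (E i)"
        by (rule no_descent[OF ir tr Eij(1)]) (use permute_insts inv[OF \<pi>(1,2)] in auto)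
      ultimately show False using less[of i j] ij by simp
    qed
  qed auto
  moreover have "(\<lambda>j. ?ty (E j)) ` {..<m} \<subseteq> {xs. set xs \<subseteq> {..n} \<and> length xs = 3 * C}"
  proof -
    have "card {i. i < n \<and> P i} \<le> n" for P
      using card_mono[of "{..<n}" "{i. i < n \<and> P i}"] by auto
    then show ?thesis by auto
  qed
  moreover have "finite {xs. set xs \<subseteq> {..n} \<and> length xs = 3 * C}" by (rule finite_lists_length_eq) simp
  ultimately have "card {..<m} \<le> card {xs. set xs \<subseteq> {..n} \<and> length xs = 3 * C}" by (rule card_inj_on_le)
  then show ?thesis by (simp add: card_lists_length_eq)
qed

section \<open>Evaluation of formulas\<close>

lemma finite_atomic_fv: "finite (atomic_fv f)"
  by (induction f) auto

definition entry_pattern :: "nat \<Rightarrow> (nat \<Rightarrow> inst) \<Rightarrow> nat \<Rightarrow> nat" where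
  "entry_pattern K v i = pattern (\<lambda>y. code (v y ! i)) K"

lemma entry_pattern_less: "entry_pattern K v i < 3 ^ K"
  unfolding entry_pattern_def by (rule pattern_less) (rule code_less)

lemma entry_pattern_eq:
  "entry_pattern K v i = entry_pattern K v j \<Longrightarrow> y < K \<Longrightarrow> v y ! i = v y ! j"
  unfolding entry_pattern_def using pattern_inj[of _ K _ y] code_less code_inj by meson

text \<open>The current values of the variables below \<open>K\<close> act as the parameters of the
  type. The representative arises from \<open>e\<close> by a permutation that fixes them, so
  \<open>f\<close> cannot tell the two apart. The old value of \<open>x\<close> may be among them,
  which only refines the types.\<close>

lemma atomic_sat_representative:
  assumes v: "\<And>y. v y \<in> insts n" and K: "atomic_fv f \<subseteq> {..<K}" and e: "e \<in> insts n"
  shows "\<exists>s. (\<forall>c < 2 * 3 ^ K. s c \<le> n) \<and> (\<forall>c \<ge> 2 * 3 ^ K. s c = 0) \<and>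
    atomic_sat n (v(x := inst n (sorted_digit (3 ^ K) (entry_pattern K v) s))) f = atomic_sat n (v(x := e)) f"
proof -
  obtain s where s: "\<forall>c < 2 * 3 ^ K. s c \<le> n" "\<forall>c \<ge> 2 * 3 ^ K. s c = 0"
    "same_type n (entry_pattern K v) e (inst n (sorted_digit (3 ^ K) (entry_pattern K v) s))"
    using sorted_representative[of n "entry_pattern K v" "3 ^ K" e] entry_pattern_less by blast
  let ?e = "inst n (sorted_digit (3 ^ K) (entry_pattern K v) s)"
  from same_type_perm[OF s(3)] obtain \<pi> where \<pi>: "\<pi> permutes {..<n}"
    "\<And>i. i < n \<Longrightarrow> entry_pattern K v (\<pi> i) = entry_pattern K v i" "\<And>i. i < n \<Longrightarrow> ?e ! i = e ! \<pi> i" by blast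
  have "atomic_sat n (v(x := ?e)) f = atomic_sat n (v(x := e)) f"
  proof (rule atomic_sat_same_orbit[OF \<pi>(1)])
    fix y assume y: "y \<in> atomic_fv f"
    show "(v(x := e)) y \<in> insts n \<and> (v(x := ?e)) y \<in> insts n" using v e by simp
    fix i assume i: "i < n"
    show "(v(x := ?e)) y ! i = (v(x := e)) y ! \<pi> i"
      using \<pi>(3)[OF i] entry_pattern_eq[OF \<pi>(2)[OF i], of y] y K by (auto simp del: inst_nth)
  qed
  with s(1,2) show ?thesis by blast
qed

lemma inst_cong: "(\<And>i. i < n \<Longrightarrow> d i = d' i) \<Longrightarrow> inst n d = inst n d'"
  by (simp add: inst_def)

lemma pt_code_dec: assumes "pt f" shows "pt (\<lambda>e. code (dec (f e)))"
proof -
  have "pt (\<lambda>e. if f e = 0 then 0 else if f e = 2 then 2 else 1)" by (intro pt_intros assms)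
  moreover have "(\<lambda>e. if f e = 0 then 0 else if f e = 2 then 2 else 1) = (\<lambda>e. code (dec (f e)))"
    by (auto simp: code_def dec_def)
  ultimately show ?thesis by simp
qed

text \<open>The index has fewer than \<open>C\<close> values for a constant \<open>C\<close>, so the
  case distinction is a fixed sum of products with indicators.\<close>

lemma pt_select:
  assumes "\<And>c. pt (\<tau> c)" "pt k" "\<And>e. k e < C"
  shows "pt (\<lambda>e. \<tau> (k e) e)"
proof -
  have "pt (\<lambda>e. \<Sum>c < C. of_bool (k e = c) * \<tau> c e)" by (intro pt_fixed_sum pt_intros assms)
  moreover have "(\<Sum>c < C. of_bool (k e = c) * \<tau> c e) = \<tau> (k e) e" for e
    using assms(3)[of e] sum.delta[of "{..<C}" "k e" "\<lambda>c. \<tau> c e"]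
    by (simp add: of_bool_def if_distrib[of "\<lambda>x. x * _"] cong: if_cong)
  ultimately show ?thesis by simp
qed

lemma pt_app: "pt2 J \<Longrightarrow> pt a \<Longrightarrow> pt (\<lambda>e. J (tl_env e) (a e))"
  by (rule pt2_app[OF _ sub_tl[OF sub_id]])

lemma pt_sorted_digit:
  assumes I: "\<And>y. pt2 (I y)" and \<tau>: "\<And>c. pt (\<tau> c)"
  shows "pt2 (\<lambda>e. sorted_digit (3 ^ K) (\<lambda>i. pattern (\<lambda>y. code (dec (I y e i))) K) (\<lambda>c. \<tau> c e))"
proof -
  let ?k = "\<lambda>e. pattern (\<lambda>y. code (dec (I y (tl_env e) (hd_env e)))) K"
  have k: "pt ?k" unfolding pattern_def
    by (intro pt_fixed_sum pt_intros pt_code_dec pt_app[OF I])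
  have less: "?k e < 3 ^ K" for e by (rule pattern_less) (rule code_less)
  have 1: "pt (\<lambda>e. (\<lambda>c e. \<tau> c (tl_env e)) (?k e) e)"
    by (rule pt_select[OF _ k less]) (intro pt_comp[OF \<tau>] pt_intros)
  have 2: "pt (\<lambda>e. (\<lambda>c e. \<tau> (3 ^ K + c) (tl_env e)) (?k e) e)"
    by (rule pt_select[OF _ k less]) (intro pt_comp[OF \<tau>] pt_intros)
  show ?thesis unfolding pt2_def sorted_digit_def by (intro pt_intros 1[simplified] 2[simplified])
qed

text \<open>A quantifier over \<open>3 ^ n\<close> instances becomes one over
  \<open>2 * 3 ^ K\<close> cut points up to \<open>n\<close>, and \<open>K\<close> depends only on
  the formula. With the truth value \<open>b\<close> as a parameter, a universal quantifier is
  covered as a negated existential one.\<close>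

lemma atomic_sat_Ex_representative:
  assumes "atomic_fv f \<subseteq> {..<K}"
  shows "(\<exists>e \<in> insts n. atomic_sat n ((\<lambda>z. inst n (I z))(x := e)) f = b) \<longleftrightarrow>
    (\<exists>s. (\<forall>c < 2 * 3 ^ K. s c \<le> n) \<and> (\<forall>c \<ge> 2 * 3 ^ K. s c = 0) \<and>
      atomic_sat n (\<lambda>z. inst n (if z = x then sorted_digit (3 ^ K) (\<lambda>i. pattern (\<lambda>y. code (dec (I y i))) K) s
         else I z)) f = b)" (is "?l \<longleftrightarrow> ?r")
proof -
  let ?v = "\<lambda>z. inst n (I z)"
  have eq: "(\<lambda>z. inst n (if z = x then sorted_digit (3 ^ K) (\<lambda>i. pattern (\<lambda>y. code (dec (I y i))) K) s else I z)) =
     ?v(x := inst n (sorted_digit (3 ^ K) (entry_pattern K ?v) s))" for s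
    by (auto simp: fun_eq_iff entry_pattern_def sorted_digit_def intro!: inst_cong)
  show ?thesis unfolding eq
  proof
    assume ?l
    then obtain e where "e \<in> insts n" "atomic_sat n (?v(x := e)) f = b" by blast
    with atomic_sat_representative[of ?v n f K e x, OF inst_in assms] show
      "\<exists>s. (\<forall>c < 2 * 3 ^ K. s c \<le> n) \<and> (\<forall>c \<ge> 2 * 3 ^ K. s c = 0) \<and>
        atomic_sat n (?v(x := inst n (sorted_digit (3 ^ K) (entry_pattern K ?v) s))) f = b" by blast
  qed (use inst_in in blast)
qed

lemma pb_atomic_quantifier:
  assumes IH: "\<And>n I. pt n \<Longrightarrow> (\<And>x. pt2 (I x)) \<Longrightarrow> pb (\<lambda>e. atomic_sat (n e) (\<lambda>x. inst (n e) (I x e)) f)"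
    and n: "pt n" and I: "\<And>x. pt2 (I x)"
  shows "pb (\<lambda>e. \<exists>a \<in> insts (n e). atomic_sat (n e) ((\<lambda>x. inst (n e) (I x e))(x := a)) f = b)"
proof -
  obtain K where K: "atomic_fv f \<subseteq> {..<K}"
    using finite_nat_iff_bounded finite_atomic_fv by blast
  show ?thesis unfolding atomic_sat_Ex_representative[OF K]
  proof (rule pb_ex_fun[OF n])
    fix G and \<tau> :: "nat \<Rightarrow> env \<Rightarrow> nat"
    assume G: "sub G" and \<tau>: "\<And>c. pt (\<tau> c)"
    let ?I = "\<lambda>z e. if z = x then sorted_digit (3 ^ K) (\<lambda>i. pattern (\<lambda>y. code (dec (I y (G e) i))) K) (\<lambda>c. \<tau> c e)
         else I z (G e)"
    have "pt2 (?I z)" for z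
      using pt_sorted_digit[of "\<lambda>y e. I y (G e)" \<tau> K, OF pt2_comp[OF I G] \<tau>] pt2_comp[OF I G, of z]
      by (cases "z = x") simp_all
    from IH[of "\<lambda>e. n (G e)" ?I, OF pt_comp[OF n G] this]
    show "pb (\<lambda>e. atomic_sat (n (G e)) (\<lambda>z. inst (n (G e)) (?I z e)) f = b)"
      by (intro pb_iff pb_const)
  qed
qed

text \<open>The digit functions \<open>I\<close> are arbitrary in the induction, because a
  quantifier replaces one of them by sorted digits computed from all of them.\<close>

lemma pb_atomic:
  "pt n \<Longrightarrow> (\<And>x. pt2 (I x)) \<Longrightarrow> pb (\<lambda>e. atomic_sat (n e) (\<lambda>x. inst (n e) (I x e)) f)"
proof (induction f arbitrary: n I)
  case (Subs x y)
  \<comment> \<open>Digits are compared by tests for 0 and 2, since all other digits denote the same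
    value.\<close>
  have "pb (\<lambda>e. \<forall>i < n e. I x e i \<noteq> 0 \<longrightarrow> I y e i \<noteq> 0 \<and> (I x e i = 2) = (I y e i = 2))"
    by (intro pt_intros pt_app[OF Subs(2)] pt_comp[OF Subs(1)] Subs(1))
  moreover have "subsumed (inst n a) (inst n b) \<longleftrightarrow> (\<forall>i < n. a i \<noteq> 0 \<longrightarrow> b i \<noteq> 0 \<and> (a i = 2) = (b i = 2))" for n a b
    by (auto simp: subsumed_def inst_def dec_def split: if_splits)
  ultimately show ?case by simp
next
  case (Prec x y)
  have "pb (\<lambda>e. (\<Sum>i < n e. of_bool (I y e i = 0)) \<le> (\<Sum>i < n e. of_bool (I x e i = 0) :: nat))"
    by (intro pt_intros pt_app[OF Prec(2)] pt_comp[OF Prec(1)] Prec(1))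
  moreover have "card (bots (inst n a)) = (\<Sum>i < n. of_bool (a i = 0))" for n a
  proof -
    have "bots (inst n a) = {..<n} \<inter> {i. a i = 0}" by (auto simp: bots_def inst_def dec_def split: if_splits)
    then show ?thesis by (simp add: sum.If_cases of_bool_def)
  qed
  ultimately show ?case by (simp only: atomic_sat.simps less_defined_def)
next
  case (Equal x y)
  have "pb (\<lambda>e. \<forall>i < n e. (I x e i = 0) = (I y e i = 0) \<and> (I x e i = 2) = (I y e i = 2))"
    by (intro pt_intros pt_app[OF Equal(2)] pt_comp[OF Equal(1)] Equal(1))
  moreover have "inst n a = inst n b \<longleftrightarrow> (\<forall>i < n. (a i = 0) = (b i = 0) \<and> (a i = 2) = (b i = 2))" for n a b
  proof -
    have "inst n a = inst n b \<longleftrightarrow> (\<forall>i < n. dec (a i) = dec (b i))" by (auto simp: inst_def)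
    moreover have "dec c = dec d \<longleftrightarrow> (c = 0) = (d = 0) \<and> (c = 2) = (d = 2)" for c d
      by (auto simp: dec_def)
    ultimately show ?thesis by blast
  qed
  ultimately show ?case by simp
next
  case (ANot f)
  then show ?case by (auto intro: pb_not)
next
  case (AAnd f g)
  then show ?case by (auto intro: pb_conj)
next
  case (AOr f g)
  then show ?case by (auto intro: pb_disj)
next
  case (AEx x f)
  have "pb (\<lambda>e. \<exists>a \<in> insts (n e). atomic_sat (n e) ((\<lambda>x. inst (n e) (I x e))(x := a)) f = True)"
    by (rule pb_atomic_quantifier[OF AEx.IH AEx.prems])
  then show ?case by simp
next
  case (AAll x f)
  have "pb (\<lambda>e. \<not> (\<exists>a \<in> insts (n e). atomic_sat (n e) ((\<lambda>x. inst (n e) (I x e))(x := a)) f = False))"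
    by (rule pb_not[OF pb_atomic_quantifier[OF AAll.IH AAll.prems]])
  then show ?case by simp
qed

section \<open>Guarded quantifiers\<close>

primrec gsat :: "nat \<Rightarrow> inst set \<Rightarrow> inst set \<Rightarrow> (nat \<Rightarrow> inst) \<Rightarrow> dt_foil \<Rightarrow> bool" where
  "gsat n N P v (Atomic f) \<longleftrightarrow> atomic_sat n v f"
| "gsat n N P v (DNot f) \<longleftrightarrow> \<not> gsat n N P v f"
| "gsat n N P v (DAnd f g) \<longleftrightarrow> gsat n N P v f \<and> gsat n N P v g"
| "gsat n N P v (DOr f g) \<longleftrightarrow> gsat n N P v f \<or> gsat n N P v g"
| "gsat n N P v (ExNode x f) \<longleftrightarrow> (\<exists>e \<in> N. gsat n N P (v(x := e)) f)"
| "gsat n N P v (AllNode x f) \<longleftrightarrow> (\<forall>e \<in> N. gsat n N P (v(x := e)) f)"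
| "gsat n N P v (ExPosLeaf x f) \<longleftrightarrow> (\<exists>e \<in> P. gsat n N P (v(x := e)) f)"
| "gsat n N P v (AllPosLeaf x f) \<longleftrightarrow> (\<forall>e \<in> P. gsat n N P (v(x := e)) f)"

text \<open>The tree enters a formula only through two sets of instances, so families read off from
  tables can take its place.\<close>

lemma sat_gsat: "sat n T v f = gsat n (node_insts n T) (pos_leaf_insts n T) v f"
  by (induction f arbitrary: v) auto

lemma gsat_cong: "(\<And>x. x \<in> fv f \<Longrightarrow> v x = v' x) \<Longrightarrow> gsat n N P v f = gsat n N P v' f"
proof (induction f arbitrary: v v')
  case (Atomic f)
  then show ?case using atomic_sat_cong[of f v v' n] by simp
next
  case (DNot f)
  from DNot.IH[of v v'] DNot.prems show ?case by simp
next
  case (DAnd f g)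
  from DAnd.IH(1)[of v v'] DAnd.IH(2)[of v v'] DAnd.prems show ?case by simp
next
  case (DOr f g)
  from DOr.IH(1)[of v v'] DOr.IH(2)[of v v'] DOr.prems show ?case by simp
next
  case (ExNode x f)
  have "gsat n N P (v(x := e)) f = gsat n N P (v'(x := e)) f" for e
    by (rule ExNode.IH) (use ExNode.prems in auto)
  then show ?case by simp
next
  case (AllNode x f)
  have "gsat n N P (v(x := e)) f = gsat n N P (v'(x := e)) f" for e
    by (rule AllNode.IH) (use AllNode.prems in auto)
  then show ?case by simp
next
  case (ExPosLeaf x f)
  have "gsat n N P (v(x := e)) f = gsat n N P (v'(x := e)) f" for e
    by (rule ExPosLeaf.IH) (use ExPosLeaf.prems in auto)
  then show ?case by simp
next
  case (AllPosLeaf x f)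
  have "gsat n N P (v(x := e)) f = gsat n N P (v'(x := e)) f" for e
    by (rule AllPosLeaf.IH) (use AllPosLeaf.prems in auto)
  then show ?case by simp
qed

definition pt3 :: "(env \<Rightarrow> nat \<Rightarrow> nat \<Rightarrow> nat) \<Rightarrow> bool" where
  "pt3 J \<longleftrightarrow> pt (\<lambda>e. J (tl_env (tl_env e)) (hd_env (tl_env e)) (hd_env e))"

lemma pt3_app: assumes "pt3 J" "sub G" "pt a" "pt b" shows "pt (\<lambda>e. J (G e) (a e) (b e))"
  using pt_comp[OF assms(1)[unfolded pt3_def] sub_push[OF assms(4) sub_push[OF assms(3,2)]]] by simp

definition pb2 :: "(env \<Rightarrow> nat \<Rightarrow> bool) \<Rightarrow> bool" where
  "pb2 P \<longleftrightarrow> pb (\<lambda>e. P (tl_env e) (hd_env e))"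

lemma pb2_app: assumes "pb2 P" "sub G" "pt a" shows "pb (\<lambda>e. P (G e) (a e))"
  using pb_comp[OF assms(1)[unfolded pb2_def] sub_push[OF assms(3,2)]] by simp

definition family :: "(env \<Rightarrow> nat) \<Rightarrow> (env \<Rightarrow> nat) \<Rightarrow> (env \<Rightarrow> nat \<Rightarrow> bool) \<Rightarrow> (env \<Rightarrow> nat \<Rightarrow> nat \<Rightarrow> nat) \<Rightarrow> env \<Rightarrow> inst set" where
  "family n M P D e = {inst (n e) (D e q) | q. q < M e \<and> P e q}"

text \<open>Quantifying over a family is a bounded quantification over its indices. The body
  \<open>S\<close> is abstract, so that its negation yields universal guards, and it is assumed
  definable under all changes \<open>G\<close> of the environment because the index is pushed on
  top.\<close>

lemma pb_guard:
  assumes IH: "\<And>G I. sub G \<Longrightarrow> (\<And>x. pt2 (I x)) \<Longrightarrow> pb (\<lambda>e. S (G e) (\<lambda>x. inst (n (G e)) (I x e)))"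
    and MPD: "pt M" "pb2 P" "pt3 D" and G: "sub G" and I: "\<And>x. pt2 (I x)"
  shows "pb (\<lambda>e. \<exists>a \<in> family n M P D (G e). S (G e) ((\<lambda>x. inst (n (G e)) (I x e))(x := a)))"
proof -
  let ?I = "\<lambda>z e. if z = x then D (G (tl_env e)) (hd_env e) else I z (tl_env e)"
  have G': "sub (\<lambda>e. G (tl_env e))" by (intro sub_comp[OF G] pt_intros)
  have "pt2 (?I z)" for z
  proof (cases "z = x")
    case True
    have "pt (\<lambda>e. D (G (tl_env (tl_env e))) (hd_env (tl_env e)) (hd_env e))"
      by (intro pt3_app[OF MPD(3)] sub_comp[OF G] pt_intros)
    with True show ?thesis by (simp add: pt2_def)
  qed (use pt2_comp[OF I sub_tl[OF sub_id]] in simp)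
  from IH[of "\<lambda>e. G (tl_env e)" ?I, OF G' this]
  have "pb (\<lambda>e. \<exists>q < M (G e). P (G e) q \<and>
      S (G e) (\<lambda>z. inst (n (G e)) (if z = x then D (G e) q else I z e)))"
    by (intro pb_ex pb_conj pb2_app[OF MPD(2)] G' pt_intros pt_comp[OF MPD(1) G])
  moreover have "(\<lambda>z. inst (n (G e)) (if z = x then D (G e) q else I z e)) =
      (\<lambda>x. inst (n (G e)) (I x e))(x := inst (n (G e)) (D (G e) q))" for e q by auto
  moreover have "(\<exists>a \<in> family n M P D e. Q a) \<longleftrightarrow> (\<exists>q < M e. P e q \<and> Q (inst (n e) (D e q)))" for e Q
    by (auto simp: family_def)
  ultimately show ?thesis by simp
qed

lemma pb_gsat:
  assumes "pt n" "pt M" "pt M'" "pb2 P" "pb2 P'" "pt3 D"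
  shows "sub G \<Longrightarrow> (\<And>x. pt2 (I x)) \<Longrightarrow>
    pb (\<lambda>e. gsat (n (G e)) (family n M P D (G e)) (family n M' P' D (G e)) (\<lambda>x. inst (n (G e)) (I x e)) f)"
proof (induction f arbitrary: G I)
  case (Atomic f)
  show ?case using pb_atomic[of "\<lambda>e. n (G e)" I f] pt_comp[OF assms(1) Atomic(1)] Atomic(2) by simp
next
  case (DNot f)
  then show ?case by (auto intro: pb_not)
next
  case (DAnd f g)
  then show ?case by (auto intro: pb_conj)
next
  case (DOr f g)
  then show ?case by (auto intro: pb_disj)
next
  case (ExNode x f)
  show ?case unfolding gsat.simps
    by (rule pb_guard[where n = n and S = "\<lambda>e v. gsat (n e) (family n M P D e) (family n M' P' D e) v f",
      OF ExNode.IH assms(2,4,6) ExNode.prems])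
next
  case (AllNode x f)
  have "pb (\<lambda>e. \<exists>a \<in> family n M P D (G e). \<not> gsat (n (G e)) (family n M P D (G e)) (family n M' P' D (G e))
     ((\<lambda>x. inst (n (G e)) (I x e))(x := a)) f)"
    by (rule pb_guard[where n = n and S = "\<lambda>e v. \<not> gsat (n e) (family n M P D e) (family n M' P' D e) v f",
      OF pb_not[OF AllNode.IH] assms(2,4,6) AllNode.prems])
  from pb_not[OF this] show ?case by simp
next
  case (ExPosLeaf x f)
  show ?case unfolding gsat.simps
    by (rule pb_guard[where n = n and S = "\<lambda>e v. gsat (n e) (family n M P D e) (family n M' P' D e) v f",
      OF ExPosLeaf.IH assms(3,5,6) ExPosLeaf.prems])
next
  case (AllPosLeaf x f)
  have "pb (\<lambda>e. \<exists>a \<in> family n M' P' D (G e). \<not> gsat (n (G e)) (family n M P D (G e)) (family n M' P' D (G e))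
     ((\<lambda>x. inst (n (G e)) (I x e))(x := a)) f)"
    by (rule pb_guard[where n = n and S = "\<lambda>e v. \<not> gsat (n e) (family n M P D e) (family n M' P' D e) v f",
      OF pb_not[OF AllPosLeaf.IH] assms(3,5,6) AllPosLeaf.prems])
  from pb_not[OF this] show ?case by simp
qed

section \<open>Trees inside words\<close>

definition nthb :: "bool list \<Rightarrow> nat \<Rightarrow> bool" where
  "nthb z i \<longleftrightarrow> i < length z \<and> z ! i"

definition feature_at :: "(nat \<Rightarrow> bool) \<Rightarrow> nat \<Rightarrow> nat \<Rightarrow> bool" where
  "feature_at y q i \<longleftrightarrow> y q \<and> (\<forall>j < i. y (q + 1 + j)) \<and> \<not> y (q + 1 + i)"

text \<open>The intended meaning of \<open>S q r\<close> is that a tree is encoded from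
  \<open>q\<close> up to \<open>r\<close>. The right-hand side refers only to shorter intervals, so
  this recursive equation has a single solution in its range and a guessed table cannot lie.\<close>

definition tree_check :: "(nat \<Rightarrow> bool) \<Rightarrow> nat \<Rightarrow> (nat \<Rightarrow> nat \<Rightarrow> bool) \<Rightarrow> bool" where
  "tree_check y L S \<longleftrightarrow> (\<forall>q \<le> L. \<forall>r \<le> L. S q r =
     (\<not> y q \<and> r = q + 2 \<or>
      (\<exists>i < r. \<exists>s < r. feature_at y q i \<and> q + i + 2 < s \<and> S (q + i + 2) s \<and> S s r)))"

definition tree_word :: "bool list \<Rightarrow> nat \<Rightarrow> nat \<Rightarrow> bool" where
  "tree_word z q r \<longleftrightarrow> r \<le> length z \<and> (\<exists>T. drop q z = enc_tree T @ drop r z)"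

lemma enc_tree_length: "0 < length (enc_tree T)"
  by (cases T) auto

lemma drop_eq_append: "drop q z = xs @ ys \<Longrightarrow> ys = drop (q + length xs) z"
  by (metis add.commute append_eq_conv_conj drop_drop)

lemma drop_append_le: "drop q z = xs @ ys \<Longrightarrow> xs \<noteq> [] \<Longrightarrow> q + length xs \<le> length z"
  by (metis append_is_Nil_conv drop_eq_Nil length_append length_drop le_add_diff_inverse linorder_le_cases nat_add_left_cancel_le le_add1)

lemma tree_wordI: "drop q z = enc_tree T @ ys \<Longrightarrow> tree_word z q (q + length (enc_tree T))"
  unfolding tree_word_def using drop_append_le[of q z] drop_eq_append[of q z] enc_tree_length[of T]
  by (metis length_greater_0_conv)

lemma tree_word_bounds: "tree_word z q r \<Longrightarrow> q < r \<and> r \<le> length z"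
proof -
  assume "tree_word z q r"
  then obtain T where T: "r \<le> length z" "drop q z = enc_tree T @ drop r z" by (auto simp: tree_word_def)
  then have "length z - q = length (enc_tree T) + (length z - r)" by (metis length_append length_drop)
  with T(1) enc_tree_length[of T] show ?thesis by linarith
qed

lemma tree_word_length: "r \<le> length z \<Longrightarrow> drop q z = enc_tree T @ drop r z \<Longrightarrow> r = q + length (enc_tree T)"
proof -
  assume *: "r \<le> length z" "drop q z = enc_tree T @ drop r z"
  then have "length z - q = length (enc_tree T) + (length z - r)" by (metis length_append length_drop)
  with *(1) enc_tree_length[of T] show ?thesis by linarith
qed

text \<open>Encodings of trees are prefix-free, so the start determines the end.\<close>

lemma tree_word_unique: "drop q z = enc_tree T @ ys \<Longrightarrow> tree_word z q r \<longleftrightarrow> r = q + length (enc_tree T)"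
proof
  assume *: "drop q z = enc_tree T @ ys" "tree_word z q r"
  then obtain T' where T': "r \<le> length z" "drop q z = enc_tree T' @ drop r z" by (auto simp: tree_word_def)
  from enc_tree_inj[of T ys T' "drop r z"] *(1) T'(2) have "T' = T" by simp
  with tree_word_length[OF T'] show "r = q + length (enc_tree T)" by simp
qed (auto intro: tree_wordI)

lemma drop_nthb:
  assumes "drop q z = xs @ ys" "j < length xs"
  shows "nthb z (q + j) = xs ! j"
proof -
  have "q + j < length z" using assms drop_append_le[of q z xs ys] by fastforce
  moreover have "z ! (q + j) = (xs @ ys) ! j" using assms(1) calculation by (metis nth_drop less_imp_le le_add1 le_trans)
  ultimately show ?thesis using assms(2) by (simp add: nthb_def nth_append)
qed

lemma feature_at_enc:
  assumes "drop q z = True # enc_nat i @ ys"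
  shows "feature_at (nthb z) q j \<longleftrightarrow> j = i"
proof -
  have d: "drop q z = (True # unary i @ [False]) @ ys" using assms by (simp add: enc_nat_def)
  have 0: "nthb z q" using drop_nthb[OF d, of 0] by simp
  have 1: "nthb z (q + 1 + k)" if "k < i" for k
    using drop_nthb[OF d, of "Suc k"] that by (simp add: nth_append)
  have 2: "\<not> nthb z (q + 1 + i)" using drop_nthb[OF d, of "Suc i"] by (simp add: nth_append)
  show ?thesis unfolding feature_at_def using 0 1 2 by (metis linorder_neqE_nat)
qed

text \<open>Positions beyond the end read as False and could be mistaken for the terminator of a
  feature; the length hypothesis excludes this.\<close>

lemma feature_at_drop:
  assumes "feature_at (nthb z) q i" "q + i + 2 \<le> length z"
  shows "drop q z = True # enc_nat i @ drop (q + i + 2) z"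
proof (rule nth_equalityI)
  show "length (drop q z) = length (True # enc_nat i @ drop (q + i + 2) z)"
    using assms(2) by (simp add: enc_nat_def)
  fix k assume k: "k < length (drop q z)"
  then have zk: "drop q z ! k = nthb z (q + k)" using assms(2) by (auto simp: nthb_def)
  consider "k = 0" | j where "k = Suc j" "j < i" | "k = Suc i" | j where "k = i + 2 + j"
    by (metis add_2_eq_Suc add_Suc_right add.commute le_add_diff_inverse less_Suc_eq not0_implies_Suc not_less_eq not_less Suc_leI)
  then show "drop q z ! k = (True # enc_nat i @ drop (q + i + 2) z) ! k"
  proof cases
    case 1
    then show ?thesis using assms(1) zk by (simp add: feature_at_def)
  next
    case 2
    then show ?thesis using assms(1) zk by (simp add: feature_at_def enc_nat_def nth_append)
  next
    case 3
    then show ?thesis using assms(1) zk by (simp add: feature_at_def enc_nat_def nth_append)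
  next
    case 4
    then show ?thesis using assms(2) by (simp add: enc_nat_def nth_append add.assoc)
  qed
qed

lemma tree_check_tree_word: "tree_check (nthb z) (length z) (tree_word z)"
  unfolding tree_check_def
proof (intro allI impI iffI)
  fix q r assume qr: "q \<le> length z" "r \<le> length z"
  {
    assume t: "tree_word z q r"
    then obtain T where T: "drop q z = enc_tree T @ drop r z" by (auto simp: tree_word_def)
    have r: "r = q + length (enc_tree T)" using tree_word_length qr(2) T by blast
    show "\<not> nthb z q \<and> r = q + 2 \<or> (\<exists>i < r. \<exists>s < r. feature_at (nthb z) q i \<and> q + i + 2 < s \<and>
        tree_word z (q + i + 2) s \<and> tree_word z s r)"
    proof (cases T)
      case (Leaf b)
      then show ?thesis using drop_nthb[OF T, of 0] r by simp
    next
      case (Node i l rt)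
      have d: "drop q z = True # enc_nat i @ enc_tree l @ enc_tree rt @ drop r z" using T Node by simp
      then have d1: "drop (q + i + 2) z = enc_tree l @ enc_tree rt @ drop r z"
        using drop_eq_append[of q z "True # enc_nat i"] by (simp add: enc_nat_def algebra_simps)
      let ?s = "q + i + 2 + length (enc_tree l)"
      have d2: "drop ?s z = enc_tree rt @ drop r z" using drop_eq_append[OF d1] by simp
      have r': "r = ?s + length (enc_tree rt)" using r Node by (simp add: enc_nat_def)
      have "feature_at (nthb z) q i" using feature_at_enc[OF d] by simp
      with tree_wordI[OF d1] tree_wordI[OF d2] r' enc_tree_length[of l] enc_tree_length[of rt]
      show ?thesis by (intro disjI2 exI[of _ i] exI[of _ ?s] conjI) auto
    qed
  next
    assume "\<not> nthb z q \<and> r = q + 2 \<or> (\<exists>i < r. \<exists>s < r. feature_at (nthb z) q i \<and> q + i + 2 < s \<and>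
        tree_word z (q + i + 2) s \<and> tree_word z s r)"
    then show "tree_word z q r"
    proof (elim disjE conjE exE)
      assume *: "\<not> nthb z q" "r = q + 2"
      then have "drop q z = z ! q # z ! Suc q # drop r z" using qr(2) by (simp add: Cons_nth_drop_Suc)
      then have "drop q z = enc_tree (Leaf (z ! Suc q)) @ drop r z" using * qr(2) by (simp add: nthb_def)
      then show ?thesis using qr(2) unfolding tree_word_def by blast
    next
      fix i s assume *: "feature_at (nthb z) q i" "tree_word z (q + i + 2) s" "tree_word z s r"
      then obtain T T' where T: "drop (q + i + 2) z = enc_tree T @ drop s z" "drop s z = enc_tree T' @ drop r z"
        by (auto simp: tree_word_def)
      have "q + i + 2 \<le> length z" using tree_word_bounds[OF *(2)] by simp
      from feature_at_drop[OF *(1) this] T have "drop q z = enc_tree (Node i T T') @ drop r z" by simp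
      then show ?thesis using qr(2) unfolding tree_word_def by blast
    qed
  }
qed

lemma tree_checkD:
  assumes "tree_check y L S" "q \<le> L" "r \<le> L"
  shows "S q r = (\<not> y q \<and> r = q + 2 \<or>
      (\<exists>i < r. \<exists>s < r. feature_at y q i \<and> q + i + 2 < s \<and> S (q + i + 2) s \<and> S s r))"
  by (rule assms(1)[unfolded tree_check_def, rule_format, OF assms(2,3)])

text \<open>Induction on the length of the interval; \<open>q + i + 2 < s < r\<close> makes both
  parts shorter.\<close>

lemma tree_check_unique:
  assumes "tree_check y L S" "tree_check y L S'" "q \<le> L" "r \<le> L"
  shows "S q r = S' q r"
  using assms(3,4)
proof (induction "r - q" arbitrary: q r rule: less_induct)
  case less
  have "S (q + i + 2) s = S' (q + i + 2) s \<and> S s r = S' s r" if "s < r" "q + i + 2 < s" for i s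
    using less.hyps[of s "q + i + 2"] less.hyps[of r s] less.prems that by simp
  then have "(\<not> y q \<and> r = q + 2 \<or>
      (\<exists>i < r. \<exists>s < r. feature_at y q i \<and> q + i + 2 < s \<and> S (q + i + 2) s \<and> S s r)) =
    (\<not> y q \<and> r = q + 2 \<or>
      (\<exists>i < r. \<exists>s < r. feature_at y q i \<and> q + i + 2 < s \<and> S' (q + i + 2) s \<and> S' s r))" by blast
  then show ?case unfolding tree_checkD[OF assms(1) less.prems] tree_checkD[OF assms(2) less.prems] .
qed

section \<open>Tables of nodes and their instances\<close>

definition child :: "(nat \<Rightarrow> bool) \<Rightarrow> (nat \<Rightarrow> nat \<Rightarrow> bool) \<Rightarrow> nat \<Rightarrow> nat \<Rightarrow> bool \<Rightarrow> nat \<Rightarrow> bool" where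
  "child y S a i b q \<longleftrightarrow> feature_at y a i \<and> a + i + 2 \<le> q \<and> (if b then S (a + i + 2) q else q = a + i + 2)"

text \<open>An edge sets one feature and keeps the others. So value \<open>b\<close> of
  \<open>k\<close> comes from a \<open>b\<close>-edge on \<open>k\<close> itself, or from the parent
  across an edge that does not overwrite it.\<close>

definition inherits :: "(nat \<Rightarrow> bool) \<Rightarrow> nat \<Rightarrow> (nat \<Rightarrow> nat \<Rightarrow> bool) \<Rightarrow> (nat \<Rightarrow> bool) \<Rightarrow> (nat \<Rightarrow> bool) \<Rightarrow>
    bool \<Rightarrow> nat \<Rightarrow> nat \<Rightarrow> bool" where
  "inherits y L S P d b q k \<longleftrightarrow> (\<exists>a < q. P a \<and>
     (\<exists>i < L. child y S a i b q \<and> (k = i \<or> d a) \<or> child y S a i (\<not> b) q \<and> k \<noteq> i \<and> d a))"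

text \<open>The root is at position \<open>q0\<close>, and \<open>D b q k\<close> says that feature \<open>k\<close> has value \<open>b\<close> at the node at \<open>q\<close>.\<close>

definition node_check :: "(nat \<Rightarrow> bool) \<Rightarrow> nat \<Rightarrow> (nat \<Rightarrow> nat \<Rightarrow> bool) \<Rightarrow> nat \<Rightarrow> nat \<Rightarrow> (nat \<Rightarrow> bool) \<Rightarrow>
    (bool \<Rightarrow> nat \<Rightarrow> nat \<Rightarrow> bool) \<Rightarrow> bool" where
  "node_check y L S q0 n P D \<longleftrightarrow>
     (\<forall>q \<le> L. P q = (q = q0 \<or> (\<exists>a < q. P a \<and> (\<exists>i < L. child y S a i False q \<or> child y S a i True q)))) \<and>
     (\<forall>b. \<forall>q \<le> L. \<forall>k < n. P q \<longrightarrow> D b q k = inherits y L S P (\<lambda>a. D b a k) b q k)"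

lemma node_checkD:
  assumes "node_check y L S q0 n P D" "q \<le> L"
  shows "P q = (q = q0 \<or> (\<exists>a < q. P a \<and> (\<exists>i < L. child y S a i False q \<or> child y S a i True q)))"
    and "k < n \<Longrightarrow> P q \<Longrightarrow> D b q k = inherits y L S P (\<lambda>a. D b a k) b q k"
  using assms unfolding node_check_def by blast+

lemma inherits_cong:
  assumes "\<And>a. a < q \<Longrightarrow> P a = P' a" "\<And>a. a < q \<Longrightarrow> P a \<Longrightarrow> d a = d' a"
    and "\<And>a i b. child y S a i b q = child y S' a i b q"
  shows "inherits y L S P d b q k = inherits y L S' P' d' b q k"
proof -
  have "P a \<and> (\<exists>i < L. child y S a i b q \<and> (k = i \<or> d a) \<or> child y S a i (\<not> b) q \<and> k \<noteq> i \<and> d a) \<longleftrightarrow>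
      P' a \<and> (\<exists>i < L. child y S' a i b q \<and> (k = i \<or> d' a) \<or> child y S' a i (\<not> b) q \<and> k \<noteq> i \<and> d' a)"
    if "a < q" for a
    using that assms by (cases "P a") auto
  then show ?thesis unfolding inherits_def by blast
qed

text \<open>Parents precede their children in the word, so the equations determine the tables by
  induction on the position. Values are compared only at nodes and below \<open>n\<close>, where the
  equations constrain them.\<close>

lemma node_check_unique:
  assumes "node_check y L S q0 n P D" "node_check y L S q0 n P' D'" "q \<le> L"
  shows "P q = P' q \<and> (P q \<longrightarrow> (\<forall>b. \<forall>k < n. D b q k = D' b q k))"
  using assms(3)
proof (induction q rule: less_induct)
  case (less q)
  have IH: "P a = P' a" "P a \<Longrightarrow> k < n \<Longrightarrow> D b a k = D' b a k" if "a < q" for a b k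
    using less.IH[OF that] that less.prems by simp_all
  have P: "P q = P' q"
    using node_checkD(1)[OF assms(1) less.prems] node_checkD(1)[OF assms(2) less.prems] IH(1) by blast
  have "D b q k = D' b q k" if "P q" "k < n" for b k
  proof -
    have "inherits y L S P (\<lambda>a. D b a k) b q k = inherits y L S P' (\<lambda>a. D' b a k) b q k"
      by (rule inherits_cong) (use IH that(2) in auto)
    then show ?thesis
      using node_checkD(2)[OF assms(1) less.prems] node_checkD(2)[OF assms(2) less.prems] that P by simp
  qed
  with P show ?case by blast
qed

text \<open>The check inspects only positions up to \<open>L\<close> and features below
  \<open>n\<close>, which is all that a table in a certificate can be made to represent.\<close>

lemma node_check_agree:
  assumes S: "\<And>q r. q \<le> L \<Longrightarrow> r \<le> L \<Longrightarrow> S' q r = S q r"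
    and P: "\<And>q. q \<le> L \<Longrightarrow> P' q = P q" and D: "\<And>b q i. q \<le> L \<Longrightarrow> i < n \<Longrightarrow> D' b q i = D b q i"
    and c: "node_check y L S q0 n P D"
  shows "node_check y L S' q0 n P' D'"
  unfolding node_check_def
proof (intro conjI allI impI)
  fix q assume q: "q \<le> L"
  have child: "child y S' a i b q = child y S a i b q" for a i b
    using S[of "a + i + 2" q] q by (auto simp: child_def)
  have Pa: "P' a = P a" if "a < q" for a using P[of a] q that by simp
  show "P' q = (q = q0 \<or> (\<exists>a < q. P' a \<and> (\<exists>i < L. child y S' a i False q \<or> child y S' a i True q)))"
    unfolding P[OF q] child using node_checkD(1)[OF c q] Pa by blast
  fix b k assume "k < n" "P' q"
  then show "D' b q k = inherits y L S' P' (\<lambda>a. D' b a k) b q k"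
    using node_checkD(2)[OF c q, of k b] P[OF q] D[OF q] D Pa q child
      inherits_cong[of q P' P "\<lambda>a. D' b a k" "\<lambda>a. D b a k" y S' S L b k] by simp
qed

text \<open>The nodes of a tree whose encoding starts at \<open>q\<close>, with position, partial instance and subtree,
  where \<open>e\<close> is the partial instance of the root.\<close>

primrec nodes :: "nat \<Rightarrow> inst \<Rightarrow> dtree \<Rightarrow> (nat \<times> inst \<times> dtree) set" where
  "nodes q e (Leaf b) = {(q, e, Leaf b)}"
| "nodes q e (Node i l r) = insert (q, e, Node i l r)
     (nodes (q + i + 2) (e[i := Some False]) l \<union> nodes (q + i + 2 + length (enc_tree l)) (e[i := Some True]) r)"

lemma nodes_root: "(q, e, T) \<in> nodes q e T"
  by (cases T) auto

lemma nodes_bounds: "(p, e', T') \<in> nodes q e T \<Longrightarrow> q \<le> p \<and> p < q + length (enc_tree T)"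
proof (induction T arbitrary: q e)
  case (Node i l r)
  then consider "p = q" | "(p, e', T') \<in> nodes (q + i + 2) (e[i := Some False]) l"
    | "(p, e', T') \<in> nodes (q + i + 2 + length (enc_tree l)) (e[i := Some True]) r" by auto
  then show ?case
  proof cases
    case 2
    from Node.IH(1)[OF this] show ?thesis by (simp add: enc_nat_def)
  next
    case 3
    from Node.IH(2)[OF this] show ?thesis by (simp add: enc_nat_def)
  qed simp
qed simp

text \<open>The subtrees occupy disjoint intervals behind their root, so a position identifies its
  node.\<close>

lemma nodes_unique:
  "(p, e1, T1) \<in> nodes q e T \<Longrightarrow> (p, e2, T2) \<in> nodes q e T \<Longrightarrow> e1 = e2 \<and> T1 = T2"
proof (induction T arbitrary: q e)
  case (Node i l r)
  let ?L = "nodes (q + i + 2) (e[i := Some False]) l"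
  let ?R = "nodes (q + i + 2 + length (enc_tree l)) (e[i := Some True]) r"
  have L: "q < p \<and> p < q + i + 2 + length (enc_tree l)" if "(p, e', T') \<in> ?L" for e' T'
    using nodes_bounds[OF that] by simp
  have R: "q + i + 2 + length (enc_tree l) \<le> p" if "(p, e', T') \<in> ?R" for e' T'
    using nodes_bounds[OF that] by simp
  have 1: "(p, e1, T1) = (q, e, Node i l r) \<or> (p, e1, T1) \<in> ?L \<or> (p, e1, T1) \<in> ?R"
    and 2: "(p, e2, T2) = (q, e, Node i l r) \<or> (p, e2, T2) \<in> ?L \<or> (p, e2, T2) \<in> ?R"
    using Node.prems by (simp_all only: nodes.simps insert_iff Un_iff)
  consider "p = q" | "q < p" "p < q + i + 2 + length (enc_tree l)" | "q < p" "q + i + 2 + length (enc_tree l) \<le> p"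
    using 1 L R by fastforce
  then show ?case
  proof cases
    case p: 1
    then have "(p, e1, T1) = (q, e, Node i l r)" "(p, e2, T2) = (q, e, Node i l r)"
      using 1 2 L R by fastforce+
    then show ?thesis by simp
  next
    case p: 2
    then have "(p, e1, T1) \<in> ?L" "(p, e2, T2) \<in> ?L" using 1 2 R by fastforce+
    then show ?thesis by (rule Node.IH(1))
  next
    case p: 3
    then have "(p, e1, T1) \<in> ?R" "(p, e2, T2) \<in> ?R" using 1 2 L by fastforce+
    then show ?thesis by (rule Node.IH(2))
  qed
qed simp

lemma nodes_drop:
  "(p, e', T') \<in> nodes q e T \<Longrightarrow> drop q z = enc_tree T @ ys \<Longrightarrow> \<exists>ys. drop p z = enc_tree T' @ ys"
proof (induction T arbitrary: q e ys)
  case (Node i l r)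
  have d: "drop q z = True # enc_nat i @ enc_tree l @ enc_tree r @ ys" using Node.prems(2) by simp
  then have d1: "drop (q + i + 2) z = enc_tree l @ enc_tree r @ ys"
    using drop_eq_append[of q z "True # enc_nat i"] by (simp add: enc_nat_def algebra_simps)
  have d2: "drop (q + i + 2 + length (enc_tree l)) z = enc_tree r @ ys" using drop_eq_append[OF d1] by simp
  consider "(p, e', T') = (q, e, Node i l r)" | "(p, e', T') \<in> nodes (q + i + 2) (e[i := Some False]) l"
    | "(p, e', T') \<in> nodes (q + i + 2 + length (enc_tree l)) (e[i := Some True]) r" using Node.prems(1) by auto
  then show ?case
  proof cases
    case 1
    then show ?thesis using Node.prems(2) by auto
  next
    case 2
    then show ?thesis using Node.IH(1) d1 by blast
  next
    case 3
    then show ?thesis using Node.IH(2) d2 by blast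
  qed
qed auto

definition child_pos :: "nat \<Rightarrow> nat \<Rightarrow> dtree \<Rightarrow> bool \<Rightarrow> nat" where
  "child_pos a i l b = (if b then a + i + 2 + length (enc_tree l) else a + i + 2)"

lemma nodes_child:
  "(a, e', Node i l r) \<in> nodes q e T \<Longrightarrow>
   (child_pos a i l b, e'[i := Some b], if b then r else l) \<in> nodes q e T"
proof (induction T arbitrary: q e)
  case (Node j l' r')
  consider "(a, e', Node i l r) = (q, e, Node j l' r')" | "(a, e', Node i l r) \<in> nodes (q + j + 2) (e[j := Some False]) l'"
    | "(a, e', Node i l r) \<in> nodes (q + j + 2 + length (enc_tree l')) (e[j := Some True]) r'" using Node.prems(1) by auto
  then show ?case
  proof cases
    case 1
    then show ?thesis using nodes_root by (cases b) (auto simp: child_pos_def)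
  next
    case 2
    from Node.IH(1)[OF this] show ?thesis by simp
  next
    case 3
    from Node.IH(2)[OF this] show ?thesis by simp
  qed
qed simp

lemma nodes_parent:
  "(p, e', T') \<in> nodes q e T \<Longrightarrow> (p, e', T') = (q, e, T) \<or>
   (\<exists>a ea i l r b. (a, ea, Node i l r) \<in> nodes q e T \<and>
     (p, e', T') = (child_pos a i l b, ea[i := Some b], if b then r else l))"
proof (induction T arbitrary: q e)
  case (Node j l' r')
  let ?L = "nodes (q + j + 2) (e[j := Some False]) l'"
  let ?R = "nodes (q + j + 2 + length (enc_tree l')) (e[j := Some True]) r'"
  have root: "(q, e, Node j l' r') \<in> nodes q e (Node j l' r')" by simp
  consider "(p, e', T') = (q, e, Node j l' r')" | "(p, e', T') \<in> ?L" | "(p, e', T') \<in> ?R" using Node.prems by auto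
  then show ?case
  proof cases
    case 2
    from Node.IH(1)[OF this] show ?thesis
    proof
      assume "(p, e', T') = (q + j + 2, e[j := Some False], l')"
      then have "(p, e', T') = (child_pos q j l' False, e[j := Some False], if False then r' else l')"
        by (simp add: child_pos_def)
      with root show ?thesis by blast
    next
      assume "\<exists>a ea i l r b. (a, ea, Node i l r) \<in> ?L \<and>
        (p, e', T') = (child_pos a i l b, ea[i := Some b], if b then r else l)"
      then obtain a ea i l r b where "(a, ea, Node i l r) \<in> ?L" and
        eq: "(p, e', T') = (child_pos a i l b, ea[i := Some b], if b then r else l)" by blast
      then have "(a, ea, Node i l r) \<in> nodes q e (Node j l' r')" by simp
      with eq show ?thesis by blast
    qed
  next
    case 3
    from Node.IH(2)[OF this] show ?thesis
    proof
      assume "(p, e', T') = (q + j + 2 + length (enc_tree l'), e[j := Some True], r')"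
      then have "(p, e', T') = (child_pos q j l' True, e[j := Some True], if True then r' else l')"
        by (simp add: child_pos_def)
      with root show ?thesis by blast
    next
      assume "\<exists>a ea i l r b. (a, ea, Node i l r) \<in> ?R \<and>
        (p, e', T') = (child_pos a i l b, ea[i := Some b], if b then r else l)"
      then obtain a ea i l r b where "(a, ea, Node i l r) \<in> ?R" and
        eq: "(p, e', T') = (child_pos a i l b, ea[i := Some b], if b then r else l)" by blast
      then have "(a, ea, Node i l r) \<in> nodes q e (Node j l' r')" by simp
      with eq show ?thesis by blast
    qed
  qed simp
qed simp

lemma nodes_length: "(p, e', T') \<in> nodes q e T \<Longrightarrow> length e' = length e"
  by (induction T arbitrary: q e) fastforce+

text \<open>The header at \<open>a\<close> determines the feature, and by prefix-freeness the end of
  the left subtree, which is where the right one starts.\<close>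

lemma child_iff:
  assumes "(a, ea, Ta) \<in> nodes q0 e T" "drop q0 z = enc_tree T @ ys"
  shows "child (nthb z) (tree_word z) a i b q \<longleftrightarrow> (\<exists>l r. Ta = Node i l r \<and> q = child_pos a i l b)"
proof -
  obtain ys' where d: "drop a z = enc_tree Ta @ ys'" using nodes_drop[OF assms] by blast
  show ?thesis
  proof (cases Ta)
    case (Leaf c)
    then have "\<not> nthb z a" using drop_nthb[OF d, of 0] by simp
    then show ?thesis using Leaf by (simp add: child_def feature_at_def)
  next
    case (Node j l r)
    then have d0: "drop a z = True # enc_nat j @ enc_tree l @ enc_tree r @ ys'" using d by simp
    then have d1: "drop (a + j + 2) z = enc_tree l @ enc_tree r @ ys'"
      using drop_eq_append[of a z "True # enc_nat j"] by (simp add: enc_nat_def algebra_simps)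
    show ?thesis unfolding child_def feature_at_enc[OF d0] Node child_pos_def
      using tree_word_unique[OF d1, of q] by auto
  qed
qed

text \<open>This holds for any table \<open>S\<close>, also a guessed one, so bounded quantifiers
  suffice in the check.\<close>

lemma child_less: "child y S a i b q \<Longrightarrow> q \<le> L \<Longrightarrow> a < q \<and> i < L"
  by (auto simp: child_def)

section \<open>Intended contents of the tables\<close>

definition node_at :: "nat \<Rightarrow> inst \<Rightarrow> dtree \<Rightarrow> nat \<Rightarrow> bool" where
  "node_at q0 e T q \<longleftrightarrow> (\<exists>e' T'. (q, e', T') \<in> nodes q0 e T)"

definition value_at :: "nat \<Rightarrow> inst \<Rightarrow> dtree \<Rightarrow> bool \<Rightarrow> nat \<Rightarrow> nat \<Rightarrow> bool" where
  "value_at q0 e T b q k \<longleftrightarrow> (\<exists>e' T'. (q, e', T') \<in> nodes q0 e T \<and> e' ! k = Some b)"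

lemma node_at_child:
  assumes "drop q0 z = enc_tree T @ ys" "node_at q0 e T a" "child (nthb z) (tree_word z) a i b q"
  shows "node_at q0 e T q"
proof -
  obtain ea Ta where a: "(a, ea, Ta) \<in> nodes q0 e T" using assms(2) by (auto simp: node_at_def)
  then obtain l r where Ta: "Ta = Node i l r" "q = child_pos a i l b" using child_iff[OF a assms(1)] assms(3) by blast
  from nodes_child[of a ea i l r q0 e T b] a Ta show ?thesis unfolding node_at_def by blast
qed

lemma node_at_parent:
  assumes "drop q0 z = enc_tree T @ ys" "(q, e', T') \<in> nodes q0 e T"
  shows "(q, e', T') = (q0, e, T) \<or> (\<exists>a ea Ta i b. (a, ea, Ta) \<in> nodes q0 e T \<and>
    child (nthb z) (tree_word z) a i b q \<and> e' = ea[i := Some b])"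
  using nodes_parent[OF assms(2)]
proof
  assume "\<exists>a ea i l r b. (a, ea, Node i l r) \<in> nodes q0 e T \<and>
    (q, e', T') = (child_pos a i l b, ea[i := Some b], if b then r else l)"
  then obtain a ea i l r b where a: "(a, ea, Node i l r) \<in> nodes q0 e T"
    and eq: "(q, e', T') = (child_pos a i l b, ea[i := Some b], if b then r else l)" by blast
  have "child (nthb z) (tree_word z) a i b q" using child_iff[OF a assms(1)] eq by blast
  with a eq show ?thesis by blast
qed simp

lemma value_at_iff:
  assumes d: "drop q0 z = enc_tree T @ ys" and k: "k < n"
  shows "value_at q0 (replicate n None) T c q k \<longleftrightarrow>
    (\<exists>a i b. node_at q0 (replicate n None) T a \<and> child (nthb z) (tree_word z) a i b q \<and>
      (if k = i then b = c else value_at q0 (replicate n None) T c a k))" (is "?l \<longleftrightarrow> ?r")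
proof
  let ?e = "replicate n None :: inst"
  assume ?l
  then obtain e' T' where q: "(q, e', T') \<in> nodes q0 ?e T" "e' ! k = Some c" by (auto simp: value_at_def)
  \<comment> \<open>The root instance is undefined everywhere, so a node with a value has a
    parent.\<close>
  then have "(q, e', T') \<noteq> (q0, ?e, T)" using k by auto
  with node_at_parent[OF d q(1)] obtain a ea Ta i b where a: "(a, ea, Ta) \<in> nodes q0 ?e T"
    "child (nthb z) (tree_word z) a i b q" "e' = ea[i := Some b]" by blast
  have "length ea = n" using nodes_length[OF a(1)] by simp
  then have "if k = i then b = c else ea ! k = Some c" using q(2) a(3) k by (auto simp: nth_list_update)
  with a show ?r unfolding value_at_def node_at_def
    by (intro exI[of _ a] exI[of _ i] exI[of _ b]) (auto split: if_splits)
next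
  let ?e = "replicate n None :: inst"
  assume ?r
  then obtain a i b where aib: "node_at q0 ?e T a" "child (nthb z) (tree_word z) a i b q"
    "if k = i then b = c else value_at q0 ?e T c a k" by blast
  obtain ea Ta where a: "(a, ea, Ta) \<in> nodes q0 ?e T" "k \<noteq> i \<longrightarrow> ea ! k = Some c"
    using aib(1,3) by (cases "k = i") (auto simp: node_at_def value_at_def)
  then obtain l r where Ta: "Ta = Node i l r" "q = child_pos a i l b" using child_iff[OF a(1) d] aib(2) by blast
  have "length ea = n" using nodes_length[OF a(1)] by simp
  then have "ea[i := Some b] ! k = Some c" using a(2) aib(3) k by (cases "k = i") auto
  then show ?l using nodes_child[of a ea i l r q0 ?e T b] a Ta unfolding value_at_def by blast
qed

text \<open>Together with \<open>node_check_unique\<close>, this makes the intended tables the only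
  ones that pass, as far as tables are read.\<close>

lemma node_check_nodes:
  assumes d: "drop q0 z = enc_tree T @ ys"
  shows "node_check (nthb z) (length z) (tree_word z) q0 n
     (node_at q0 (replicate n None) T) (value_at q0 (replicate n None) T)"
proof -
  let ?e = "replicate n None :: inst" and ?L = "length z"
  let ?P = "node_at q0 ?e T" and ?c = "child (nthb z) (tree_word z)" and ?D = "value_at q0 ?e T"
  have 1: "?P q = (q = q0 \<or> (\<exists>a < q. ?P a \<and> (\<exists>i < ?L. ?c a i False q \<or> ?c a i True q)))"
    if q: "q \<le> ?L" for q
  proof
    assume "?P q"
    then obtain e' T' where "(q, e', T') \<in> nodes q0 ?e T" by (auto simp: node_at_def)
    from node_at_parent[OF d this] show "q = q0 \<or> (\<exists>a < q. ?P a \<and> (\<exists>i < ?L. ?c a i False q \<or> ?c a i True q))"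
    proof
      assume "\<exists>a ea Ta i b. (a, ea, Ta) \<in> nodes q0 ?e T \<and> ?c a i b q \<and> e' = ea[i := Some b]"
      then obtain a ea Ta i b where a: "(a, ea, Ta) \<in> nodes q0 ?e T" "?c a i b q" by blast
      have "?P a" using a(1) unfolding node_at_def by blast
      moreover have "?c a i False q \<or> ?c a i True q" using a(2) by (cases b) simp_all
      moreover have "a < q" "i < ?L" using child_less[OF a(2) q] by simp_all
      ultimately show ?thesis by blast
    qed simp
  next
    assume "q = q0 \<or> (\<exists>a < q. ?P a \<and> (\<exists>i < ?L. ?c a i False q \<or> ?c a i True q))"
    then consider "q = q0" | a i b where "?P a" "?c a i b q" by blast
    then show "?P q"
    proof cases
      case 1
      then show ?thesis using nodes_root unfolding node_at_def by blast
    qed (rule node_at_child[OF d])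
  qed
  have 2: "?D c q k = inherits (nthb z) ?L (tree_word z) ?P (\<lambda>a. ?D c a k) c q k" if q: "q \<le> ?L" and k: "k < n" for c q k
    unfolding value_at_iff[OF d k, of c q] inherits_def
  proof
    assume "\<exists>a i b. ?P a \<and> ?c a i b q \<and> (if k = i then b = c else ?D c a k)"
    then obtain a i b where *: "?P a" "?c a i b q" "if k = i then b = c else ?D c a k" by blast
    from child_less[OF *(2) q] have "a < q" "i < ?L" by auto
    with * show "\<exists>a < q. ?P a \<and> (\<exists>i < ?L. ?c a i c q \<and> (k = i \<or> ?D c a k) \<or>
          ?c a i (\<not> c) q \<and> k \<noteq> i \<and> ?D c a k)" by (cases "b = c") (auto split: if_splits)
  next
    assume "\<exists>a < q. ?P a \<and> (\<exists>i < ?L. ?c a i c q \<and> (k = i \<or> ?D c a k) \<or>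
          ?c a i (\<not> c) q \<and> k \<noteq> i \<and> ?D c a k)"
    then obtain a i where *: "?P a" "?c a i c q \<and> (k = i \<or> ?D c a k) \<or> ?c a i (\<not> c) q \<and> k \<noteq> i \<and> ?D c a k"
      by blast
    then show "\<exists>a i b. ?P a \<and> ?c a i b q \<and> (if k = i then b = c else ?D c a k)"
      by (metis (full_types))
  qed
  show ?thesis unfolding node_check_def by (intro conjI allI impI) (rule 1 2, assumption+)+
qed

section \<open>Instances of nodes along paths\<close>

fun follow :: "dtree \<Rightarrow> bool list \<Rightarrow> inst \<Rightarrow> inst" where
  "follow (Node i l r) (b # u) e = follow (if b then r else l) u (e[i := Some b])"
| "follow _ _ e = e"

lemma nodes_follow:
  "(\<exists>p. (p, e', T') \<in> nodes q e T) \<longleftrightarrow> (\<exists>u. subtree_at T u = Some T' \<and> e' = follow T u e)"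
proof (induction T arbitrary: q e)
  case (Leaf b)
  have "(\<exists>u. subtree_at (Leaf b) u = Some T' \<and> e' = follow (Leaf b) u e) \<longleftrightarrow> T' = Leaf b \<and> e' = e"
  proof
    assume "\<exists>u. subtree_at (Leaf b) u = Some T' \<and> e' = follow (Leaf b) u e"
    then obtain u where "subtree_at (Leaf b) u = Some T'" "e' = follow (Leaf b) u e" by blast
    then show "T' = Leaf b \<and> e' = e" by (cases u) auto
  qed (auto intro: exI[of _ "[]"])
  then show ?case by auto
next
  case (Node i l r)
  have "(\<exists>u. subtree_at (Node i l r) u = Some T' \<and> e' = follow (Node i l r) u e) \<longleftrightarrow>
      T' = Node i l r \<and> e' = e \<or> (\<exists>u. subtree_at l u = Some T' \<and> e' = follow l u (e[i := Some False])) \<or>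
      (\<exists>u. subtree_at r u = Some T' \<and> e' = follow r u (e[i := Some True]))" (is "?l = ?r")
  proof
    assume ?l
    then obtain u where u: "subtree_at (Node i l r) u = Some T'" "e' = follow (Node i l r) u e" by blast
    then show ?r
    proof (cases u)
      case (Cons b u')
      with u show ?thesis by (cases b) auto
    qed auto
  next
    assume ?r
    then show ?l
    proof (elim disjE exE conjE)
      fix u assume "subtree_at l u = Some T'" "e' = follow l u (e[i := Some False])"
      then show ?l by (intro exI[of _ "False # u"]) simp
    next
      fix u assume "subtree_at r u = Some T'" "e' = follow r u (e[i := Some True])"
      then show ?l by (intro exI[of _ "True # u"]) simp
    qed (auto intro: exI[of _ "[]"])
  qed
  then show ?case unfolding Node.IH(1)[symmetric, where q = "q + i + 2" and e = "e[i := Some False]"]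
      Node.IH(2)[symmetric, where q = "q + i + 2 + length (enc_tree l)" and e = "e[i := Some True]"]
    by auto
qed

lemma follow_update:
  "i \<notin> features T \<Longrightarrow> subtree_at T u \<noteq> None \<Longrightarrow> follow T u (e[i := x]) = (follow T u e)[i := x]"
proof (induction T u e rule: follow.induct)
  case (1 j l r b u e)
  then show ?case by (cases b) (auto simp: list_update_swap)
qed auto

text \<open>\<open>follow\<close> updates from the root downward and lets later edges win,
  \<open>path_inst\<close> builds upward and lets earlier edges win. They agree because no feature
  is repeated on a path.\<close>

lemma follow_path_inst:
  "decision_tree n T \<Longrightarrow> subtree_at T u \<noteq> None \<Longrightarrow> follow T u (replicate n None) = path_inst n T u"
proof (induction n T u rule: path_inst.induct)
  case (1 n i l r b u)
  then show ?case by (cases b) (auto simp: follow_update)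
qed auto

lemma node_insts_nodes:
  assumes "decision_tree n T"
  shows "node_insts n T = {e'. \<exists>p T'. (p, e', T') \<in> nodes q (replicate n None) T}"
    and "pos_leaf_insts n T = {e'. \<exists>p. (p, e', Leaf True) \<in> nodes q (replicate n None) T}"
proof -
  have "e' \<in> node_insts n T \<longleftrightarrow> (\<exists>T' u. subtree_at T u = Some T' \<and> e' = follow T u (replicate n None))" for e'
    unfolding node_insts_def using follow_path_inst[OF assms] by fastforce
  then show "node_insts n T = {e'. \<exists>p T'. (p, e', T') \<in> nodes q (replicate n None) T}"
    unfolding nodes_follow[symmetric, where T = T and e = "replicate n None" and q = q] by blast
  have "e' \<in> pos_leaf_insts n T \<longleftrightarrow> (\<exists>u. subtree_at T u = Some (Leaf True) \<and> e' = follow T u (replicate n None))" for e'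
    unfolding pos_leaf_insts_def using follow_path_inst[OF assms] by fastforce
  then show "pos_leaf_insts n T = {e'. \<exists>p. (p, e', Leaf True) \<in> nodes q (replicate n None) T}"
    unfolding nodes_follow[symmetric, where T = T and e = "replicate n None" and q = q] by blast
qed

text \<open>Any two table bits yield an entry; if both are set, it is
  \<open>Some False\<close>.\<close>

definition digit :: "bool \<Rightarrow> bool \<Rightarrow> nat" where
  "digit b c = (if b then 1 else if c then 2 else 0)"

lemma dec_digit: "(\<forall>b. D b \<longleftrightarrow> x = Some b) \<Longrightarrow> dec (digit (D False) (D True)) = x"
  by (cases x) (auto simp: digit_def dec_def)

text \<open>By uniqueness, guessed tables that pass coincide with the intended ones wherever they
  are used. A positive leaf is recognized by its code, False followed by True.\<close>

lemma tables_sound: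
  assumes S: "tree_check (nthb z) (length z) S"
    and C: "node_check (nthb z) (length z) S q0 n P D"
    and d: "drop q0 z = enc_tree T @ ys" and T: "decision_tree n T"
  shows "{inst n (\<lambda>k. digit (D False q k) (D True q k)) | q. q < length z + 1 \<and> P q} = node_insts n T"
    and "{inst n (\<lambda>k. digit (D False q k) (D True q k)) | q. q < length z + 1 \<and> P q \<and> \<not> nthb z q \<and> nthb z (q + 1)} =
      pos_leaf_insts n T"
proof -
  let ?e = "replicate n None :: inst"
  have "node_check (nthb z) (length z) (tree_word z) q0 n P D"
    by (rule node_check_agree[OF _ refl refl C]) (rule tree_check_unique[OF tree_check_tree_word S])
  from node_check_unique[OF this node_check_nodes[OF d]]
  have P: "P q = node_at q0 ?e T q" and D: "P q \<Longrightarrow> k < n \<Longrightarrow> D b q k = value_at q0 ?e T b q k"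
    if "q \<le> length z" for q b k using that by blast+
  have le: "q < length z" if "(q, e', T') \<in> nodes q0 ?e T" for q e' T'
    using nodes_bounds[OF that] drop_append_le[OF d] enc_tree_length[of T] by fastforce
  have eq: "inst n (\<lambda>k. digit (D False q k) (D True q k)) = e'" if q: "(q, e', T') \<in> nodes q0 ?e T" for q e' T'
  proof (rule nth_equalityI)
    show "length (inst n (\<lambda>k. digit (D False q k) (D True q k))) = length e'"
      using nodes_length[OF q] by (simp add: inst_def)
    fix k assume "k < length (inst n (\<lambda>k. digit (D False q k) (D True q k)))"
    then have k: "k < n" by (simp add: inst_def)
    have "P q" using P[of q] le[OF q] q by (auto simp: node_at_def)
    then have "D b q k = value_at q0 ?e T b q k" for b using D[of q k b] le[OF q] k by simp
    moreover have "value_at q0 ?e T b q k = (e' ! k = Some b)" for b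
    proof
      assume "value_at q0 ?e T b q k"
      then obtain e'' T'' where q': "(q, e'', T'') \<in> nodes q0 ?e T" "e'' ! k = Some b"
        unfolding value_at_def by blast
      from nodes_unique[OF q q'(1)] q'(2) show "e' ! k = Some b" by simp
    next
      assume "e' ! k = Some b"
      with q show "value_at q0 ?e T b q k" unfolding value_at_def by blast
    qed
    ultimately have "D b q k = (e' ! k = Some b)" for b by (simp only:)
    then show "inst n (\<lambda>k. digit (D False q k) (D True q k)) ! k = e' ! k"
      using dec_digit[of "\<lambda>b. D b q k" "e' ! k"] k by simp
  qed
  have leaf: "T' = Leaf True \<longleftrightarrow> \<not> nthb z q \<and> nthb z (q + 1)" if q: "(q, e', T') \<in> nodes q0 ?e T" for q e' T'
  proof -
    obtain ys' where d': "drop q z = enc_tree T' @ ys'" using nodes_drop[OF q d] by blast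
    show ?thesis
    proof (cases T')
      case (Leaf c)
      then show ?thesis using drop_nthb[OF d', of 0] drop_nthb[OF d', of 1] by auto
    next
      case (Node i l r)
      then show ?thesis using drop_nthb[OF d', of 0] by auto
    qed
  qed
  have Pq: "q < length z + 1 \<and> P q \<longleftrightarrow> (\<exists>e' T'. (q, e', T') \<in> nodes q0 ?e T)" for q
    using P[of q] le[of q] unfolding node_at_def by (auto simp: less_Suc_eq_le) (metis less_imp_le)+
  show "{inst n (\<lambda>k. digit (D False q k) (D True q k)) | q. q < length z + 1 \<and> P q} = node_insts n T"
    unfolding node_insts_nodes(1)[OF T, of q0] Pq using eq by blast
  have "{inst n (\<lambda>k. digit (D False q k) (D True q k)) | q. q < length z + 1 \<and> P q \<and> \<not> nthb z q \<and> nthb z (q + 1)} =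
    {inst n (\<lambda>k. digit (D False q k) (D True q k)) | q. (\<exists>e' T'. (q, e', T') \<in> nodes q0 ?e T) \<and> \<not> nthb z q \<and> nthb z (q + 1)}"
    using Pq by blast
  also have "\<dots> = pos_leaf_insts n T"
    unfolding node_insts_nodes(2)[OF T, of q0] using eq leaf by blast
  finally show "{inst n (\<lambda>k. digit (D False q k) (D True q k)) | q. q < length z + 1 \<and> P q \<and> \<not> nthb z q \<and> nthb z (q + 1)} =
      pos_leaf_insts n T" .
qed

section \<open>The oracle language\<close>

lemma len_tl [simp]: "len k (tl_env e) = len k e" and bit_tl [simp]: "bit k (tl_env e) = bit k e"
  by (auto simp: len_def bit_def tl_env_def fun_eq_iff)

text \<open>Queries arrive reversed; reading them from the end restores the order of the input and
  the partial output behind it.\<close>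

definition zbit :: "env \<Rightarrow> nat \<Rightarrow> bool" where
  "zbit e i \<longleftrightarrow> i < len False e \<and> bit False e (len False e - 1 - i)"

text \<open>The certificate consists of six tables: 0 for the intervals occupied by subtrees, 1 for the
  positions of nodes, 2 and 3 for the features with value 0 and 1 at a node, and 4 and 5 for the
  features with value 0 and 1 in an instance of the chain.\<close>

definition tab :: "nat \<Rightarrow> env \<Rightarrow> nat \<Rightarrow> nat \<Rightarrow> bool" where
  "tab k e a b = bit True e (k + 6 * (b + (len False e + 1) * a))"

definition chain_digit :: "env \<Rightarrow> nat \<Rightarrow> nat \<Rightarrow> nat" where
  "chain_digit e j i = digit (tab 4 e j i) (tab 5 e j i)"

definition node_digit :: "env \<Rightarrow> nat \<Rightarrow> nat \<Rightarrow> nat" where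
  "node_digit e q i = digit (tab 2 e q i) (tab 3 e q i)"

definition param_digit :: "(nat \<Rightarrow> bool) \<Rightarrow> nat \<Rightarrow> nat \<Rightarrow> nat \<Rightarrow> nat \<Rightarrow> nat" where
  "param_digit y r n c i = (if y (r + 2 * (n * c + i)) then if y (r + 2 * (n * c + i) + 1) then 2 else 1 else 0)"

definition phi_digit :: "nat \<Rightarrow> env \<Rightarrow> nat \<Rightarrow> nat \<Rightarrow> nat \<Rightarrow> nat \<Rightarrow> nat \<Rightarrow> nat" where
  "phi_digit k e n r j x i =
     (if x = 0 then chain_digit e j i else if x \<le> k then param_digit (zbit e) r n (x - 1) i else 0)"

text \<open>Chains descend: the later element takes the place of \<open>y\<close>, the earlier one
  that of \<open>z\<close>. The parameters of \<open>\<rho>\<close> are stored behind the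
  \<open>k\<close> parameters of \<open>\<phi>\<close>.\<close>

definition rho_digit :: "nat \<Rightarrow> nat \<Rightarrow> env \<Rightarrow> nat \<Rightarrow> nat \<Rightarrow> nat \<Rightarrow> nat \<Rightarrow> nat \<Rightarrow> nat" where
  "rho_digit k l e n r j x i =
     (if x = 0 then chain_digit e (j + 1) i else if x = 1 then chain_digit e j i
      else if x \<le> l + 1 then param_digit (zbit e) r n (k + (x - 2)) i else 0)"

definition phi_check :: "nat \<Rightarrow> dt_foil \<Rightarrow> env \<Rightarrow> nat \<Rightarrow> nat \<Rightarrow> nat \<Rightarrow> bool" where
  "phi_check k \<phi> e n r j =
     gsat n {inst n (node_digit e q) | q. q < len False e + 1 \<and> tab 1 e q 0}
       {inst n (node_digit e q) | q. q < len False e + 1 \<and> tab 1 e q 0 \<and> \<not> zbit e q \<and> zbit e (q + 1)}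
       (\<lambda>x. inst n (phi_digit k e n r j x)) \<phi>"

definition rho_check :: "nat \<Rightarrow> nat \<Rightarrow> atomic \<Rightarrow> env \<Rightarrow> nat \<Rightarrow> nat \<Rightarrow> nat \<Rightarrow> bool" where
  "rho_check k l \<rho> e n r j = atomic_sat n (\<lambda>x. inst n (rho_digit k l e n r j x)) \<rho>"

text \<open>The bits of a chain length \<open>m\<close> in unary, of a separator, and of the reversed encoding of
  the last instance of the chain, whose entries are given by \<open>d\<close>, or of No if \<open>m = 0\<close>.\<close>

definition out_bit :: "nat \<Rightarrow> nat \<Rightarrow> (nat \<Rightarrow> nat) \<Rightarrow> nat \<Rightarrow> bool" where
  "out_bit n m d t \<longleftrightarrow> t < m \<or> 0 < m \<and> m < t \<and> (t = m + 1 + 2 * n \<or>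
     (\<exists>i < n. t + 2 * i = m + 2 * n \<and> d i \<noteq> 0 \<or> t + 2 * i + 1 = m + 2 * n \<and> d i = 2))"

text \<open>The unary dimension and its terminator occupy \<open>n + 1\<close> bits, so the root is
  at position \<open>n + 1\<close>.\<close>

definition table_check :: "env \<Rightarrow> nat \<Rightarrow> bool" where
  "table_check e n \<longleftrightarrow> tree_check (zbit e) (len False e) (tab 0 e) \<and>
     node_check (zbit e) (len False e) (tab 0 e) (n + 1) n (\<lambda>q. tab 1 e q 0) (\<lambda>b. tab (if b then 3 else 2) e)"

text \<open>There are $3^l$ patterns of parameter values, each with three counts, of at most \<open>n\<close>, for the
  possible entries of an instance.\<close>

definition type_bound :: "nat \<Rightarrow> nat \<Rightarrow> nat" where
  "type_bound l n = (n + 1) ^ (3 * 3 ^ l)"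

definition chain_check :: "nat \<Rightarrow> dt_foil \<Rightarrow> nat \<Rightarrow> atomic \<Rightarrow> env \<Rightarrow> nat \<Rightarrow> nat \<Rightarrow> nat \<Rightarrow> bool" where
  "chain_check k \<phi> l \<rho> e n r m \<longleftrightarrow> (\<forall>j < m. phi_check k \<phi> e n r j) \<and> (\<forall>j < m. j + 1 < m \<longrightarrow> rho_check k l \<rho> e n r j)"

text \<open>From position \<open>z\<close> on, the query must be a prefix of the word for
  \<open>m\<close> and the last instance. The length allowed is exactly that of this word, where No
  takes one bit.\<close>

definition output_check :: "env \<Rightarrow> nat \<Rightarrow> nat \<Rightarrow> nat \<Rightarrow> bool" where
  "output_check e n z m \<longleftrightarrow> z \<le> len False e \<and> len False e \<le> z + (m + 1 + (if m = 0 then 1 else 2 * n + 1)) \<and>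
     (\<forall>t < len False e. z + t < len False e \<longrightarrow> zbit e (z + t) = out_bit n m (chain_digit e (m - 1)) t)"

text \<open>\<open>n\<close> is forced to be the length of the initial run of ones and
  \<open>r\<close>, through table 0, to be the end of the tree, where the parameters start with
  \<open>2 * n\<close> bits each. The bound on \<open>m\<close> keeps quantifier and certificate
  polynomial; by \<open>chain_length\<close> it loses no chain of a valid input.\<close>

definition check :: "nat \<Rightarrow> dt_foil \<Rightarrow> nat \<Rightarrow> atomic \<Rightarrow> env \<Rightarrow> bool" where
  "check k \<phi> l \<rho> e \<longleftrightarrow> (\<exists>n < len False e. (\<forall>i < n. zbit e i) \<and> \<not> zbit e n \<and> table_check e n \<and>
     (\<exists>r \<le> len False e. tab 0 e (n + 1) r \<and>
       (\<exists>m \<le> type_bound l n. chain_check k \<phi> l \<rho> e n r m \<and> output_check e n (r + 2 * (n * (k + l))) m)))"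

lemma zbit_tl [simp]: "zbit (tl_env e) = zbit e" and tab_tl [simp]: "tab c (tl_env e) = tab c e"
  by (simp_all add: fun_eq_iff zbit_def tab_def)

lemma digits_tl [simp]: "chain_digit (tl_env e) = chain_digit e" "node_digit (tl_env e) = node_digit e"
  "phi_digit k (tl_env e) = phi_digit k e" "rho_digit k l (tl_env e) = rho_digit k l e"
  by (simp_all add: fun_eq_iff chain_digit_def node_digit_def phi_digit_def rho_digit_def)

lemma checks_tl [simp]:
  "phi_check k \<phi> (tl_env e) = phi_check k \<phi> e" "rho_check k l \<rho> (tl_env e) = rho_check k l \<rho> e"
  "table_check (tl_env e) = table_check e"
  by (simp_all add: fun_eq_iff phi_check_def rho_check_def table_check_def)

section \<open>Definability of the check by a term\<close>

lemma pb_zbit: "sub G \<Longrightarrow> pt f \<Longrightarrow> pb (\<lambda>e. zbit (G e) (f e))"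
  unfolding zbit_def by (intro pt_intros)

lemma pb_tab: "sub G \<Longrightarrow> pt a \<Longrightarrow> pt b \<Longrightarrow> pb (\<lambda>e. tab c (G e) (a e) (b e))"
  unfolding tab_def by (intro pt_intros)

lemma pt_digit: "pb p \<Longrightarrow> pb q \<Longrightarrow> pt (\<lambda>e. digit (p e) (q e))"
  unfolding digit_def by (intro pt_intros)

lemma pt_chain_digit: "sub G \<Longrightarrow> pt a \<Longrightarrow> pt b \<Longrightarrow> pt (\<lambda>e. chain_digit (G e) (a e) (b e))"
  unfolding chain_digit_def by (intro pt_digit pb_tab)

lemma pt_node_digit: "sub G \<Longrightarrow> pt a \<Longrightarrow> pt b \<Longrightarrow> pt (\<lambda>e. node_digit (G e) (a e) (b e))"
  unfolding node_digit_def by (intro pt_digit pb_tab)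

lemma pt_param_digit:
  "sub G \<Longrightarrow> pt r \<Longrightarrow> pt n \<Longrightarrow> pt c \<Longrightarrow> pt i \<Longrightarrow> pt (\<lambda>e. param_digit (zbit (G e)) (r e) (n e) (c e) (i e))"
  unfolding param_digit_def by (intro pt_intros pb_zbit)

lemma pb_phi_check:
  "sub G \<Longrightarrow> pt n \<Longrightarrow> pt r \<Longrightarrow> pt j \<Longrightarrow> pb (\<lambda>e. phi_check k \<phi> (G e) (n e) (r e) (j e))"
proof -
  \<comment> \<open>The three arguments are first the top three variables of the environment; a
    substitution then gives the general form.\<close>
  let ?n = "\<lambda>e. hd_env (tl_env (tl_env e))" and ?r = "\<lambda>e. hd_env (tl_env e)"
  let ?I = "\<lambda>x e. phi_digit k e (?n e) (?r e) (hd_env e) x"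
  let ?P = "\<lambda>e q. tab 1 e q 0" and ?P' = "\<lambda>e q. tab 1 e q 0 \<and> \<not> zbit e q \<and> zbit e (q + 1)"
  have n: "pt ?n" by (intro pt_intros)
  have M: "pt (\<lambda>e. len False e + 1)" by (intro pt_intros)
  have P: "pb2 ?P" "pb2 ?P'" unfolding pb2_def by (intro pb_tab pb_zbit pt_intros)+
  have D: "pt3 node_digit" unfolding pt3_def by (intro pt_node_digit pt_intros)
  have I: "pt2 (?I x)" for x
    unfolding pt2_def phi_digit_def by (intro pt_chain_digit pt_param_digit pt_intros)
  have "pb (\<lambda>e. phi_check k \<phi> e (?n e) (?r e) (hd_env e))"
    using pb_gsat[of ?n "\<lambda>e. len False e + 1" "\<lambda>e. len False e + 1" ?P ?P' node_digit "\<lambda>e. e" ?I \<phi>, OF n M M P D sub_id I]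
    unfolding phi_check_def family_def .
  then have *: "pb (\<lambda>e. phi_check k \<phi> (tl_env (tl_env (tl_env e))) (?n e) (?r e) (hd_env e))" by simp
  assume "sub G" "pt n" "pt r" "pt j"
  then have "sub (\<lambda>e. push (j e) (push (r e) (push (n e) (G e))))" by (intro sub_push)
  from pb_comp[OF * this] show ?thesis by (simp only: hd_push tl_push)
qed

lemma pb_rho_check:
  "sub G \<Longrightarrow> pt n \<Longrightarrow> pt r \<Longrightarrow> pt j \<Longrightarrow> pb (\<lambda>e. rho_check k l \<rho> (G e) (n e) (r e) (j e))"
proof -
  let ?n = "\<lambda>e. hd_env (tl_env (tl_env e))" and ?r = "\<lambda>e. hd_env (tl_env e)"
  let ?I = "\<lambda>x e. rho_digit k l e (?n e) (?r e) (hd_env e) x"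
  have n: "pt ?n" by (intro pt_intros)
  have I: "pt2 (?I x)" for x
    unfolding pt2_def rho_digit_def by (intro pt_chain_digit pt_param_digit pt_intros)
  have "pb (\<lambda>e. rho_check k l \<rho> e (?n e) (?r e) (hd_env e))"
    using pb_atomic[of ?n ?I \<rho>, OF n I] unfolding rho_check_def .
  then have *: "pb (\<lambda>e. rho_check k l \<rho> (tl_env (tl_env (tl_env e))) (?n e) (?r e) (hd_env e))" by simp
  assume "sub G" "pt n" "pt r" "pt j"
  then have "sub (\<lambda>e. push (j e) (push (r e) (push (n e) (G e))))" by (intro sub_push)
  from pb_comp[OF * this] show ?thesis by (simp only: hd_push tl_push)
qed

lemma pb_table_check: "sub G \<Longrightarrow> pt n \<Longrightarrow> pb (\<lambda>e. table_check (G e) (n e))"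
proof -
  have *: "pb (\<lambda>e. table_check e (hd_env e))"
    unfolding table_check_def tree_check_def node_check_def inherits_def child_def feature_at_def all_bool_eq
      if_True if_False not_True_eq_False not_False_eq_True
    by (intro pb_tab pb_zbit pt_intros)
  then have *: "pb (\<lambda>e. table_check (tl_env e) (hd_env e))" by simp
  assume "sub G" "pt n"
  from pb_comp[OF * sub_push[OF this(2,1)]] show ?thesis by (simp only: hd_push tl_push)
qed

lemma pb_check: "pb (check k \<phi> l \<rho>)"
proof -
  have "pb (\<lambda>e. check k \<phi> l \<rho> e)"
    unfolding check_def chain_check_def output_check_def out_bit_def type_bound_def
    by (intro pb_table_check pb_phi_check pb_rho_check pt_chain_digit pb_tab pb_zbit pt_intros)
  then show ?thesis by simp
qed

text \<open>Six tables with \<open>L + 1\<close> columns each. There are \<open>L + 1\<close> rows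
  for positions and \<open>(L + 1) ^ (3 * 3 ^ l)\<close> for chain elements, which is at least
  \<open>type_bound l n\<close> as \<open>n < L\<close>.\<close>

definition witness_bound :: "nat \<Rightarrow> nat poly" where
  "witness_bound l = [:6:] * [:1, 1:] * ([:1, 1:] + [:1, 1:] ^ (3 * 3 ^ l))"

definition query_language :: "nat \<Rightarrow> dt_foil \<Rightarrow> nat \<Rightarrow> atomic \<Rightarrow> bool list set" where
  "query_language k \<phi> l \<rho> =
     {w. \<exists>u. length u \<le> poly (witness_bound l) (length w) \<and> check k \<phi> l \<rho> (words w u, \<lambda>_. 0)}"

lemma query_language_NP: "query_language k \<phi> l \<rho> \<in> NP"
proof -
  obtain t where "\<And>W v. of_bool (check k \<phi> l \<rho> (W, v)) = eval t W v"
    using pb_check[of k \<phi> l \<rho>] unfolding pb_def pt_def by blast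
  from this[symmetric] have "polytime_decidable2 (\<lambda>w u. check k \<phi> l \<rho> (words w u, \<lambda>_. 0))"
    using polytime_decidable2_eval[of t] by simp
  then show ?thesis unfolding NP_def query_language_def by blast
qed

lemma zbit_words: "zbit (words w u, v) = nthb (rev w)"
  by (auto simp: fun_eq_iff zbit_def nthb_def len_def bit_def words_def rev_nth)

lemma len_words [simp]: "len False (words w u, v) = length w"
  by (simp add: len_def words_def)

lemma tree_check_agree:
  assumes "\<And>q r. q \<le> L \<Longrightarrow> r \<le> L \<Longrightarrow> S' q r = S q r" "tree_check y L S"
  shows "tree_check y L S'"
  unfolding tree_check_def
proof (intro allI impI)
  fix q r assume qr: "q \<le> L" "r \<le> L"
  have "S' (q + i + 2) s = S (q + i + 2) s \<and> S' s r = S s r" if "s < r" "q + i + 2 < s" for i s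
    using assms(1)[of "q + i + 2" s] assms(1)[of s r] qr that by simp
  then have "(\<exists>i < r. \<exists>s < r. feature_at y q i \<and> q + i + 2 < s \<and> S (q + i + 2) s \<and> S s r) =
     (\<exists>i < r. \<exists>s < r. feature_at y q i \<and> q + i + 2 < s \<and> S' (q + i + 2) s \<and> S' s r)" by blast
  with tree_checkD[OF assms(2) qr] assms(1)[OF qr]
  show "S' q r = (\<not> y q \<and> r = q + 2 \<or>
      (\<exists>i < r. \<exists>s < r. feature_at y q i \<and> q + i + 2 < s \<and> S' (q + i + 2) s \<and> S' s r))" by simp
qed

section \<open>Encoded instances and words of chains\<close>

lemma enc_inst_length: "length (enc_inst e) = 2 * length e"
proof (induction e)
  case (Cons b e)
  then show ?case by (cases b) (auto simp: enc_inst_def)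
qed (simp add: enc_inst_def)

lemma enc_inst_nth:
  "i < length e \<Longrightarrow> enc_inst e ! (2 * i) = (e ! i \<noteq> None) \<and> enc_inst e ! (2 * i + 1) = (e ! i = Some True)"
proof (induction e arbitrary: i)
  case (Cons b e)
  have "enc_inst (b # e) = enc_entry b @ enc_inst e" by (simp add: enc_inst_def)
  with Cons show ?case by (cases i; cases b) auto
qed simp

lemma enc_insts_length:
  "set es \<subseteq> insts n \<Longrightarrow> length (concat (map enc_inst es)) = 2 * (n * length es)"
  by (induction es) (auto simp: insts_def enc_inst_length)

lemma enc_insts_nth:
  "set es \<subseteq> insts n \<Longrightarrow> c < length es \<Longrightarrow> g < 2 * n \<Longrightarrow>
    concat (map enc_inst es) ! (2 * (n * c) + g) = enc_inst (es ! c) ! g"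
proof (induction es arbitrary: c)
  case (Cons e es)
  have e: "length (enc_inst e) = 2 * n" using Cons.prems by (simp add: enc_inst_length insts_def)
  show ?case
  proof (cases c)
    case 0
    then show ?thesis using e Cons.prems by (simp add: nth_append)
  next
    case (Suc c')
    then have "2 * (n * c) + g = length (enc_inst e) + (2 * (n * c') + g)" by (simp add: e algebra_simps)
    then have "concat (map enc_inst (e # es)) ! (2 * (n * c) + g) = concat (map enc_inst es) ! (2 * (n * c') + g)"
      by (simp only: list.map concat.simps nth_append_length_plus)
    then show ?thesis using Cons Suc by simp
  qed
qed simp

lemma param_digit_enc:
  assumes d: "drop r z = concat (map enc_inst es) @ p" and es: "set es \<subseteq> insts n"
    and c: "c < length es" and i: "i < n"
  shows "dec (param_digit (nthb z) r n c i) = es ! c ! i"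
proof -
  have len: "2 * (n * c + i) + 1 < length (concat (map enc_inst es))"
  proof -
    have "n * c + n \<le> n * length es" using c mult_le_mono2[of "Suc c" "length es" n] by simp
    then show ?thesis using i enc_insts_length[OF es] by simp
  qed
  have e: "length (es ! c) = n" using es c nth_mem by (auto simp: insts_def)
  have "nthb z (r + 2 * (n * c + i)) = enc_inst (es ! c) ! (2 * i)"
    using drop_nthb[OF d, of "2 * (n * c + i)"] len enc_insts_nth[OF es c, of "2 * i"] i by (simp add: algebra_simps)
  moreover have "nthb z (r + 2 * (n * c + i) + 1) = enc_inst (es ! c) ! (2 * i + 1)"
    using drop_nthb[OF d, of "2 * (n * c + i) + 1"] len enc_insts_nth[OF es c, of "2 * i + 1"] i
    by (simp add: algebra_simps)
  ultimately show ?thesis using enc_inst_nth[of i "es ! c"] i e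
    by (cases "es ! c ! i") (auto simp: param_digit_def dec_def)
qed

definition chain_word :: "nat \<Rightarrow> (nat \<Rightarrow> inst) \<Rightarrow> bool list" where
  "chain_word m E = unary m @ False # rev (enc_output (if m = 0 then None else Some (E (m - 1))))"

lemma chain_word_length:
  "(m \<noteq> 0 \<Longrightarrow> E (m - 1) \<in> insts n) \<Longrightarrow> length (chain_word m E) = m + 1 + (if m = 0 then 1 else 2 * n + 1)"
  by (auto simp: chain_word_def enc_inst_length insts_def)

lemma chain_word_nth:
  assumes m: "m \<noteq> 0 \<Longrightarrow> E (m - 1) \<in> insts n" and d: "\<And>i. m \<noteq> 0 \<Longrightarrow> i < n \<Longrightarrow> dec (d i) = E (m - 1) ! i"
    and t: "t < length (chain_word m E)"
  shows "chain_word m E ! t = out_bit n m d t"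
proof -
  consider "t < m" | "t = m" | "m < t" "m = 0" | "m < t" "0 < m" by linarith
  then show ?thesis
  proof cases
    case 1
    then show ?thesis by (simp add: chain_word_def out_bit_def nth_append)
  next
    case 2
    then show ?thesis by (simp add: chain_word_def out_bit_def nth_append)
  next
    case 3
    then have "t = 1" using t by (simp add: chain_word_def)
    with 3 show ?thesis by (simp add: chain_word_def out_bit_def)
  next
    case 4
    let ?e = "E (m - 1)"
    have e: "length ?e = n" "length (E (m - Suc 0)) = n" using m 4 by (simp_all add: insts_def)
    obtain s where s: "t = m + 1 + s" using 4 less_imp_Suc_add by fastforce
    have sl: "s < 2 * n + 1" using t 4 chain_word_length[of m E n] m s by simp
    have nth: "chain_word m E ! t = (rev (enc_inst ?e) @ [True]) ! s"
      using 4 s by (simp add: chain_word_def nth_append)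
    show ?thesis
    proof (cases "s = 2 * n")
      case True
      then have "t = m + 1 + 2 * n" using s by simp
      then have "out_bit n m d t" using 4 by (simp add: out_bit_def)
      moreover have "chain_word m E ! t" using nth True by (simp add: nth_append enc_inst_length e)
      ultimately show ?thesis by simp
    next
      case False
      \<comment> \<open>Reversal puts bit \<open>g\<close> of the encoding at offset
        \<open>2 * n - 1 - g\<close>. An even \<open>g\<close> tells whether an entry is defined, an
        odd \<open>g\<close> gives its value; by parity only one clause of \<open>out_bit\<close>
        can apply.\<close>
      let ?g = "2 * n - 1 - s"
      have g: "?g < 2 * n" "s + ?g + 1 = 2 * n" using sl False by simp_all
      have nth': "chain_word m E ! t = enc_inst ?e ! ?g"
        using nth sl False by (simp add: nth_append enc_inst_length e rev_nth)
      obtain i where i: "?g = 2 * i \<or> ?g = 2 * i + 1" by (metis oddE evenE)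
      then have "i < n" using g(1) by auto
      with i show ?thesis
      proof (elim disjE)
        assume gi: "?g = 2 * i"
        have "t + 2 * i = m + 2 * n" using s g(2) gi by linarith
        then have "t + 2 * i' = m + 2 * n \<longleftrightarrow> i' = i" "t + 2 * i' + 1 \<noteq> m + 2 * n" for i'
          by presburger+
        moreover have "t \<noteq> m + 1 + 2 * n" using s False by simp
        ultimately have "out_bit n m d t \<longleftrightarrow> d i \<noteq> 0" using 4 \<open>i < n\<close> by (auto simp: out_bit_def)
        moreover have "d i \<noteq> 0 \<longleftrightarrow> ?e ! i \<noteq> None" using d[of i, symmetric] 4 \<open>i < n\<close> by (simp add: dec_def)
        ultimately show ?thesis using nth' gi enc_inst_nth[of i ?e] e \<open>i < n\<close> by simp
      next
        assume gi: "?g = 2 * i + 1"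
        have "t + 2 * i + 1 = m + 2 * n" using s g(2) gi by linarith
        then have "t + 2 * i' + 1 = m + 2 * n \<longleftrightarrow> i' = i" "t + 2 * i' \<noteq> m + 2 * n" for i'
          by presburger+
        moreover have "t \<noteq> m + 1 + 2 * n" using s False by simp
        ultimately have "out_bit n m d t \<longleftrightarrow> d i = 2" using 4 \<open>i < n\<close> by (auto simp: out_bit_def)
        moreover have "d i = 2 \<longleftrightarrow> ?e ! i = Some True" using d[of i, symmetric] 4 \<open>i < n\<close> by (simp add: dec_def)
        ultimately show ?thesis using nth' gi enc_inst_nth[of i ?e] e \<open>i < n\<close> by simp
      qed
    qed
  qed
qed

lemma table_word:
  fixes Y :: "nat \<Rightarrow> nat \<Rightarrow> nat \<Rightarrow> bool"
  shows "\<exists>u. length u = 6 * (length w + 1) * B \<and>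
    (\<forall>c < 6. \<forall>b \<le> length w. \<forall>a < B. tab c (words w u, v) a b = Y c a b)"
proof -
  let ?N = "length w + 1"
  \<comment> \<open>Inverts the mixed radix numbering in \<open>tab\<close>: the table number below
    6, then the column up to \<open>length w\<close>, then the row.\<close>
  let ?u = "map (\<lambda>i. Y (i mod 6) (i div 6 div ?N) (i div 6 mod ?N)) [0..<6 * ?N * B]"
  have "tab c (words w ?u, v) a b = Y c a b" if "c < 6" "b \<le> length w" "a < B" for a b c
  proof -
    let ?i = "c + 6 * (b + ?N * a)"
    have N: "(b + N * a) div N = a" "(b + N * a) mod N = b" if "b < N" for N using that by simp_all
    have "b + ?N * a < ?N * Suc a" using that(2) by simp
    also have "\<dots> \<le> ?N * B" using that(3) by (intro mult_le_mono2) simp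
    finally have "b + ?N * a < ?N * B" .
    moreover have "c + 6 * X < 6 * Z" if "X < Z" for X Z using that \<open>c < 6\<close> by simp
    ultimately have "?i < 6 * (?N * B)" by blast
    then have "?i < 6 * ?N * B" by (simp only: mult.assoc)
    moreover have "(c + 6 * X) mod 6 = c" "(c + 6 * X) div 6 = X" for X using that(1) by simp_all
    moreover from N[of ?N] \<open>b \<le> length w\<close> have "(b + ?N * a) div ?N = a" "(b + ?N * a) mod ?N = b" by simp_all
    ultimately show ?thesis
      by (simp only: tab_def bit_def len_def words_def fst_conv if_True if_False length_map length_upt nth_map nth_upt
        diff_zero add_0 simp_thms)
  qed
  then show ?thesis by (intro exI[of _ ?u]) simp
qed

section \<open>Longest chains\<close>

lemma enc_nat_bits:
  assumes "z = enc_nat n @ ys"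
  shows "i < n \<Longrightarrow> nthb z i" "\<not> nthb z n"
  using assms by (simp_all add: nthb_def enc_nat_def nth_append)

definition chain :: "nat \<Rightarrow> dtree \<Rightarrow> inst list \<Rightarrow> inst list \<Rightarrow> dt_foil \<Rightarrow> atomic \<Rightarrow> (nat \<Rightarrow> inst) \<Rightarrow> nat \<Rightarrow> bool" where
  "chain n T us vs \<phi> \<rho> E m \<longleftrightarrow> (\<forall>j < m. E j \<in> insts n \<and> sat n T ((!) (E j # us)) \<phi>) \<and>
     (\<forall>j. Suc j < m \<longrightarrow> atomic_sat n ((!) (E (Suc j) # E j # vs)) \<rho>)"

context
  fixes k l n :: nat and \<phi> :: dt_foil and \<rho> :: atomic and T :: dtree and us vs :: "inst list"
  assumes opt: "opt_dt_foil (MinOf k \<phi> l \<rho>)" and valid: "valid_input (MinOf k \<phi> l \<rho>) n T us vs"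
begin

lemma input_parts:
  fixes p :: "bool list"
  defines "z \<equiv> enc_input n T us vs @ p" and "r \<equiv> n + 1 + length (enc_tree T)"
  shows "z = enc_nat n @ enc_tree T @ concat (map enc_inst (us @ vs)) @ p"
    and "drop (n + 1) z = enc_tree T @ concat (map enc_inst (us @ vs)) @ p"
    and "drop r z = concat (map enc_inst (us @ vs)) @ p"
    and "length (enc_input n T us vs) = r + 2 * (n * (k + l))"
    and "set (us @ vs) \<subseteq> insts n"
proof -
  show z: "z = enc_nat n @ enc_tree T @ concat (map enc_inst (us @ vs)) @ p"
    by (simp add: z_def enc_input_def)
  show 1: "drop (n + 1) z = enc_tree T @ concat (map enc_inst (us @ vs)) @ p"
    unfolding z by (simp add: enc_nat_def)
  show "drop r z = concat (map enc_inst (us @ vs)) @ p"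
    using drop_eq_append[OF 1] by (simp add: r_def)
  show es: "set (us @ vs) \<subseteq> insts n" using valid by auto
  show "length (enc_input n T us vs) = r + 2 * (n * (k + l))"
    using enc_insts_length[OF es] valid by (simp add: enc_input_def enc_nat_def r_def)
qed

lemma param_digit_input:
  assumes "c < k + l"
  shows "inst n (\<lambda>i. param_digit (nthb (enc_input n T us vs @ p)) (n + 1 + length (enc_tree T)) n c i) = (us @ vs) ! c"
proof (rule insts_nth_eq[of _ n])
  have c: "c < length (us @ vs)" using assms valid by simp
  then show "(us @ vs) ! c \<in> insts n" using input_parts(5) nth_mem by blast
  fix i assume "i < n"
  then show "inst n (param_digit (nthb (enc_input n T us vs @ p)) (n + 1 + length (enc_tree T)) n c) ! i = (us @ vs) ! c ! i"
    using param_digit_enc[OF input_parts(3)[of p] input_parts(5) c] by simp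
qed simp

text \<open>Tables that passed leave no freedom, so the guards range over the true nodes and leaves;
  only the chain itself is chosen by the certificate.\<close>

lemma chain_check_iff:
  assumes t: "table_check (words (rev (enc_input n T us vs @ p)) u, v) n"
  shows "chain_check k \<phi> l \<rho> (words (rev (enc_input n T us vs @ p)) u, v) n (n + 1 + length (enc_tree T)) m \<longleftrightarrow>
    chain n T us vs \<phi> \<rho> (\<lambda>j. inst n (chain_digit (words (rev (enc_input n T us vs @ p)) u, v) j)) m"
proof -
  let ?z = "enc_input n T us vs @ p" and ?r = "n + 1 + length (enc_tree T)"
  let ?e = "(words (rev ?z) u, v)"
  let ?E = "\<lambda>j. inst n (chain_digit ?e j)"
  have y: "zbit ?e = nthb ?z" by (simp only: zbit_words rev_rev_ident)
  have L: "len False ?e = length ?z" by simp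
  have tc: "tree_check (nthb ?z) (length ?z) (tab 0 ?e)"
    and nc: "node_check (nthb ?z) (length ?z) (tab 0 ?e) (n + 1) n (\<lambda>q. tab 1 ?e q 0) (\<lambda>b. tab (if b then 3 else 2) ?e)"
    using t unfolding table_check_def y L by blast+
  have T: "decision_tree n T" using valid by simp
  have k: "length us = k" and l: "length vs = l" using valid by simp_all
  note sound = tables_sound[OF tc nc input_parts(2) T, unfolded if_True if_False]
  have phi: "phi_check k \<phi> ?e n ?r j = sat n T ((!) (?E j # us)) \<phi>" for j
  proof -
    have "inst n (phi_digit k ?e n ?r j x) = (?E j # us) ! x" if "x \<in> fv \<phi>" for x
    proof (cases x)
      case 0
      then show ?thesis by (auto simp: phi_digit_def intro!: inst_cong)
    next
      case (Suc x')
      have "x \<le> k" using that opt by auto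
      then have x': "x' < k" using Suc by simp
      have "inst n (phi_digit k ?e n ?r j x) = inst n (param_digit (nthb ?z) ?r n x')"
        unfolding phi_digit_def y using Suc x' by (auto intro!: inst_cong)
      then show ?thesis using param_digit_input[of x' p] x' Suc k by (simp add: nth_append)
    qed
    then have "gsat n N P (\<lambda>x. inst n (phi_digit k ?e n ?r j x)) \<phi> = gsat n N P ((!) (?E j # us)) \<phi>" for N P
      by (rule gsat_cong)
    then show ?thesis
      unfolding phi_check_def node_digit_def L y sound sat_gsat by simp
  qed
  have rho: "rho_check k l \<rho> ?e n ?r j = atomic_sat n ((!) (?E (Suc j) # ?E j # vs)) \<rho>" for j
    unfolding rho_check_def
  proof (rule atomic_sat_cong)
    fix x assume x: "x \<in> atomic_fv \<rho>"
    consider "x = 0" | "x = 1" | x' where "x = Suc (Suc x')" by (metis not0_implies_Suc One_nat_def)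
    then show "inst n (rho_digit k l ?e n ?r j x) = (?E (Suc j) # ?E j # vs) ! x"
    proof cases
      case 3
      have "x \<le> l + 1" using x opt by auto
      then have x': "x' < l" using 3 by simp
      have "inst n (rho_digit k l ?e n ?r j x) = inst n (param_digit (nthb ?z) ?r n (k + x'))"
        unfolding rho_digit_def y using 3 x' by (auto intro!: inst_cong)
      then show ?thesis using param_digit_input[of "k + x'" p] x' 3 k by (simp add: nth_append)
    qed (auto simp: rho_digit_def intro!: inst_cong)
  qed
  show ?thesis unfolding chain_check_def chain_def phi rho by auto
qed

text \<open>Completeness: the intended tables together with any chain fit into a certificate of the
  allowed length.\<close>

lemma tables_exist:
  fixes p :: "bool list" and E :: "nat \<Rightarrow> inst"
  defines "w \<equiv> rev (enc_input n T us vs @ p)"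
  shows "\<exists>u. length u \<le> poly (witness_bound l) (length w) \<and> table_check (words w u, v) n \<and>
    tab 0 (words w u, v) (n + 1) (n + 1 + length (enc_tree T)) \<and>
    (\<forall>j < type_bound l n. E j \<in> insts n \<longrightarrow> inst n (chain_digit (words w u, v) j) = E j)"
proof -
  let ?z = "enc_input n T us vs @ p" and ?L = "length w"
  let ?root = "n + 1" and ?bot = "replicate n None :: inst"
  \<comment> \<open>Enough rows for all positions and for all chain elements.\<close>
  let ?B = "?L + 1 + (?L + 1) ^ (3 * 3 ^ l)"
  let ?Y = "\<lambda>c a b. if c = 0 then tree_word ?z a b else if c = 1 then node_at ?root ?bot T a
     else if c = 2 then value_at ?root ?bot T False a b else if c = 3 then value_at ?root ?bot T True a b
     else if c = 4 then E a ! b = Some False else E a ! b = Some True"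
  obtain u where u: "length u = 6 * (?L + 1) * ?B"
    "\<And>c a b. c < 6 \<Longrightarrow> b \<le> ?L \<Longrightarrow> a < ?B \<Longrightarrow> tab c (words w u, v) a b = ?Y c a b"
    using table_word[of w ?B v ?Y] by blast
  let ?e = "(words w u, v)"
  have L: "?L = length ?z" by (simp add: w_def)
  have y: "zbit ?e = nthb ?z" by (simp only: zbit_words rev_rev_ident w_def)
  have le: "a \<le> ?L \<Longrightarrow> a < ?B" for a by simp
  have n: "n < ?L" and q0: "?root \<le> ?L" "?root + length (enc_tree T) \<le> ?L"
    using input_parts(4) by (simp_all add: w_def)
  have d: "drop ?root ?z = enc_tree T @ concat (map enc_inst (us @ vs)) @ p" by (rule input_parts(2))
  have S: "tab 0 ?e q r = tree_word ?z q r" if "q \<le> ?L" "r \<le> ?L" for q r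
    using u(2)[of 0 r q] that le by simp
  have "tree_check (nthb ?z) ?L (tab 0 ?e)"
    by (rule tree_check_agree[OF S]) (use tree_check_tree_word[of ?z] L in simp_all)
  moreover have "node_check (nthb ?z) ?L (tab 0 ?e) ?root n (\<lambda>q. tab 1 ?e q 0) (\<lambda>b. tab (if b then 3 else 2) ?e)"
  proof (rule node_check_agree[OF S])
    show "tab 1 ?e q 0 = node_at ?root ?bot T q" if "q \<le> ?L" for q
      using u(2)[of 1 0 q] that le by simp
    show "tab (if b then 3 else 2) ?e q i = value_at ?root ?bot T b q i" if "q \<le> ?L" "i < n" for b q i
      using u(2)[of "if b then 3 else 2" i q] that le n by (cases b) simp_all
    show "node_check (nthb ?z) ?L (tree_word ?z) ?root n (node_at ?root ?bot T) (value_at ?root ?bot T)"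
      using node_check_nodes[OF d] L by simp
  qed
  ultimately have "table_check ?e n" unfolding table_check_def y by simp
  moreover have "tab 0 ?e ?root (?root + length (enc_tree T))"
    using S[OF q0] tree_wordI[OF d] by simp
  moreover have "inst n (chain_digit ?e j) = E j" if j: "j < type_bound l n" "E j \<in> insts n" for j
  proof (rule insts_nth_eq[OF inst_in j(2)])
    fix i assume i: "i < n"
    have "type_bound l n \<le> (?L + 1) ^ (3 * 3 ^ l)" unfolding type_bound_def using n by (intro power_mono) auto
    then have "j < ?B" using j(1) by simp
    then have "tab 4 ?e j i = (E j ! i = Some False)" "tab 5 ?e j i = (E j ! i = Some True)"
      using u(2)[of 4 i j] u(2)[of 5 i j] i n by simp_all
    then show "inst n (chain_digit ?e j) ! i = E j ! i"
      using i dec_digit[of "\<lambda>b. E j ! i = Some b" "E j ! i"] by (simp add: chain_digit_def)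
  qed
  moreover have "length u \<le> poly (witness_bound l) ?L"
    unfolding u(1) by (simp add: witness_bound_def algebra_simps)
  ultimately show ?thesis by blast
qed

text \<open>On valid inputs a query asks whether \<open>p\<close> can be completed to the word of
  some chain. Soundness rests on the fact that the certificate cannot influence how the input is
  parsed.\<close>

lemma query_language_iff:
  "rev (enc_input n T us vs @ p) \<in> query_language k \<phi> l \<rho> \<longleftrightarrow>
   (\<exists>m E s. m \<le> type_bound l n \<and> chain n T us vs \<phi> \<rho> E m \<and> chain_word m E = p @ s)"
proof -
  let ?x = "enc_input n T us vs"
  let ?z = "?x @ p" and ?r = "n + 1 + length (enc_tree T)"
  let ?w = "rev ?z"
  have lx: "?r + 2 * (n * (k + l)) = length ?x" using input_parts(4) by simp
  have bit: "nthb ?z (length ?x + t) = p ! t" if "t < length p" for t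
    using that by (simp add: nthb_def nth_append)
  have out: "output_check (words ?w u, v) n (length ?x) m \<longleftrightarrow> (\<exists>s. chain_word m E = p @ s)"
    if E: "m \<noteq> 0 \<Longrightarrow> E (m - 1) \<in> insts n" "m \<noteq> 0 \<Longrightarrow> inst n (chain_digit (words ?w u, v) (m - 1)) = E (m - 1)"
    for u v m E
  proof -
    let ?d = "chain_digit (words ?w u, v) (m - 1)"
    have nth: "chain_word m E ! t = out_bit n m ?d t" if "t < length (chain_word m E)" for t
    proof (rule chain_word_nth[OF _ _ that])
      show "dec (?d i) = E (m - 1) ! i" if "m \<noteq> 0" "i < n" for i
        using E(2)[OF that(1)] that(2) by (metis inst_nth)
    qed (use E(1) in simp)
    have len: "length (chain_word m E) = m + 1 + (if m = 0 then 1 else 2 * n + 1)"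
      using chain_word_length[of m E n] E(1) by simp
    have "output_check (words ?w u, v) n (length ?x) m \<longleftrightarrow>
       length p \<le> length (chain_word m E) \<and> (\<forall>t < length p. p ! t = out_bit n m ?d t)"
      unfolding output_check_def len zbit_words rev_rev_ident using bit by (auto simp del: One_nat_def)
    also have "\<dots> \<longleftrightarrow> length p \<le> length (chain_word m E) \<and> (\<forall>t < length p. p ! t = chain_word m E ! t)"
      using nth by auto
    also have "\<dots> \<longleftrightarrow> (\<exists>s. chain_word m E = p @ s)"
    proof
      assume *: "length p \<le> length (chain_word m E) \<and> (\<forall>t < length p. p ! t = chain_word m E ! t)"
      then have "take (length p) (chain_word m E) = p" by (intro nth_equalityI) auto
      then show "\<exists>s. chain_word m E = p @ s" by (metis append_take_drop_id)
    qed (auto simp: nth_append)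
    finally show ?thesis .
  qed
  show ?thesis
  proof
    assume "?w \<in> query_language k \<phi> l \<rho>"
    then obtain u where "check k \<phi> l \<rho> (words ?w u, \<lambda>_. 0)" unfolding query_language_def by blast
    let ?e = "(words ?w u, \<lambda>_. 0 :: nat)"
    let ?E = "\<lambda>j. inst n (chain_digit ?e j)"
    have y: "zbit ?e = nthb ?z" by (simp only: zbit_words rev_rev_ident)
    from \<open>check k \<phi> l \<rho> ?e\<close> obtain n' r m where n': "\<forall>i < n'. nthb ?z i" "\<not> nthb ?z n'" "table_check ?e n'"
      and r: "r \<le> length ?z" "tab 0 ?e (n' + 1) r" and m: "m \<le> type_bound l n'"
      "chain_check k \<phi> l \<rho> ?e n' r m" "output_check ?e n' (r + 2 * (n' * (k + l))) m"
      unfolding check_def y len_words length_rev by blast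
    \<comment> \<open>Both are the position of the first False.\<close>
    have "n' = n" using n'(1,2) enc_nat_bits[OF input_parts(1)[of p]] by (metis linorder_neqE_nat)
    have tc: "tree_check (nthb ?z) (length ?z) (tab 0 ?e)"
      using n'(3) unfolding table_check_def y len_words length_rev by blast
    have "n + 1 \<le> length ?z" using input_parts(4) by simp
    then have "tree_word ?z (n + 1) r"
      using tree_check_unique[OF tc tree_check_tree_word[of ?z]] r \<open>n' = n\<close> by blast
    then have "r = ?r" using tree_word_unique[OF input_parts(2)] by blast
    have "chain n T us vs \<phi> \<rho> ?E m" using chain_check_iff m(2) n'(3) \<open>n' = n\<close> \<open>r = ?r\<close> by blast
    moreover have "\<exists>s. chain_word m ?E = p @ s"
      using out[of m ?E u "\<lambda>_. 0"] m(3) \<open>n' = n\<close> \<open>r = ?r\<close> lx by simp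
    ultimately show "\<exists>m E s. m \<le> type_bound l n \<and> chain n T us vs \<phi> \<rho> E m \<and> chain_word m E = p @ s"
      using m(1) \<open>n' = n\<close> by blast
  next
    assume "\<exists>m E s. m \<le> type_bound l n \<and> chain n T us vs \<phi> \<rho> E m \<and> chain_word m E = p @ s"
    then obtain m E s where m: "m \<le> type_bound l n" "chain n T us vs \<phi> \<rho> E m" "chain_word m E = p @ s" by blast
    obtain u where u: "length u \<le> poly (witness_bound l) (length ?w)" "table_check (words ?w u, \<lambda>_. 0) n"
      "tab 0 (words ?w u, \<lambda>_. 0) (n + 1) ?r"
      "\<And>j. j < type_bound l n \<Longrightarrow> E j \<in> insts n \<Longrightarrow> inst n (chain_digit (words ?w u, \<lambda>_. 0) j) = E j"
      using tables_exist[of p "\<lambda>_. 0" E] by blast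
    let ?e = "(words ?w u, \<lambda>_. 0 :: nat)"
    have y: "zbit ?e = nthb ?z" by (simp only: zbit_words rev_rev_ident)
    have E: "E j \<in> insts n \<and> inst n (chain_digit ?e j) = E j" if "j < m" for j
      using m(1,2) u(4)[of j] that by (auto simp: chain_def)
    have "chain n T us vs \<phi> \<rho> (\<lambda>j. inst n (chain_digit ?e j)) m"
      using m(2) E by (auto simp: chain_def)
    then have cc: "chain_check k \<phi> l \<rho> ?e n ?r m" using chain_check_iff[OF u(2)] by blast
    have oc: "output_check ?e n (length ?x) m"
      using out[of m E u "\<lambda>_. 0"] E[of "m - 1"] m(3) by auto
    have "n < length ?z" "?r \<le> length ?z" using input_parts(4) by simp_all
    moreover have "\<forall>i < n. nthb ?z i" "\<not> nthb ?z n" using enc_nat_bits[OF input_parts(1)[of p]] by auto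
    ultimately have "check k \<phi> l \<rho> ?e"
      unfolding check_def y lx[symmetric] using u(2,3) cc oc[folded lx] m(1) len_words length_rev by metis
    with u(1) show "?w \<in> query_language k \<phi> l \<rho>" unfolding query_language_def by blast
  qed
qed

text \<open>Guarantees that the bound on \<open>m\<close> in \<open>check\<close> excludes no chain.
  Types are taken relative to the \<open>l\<close> parameters of \<open>\<rho>\<close>, which
  pattern-preserving permutations leave fixed.\<close>

lemma chain_length:
  assumes "chain n T us vs \<phi> \<rho> E m"
  shows "m \<le> type_bound l n"
  unfolding type_bound_def
proof (rule chain_bound)
  let ?R = "\<lambda>a b. atomic_sat n ((!) (a # b # vs)) \<rho>"
  let ?pc = "entry_pattern l (\<lambda>y. vs ! y)"
  have vs: "set vs \<subseteq> insts n" "length vs = l" using valid by auto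
  have "represents_strict_order l \<rho>" using opt by simp
  then have "irreflp_on (insts n) ?R \<and> transp_on (insts n) ?R"
    unfolding represents_strict_order_def Let_def sat.simps using valid by auto
  then show "irreflp_on (insts n) ?R" "transp_on (insts n) ?R" by blast+
  show "E j \<in> insts n" if "j < m" for j using assms that by (simp add: chain_def)
  show "?R (E (Suc j)) (E j)" if "Suc j < m" for j using assms that by (simp add: chain_def)
  show "?pc i < 3 ^ l" for i by (rule entry_pattern_less)
  fix \<pi> a b
  assume \<pi>: "\<pi> permutes {..<n}" "\<And>i. i < n \<Longrightarrow> ?pc (\<pi> i) = ?pc i" and ab: "a \<in> insts n" "b \<in> insts n" "?R a b"
  have fv: "x < l + 2" if "x \<in> atomic_fv \<rho>" for x using that opt by auto
  have "?R (permute_list \<pi> a) (permute_list \<pi> b) = ?R a b"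
  proof (rule atomic_sat_same_orbit[OF \<pi>(1)])
    fix x assume "x \<in> atomic_fv \<rho>"
    from fv[OF this] have x: "x < l + 2" .
    consider "x = 0" | "x = 1" | x' where "x = Suc (Suc x')" "x' < l"
      using x by (metis not0_implies_Suc One_nat_def add_2_eq_Suc' Suc_less_eq)
    then have "(a # b # vs) ! x \<in> insts n \<and> (permute_list \<pi> a # permute_list \<pi> b # vs) ! x \<in> insts n \<and>
      (\<forall>i < n. (permute_list \<pi> a # permute_list \<pi> b # vs) ! x ! i = (a # b # vs) ! x ! \<pi> i)"
    proof cases
      case 3
      then have "vs ! x' \<in> insts n" using vs nth_mem by blast
      with 3 show ?thesis using entry_pattern_eq[OF \<pi>(2), of _ x'] by auto
    qed (use ab permute_insts permute_insts_nth[OF \<pi>(1)] in auto)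
    then show "(a # b # vs) ! x \<in> insts n \<and> (permute_list \<pi> a # permute_list \<pi> b # vs) ! x \<in> insts n"
      and "\<And>i. i < n \<Longrightarrow> (permute_list \<pi> a # permute_list \<pi> b # vs) ! x ! i = (a # b # vs) ! x ! \<pi> i"
      by blast+
  qed
  with ab(3) show "?R (permute_list \<pi> a) (permute_list \<pi> b)" by blast
qed

text \<open>A greedy path that cannot be extended is a complete word of a chain. Its separator shows
  that no longer chain exists, which makes the last element minimal, or shows that nothing satisfies
  \<open>\<phi>\<close> if the chain is empty.\<close>

lemma greedy_correct:
  assumes g: "greedy_max (query_language k \<phi> l \<rho>) (enc_input n T us vs) p"
  shows "(enc_input n T us vs, result p) \<in> Comp (MinOf k \<phi> l \<rho>)"
proof -
  let ?x = "enc_input n T us vs" and ?A = "query_language k \<phi> l \<rho>"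
  let ?chain = "chain n T us vs \<phi> \<rho>"
  have gr: "greedy ?A ?x p" and stop: "rev (?x @ p @ [b]) \<notin> ?A" for b using g by (auto simp: greedy_max_def)
  have "\<exists>m E s. m \<le> type_bound l n \<and> ?chain E m \<and> chain_word m E = p @ s"
  proof (cases "p = []")
    case True
    \<comment> \<open>The empty path was never confirmed by a query, but it begins the word of the
      empty chain.\<close>
    have "?chain (\<lambda>_. []) 0" by (simp add: chain_def)
    with True show ?thesis by (intro exI[of _ 0] exI[of _ "\<lambda>_. []"]) simp
  next
    case False
    then show ?thesis using greedy_query[OF gr] query_language_iff by blast
  qed
  then obtain m E s where m: "m \<le> type_bound l n" "?chain E m" "chain_word m E = p @ s" by blast
  \<comment> \<open>A further bit of the word would have been accepted, against maximality of the
    path.\<close>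
  have "s = []"
  proof (rule ccontr)
    assume "s \<noteq> []"
    then obtain b s' where "s = b # s'" by (cases s) auto
    then have "chain_word m E = (p @ [b]) @ s'" using m(3) by simp
    then have "rev (?x @ (p @ [b])) \<in> ?A" using m(1,2) query_language_iff by blast
    then show False using stop by simp
  qed
  let ?o = "if m = 0 then None else Some (E (m - 1))"
  have p: "p = unary m @ False # rev (enc_output ?o)" using m(3) \<open>s = []\<close> by (simp add: chain_word_def)
  have "dropWhile id p = False # rev (enc_output ?o)" unfolding p by (subst dropWhile_append2) auto
  then have res: "result p = enc_output ?o" by (simp add: result_def)
  have longest: "\<not> ?chain E' (Suc m)" for E'
  proof
    assume c: "?chain E' (Suc m)"
    \<comment> \<open>The word of a longer chain has a 1 where \<open>p\<close> has its separator,
      and this 1 was refused.\<close>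
    have "chain_word (Suc m) E' = (unary m @ [True]) @ False # rev (enc_output (Some (E' m)))"
      by (simp add: chain_word_def replicate_app_Cons_same)
    then have "rev (?x @ (unary m @ [True])) \<in> ?A" using c chain_length[OF c] query_language_iff by blast
    then show False using greedy_refused[OF gr p] by simp
  qed
  have "correct_output (MinOf k \<phi> l \<rho>) n T us vs ?o"
  proof (cases "m = 0")
    case True
    \<comment> \<open>A single instance that satisfies \<open>\<phi>\<close> would be a chain of
      length 1.\<close>
    have "\<not> sat n T ((!) (e # us)) \<phi>" if "e \<in> insts n" for e
      using longest[of "\<lambda>_. e"] that True by (simp add: chain_def)
    with True show ?thesis by auto
  next
    case False
    then have e: "E (m - 1) \<in> insts n" "sat n T ((!) (E (m - 1) # us)) \<phi>" using m(2) by (auto simp: chain_def)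
    have "\<not> (sat n T ((!) (e' # us)) \<phi> \<and> atomic_sat n ((!) (e' # E (m - 1) # vs)) \<rho>)" if "e' \<in> insts n" for e'
    proof
      assume *: "sat n T ((!) (e' # us)) \<phi> \<and> atomic_sat n ((!) (e' # E (m - 1) # vs)) \<rho>"
      \<comment> \<open>A better instance \<open>e'\<close> could be appended to the chain at
        position \<open>m\<close>.\<close>
      have "atomic_sat n ((!) ((E(m := e')) (Suc j) # (E(m := e')) j # vs)) \<rho>" if "Suc j < Suc m" for j
      proof (cases "Suc j = m")
        case True
        then have "j = m - 1" by simp
        with True * show ?thesis by simp
      next
        case False
        then show ?thesis using that m(2) by (simp add: chain_def)
      qed
      then have "?chain (E(m := e')) (Suc m)"
        using m(2) * \<open>e' \<in> insts n\<close> by (simp add: chain_def less_Suc_eq)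
      then show False using longest by blast
    qed
    with e False show ?thesis by auto
  qed
  then show ?thesis unfolding Comp_def res using valid by blast
qed

end

section \<open>Greedy paths on arbitrary words\<close>

lemma query_parse:
  assumes "rev z \<in> query_language k \<phi> l \<rho>"
  shows "\<exists>n r. n < length z \<and> (\<forall>i < n. nthb z i) \<and> \<not> nthb z n \<and> tree_word z (n + 1) r \<and>
    r + 2 * (n * (k + l)) \<le> length z \<and> length z \<le> r + 2 * (n * (k + l)) + (type_bound l n + 2 * n + 2)"
proof -
  obtain u where "check k \<phi> l \<rho> (words (rev z) u, \<lambda>_. 0)" using assms unfolding query_language_def by blast
  let ?e = "(words (rev z) u, \<lambda>_. 0 :: nat)"
  have y: "zbit ?e = nthb z" by (simp only: zbit_words rev_rev_ident)
  from \<open>check k \<phi> l \<rho> ?e\<close> obtain n r m where n: "n < length z" "\<forall>i < n. nthb z i" "\<not> nthb z n" "table_check ?e n"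
    and r: "r \<le> length z" "tab 0 ?e (n + 1) r" and m: "m \<le> type_bound l n" "output_check ?e n (r + 2 * (n * (k + l))) m"
    unfolding check_def y len_words length_rev by blast
  have tc: "tree_check (nthb z) (length z) (tab 0 ?e)"
    using n(4) unfolding table_check_def y len_words length_rev by blast
  have "n + 1 \<le> length z" using n(1) by simp
  \<comment> \<open>The parse of an accepted word can be stated without its certificate, so parses
    obtained from different certificates are comparable.\<close>
  then have "tree_word z (n + 1) r" using tree_check_unique[OF tc tree_check_tree_word[of z]] r by blast
  moreover have "r + 2 * (n * (k + l)) \<le> length z"
    "length z \<le> r + 2 * (n * (k + l)) + (m + 1 + (if m = 0 then 1 else 2 * n + 1))"
    using m(2) unfolding output_check_def len_words length_rev by blast+
  moreover have "m + 1 + (if m = 0 then 1 else 2 * n + 1) \<le> type_bound l n + 2 * n + 2" using m(1) by simp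
  ultimately show ?thesis using n(1-3) by (meson add_left_mono le_trans)
qed

text \<open>The first query already contains the whole input, which can be parsed in only one way.\<close>

lemma query_extension_bound:
  assumes "rev (x @ [b]) \<in> query_language k \<phi> l \<rho>" "rev (x @ b # p) \<in> query_language k \<phi> l \<rho>"
  shows "length (b # p) \<le> poly ([:3, 2:] + [:1, 1:] ^ (3 * 3 ^ l)) (length x)"
proof -
  let ?z = "x @ [b]"
  obtain n r where n: "n < length ?z" "\<forall>i < n. nthb ?z i" "\<not> nthb ?z n" and t: "tree_word ?z (n + 1) r"
    and r: "r + 2 * (n * (k + l)) \<le> length ?z" using query_parse[OF assms(1)] by blast
  obtain n' r' where n': "\<forall>i < n'. nthb (?z @ p) i" "\<not> nthb (?z @ p) n'" and t': "tree_word (?z @ p) (n' + 1) r'"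
    and r': "length (?z @ p) \<le> r' + 2 * (n' * (k + l)) + (type_bound l n' + 2 * n' + 2)"
    using query_parse[of "?z @ p" k \<phi> l \<rho>] assms(2) by auto
  have y: "nthb (?z @ p) i = nthb ?z i" if "i < length ?z" for i
    using that by (simp add: nthb_def nth_append)
  have "n' = n"
  proof (rule linorder_cases[of n' n])
    assume "n' < n"
    then show ?thesis using n'(2) n(1,2) y[of n'] by simp
  next
    assume "n < n'"
    then show ?thesis using n'(1) n(1,3) y[of n] by blast
  qed
  obtain S where S: "drop (n + 1) ?z = enc_tree S @ drop r ?z" using t by (auto simp: tree_word_def)
  have "drop (n + 1) (?z @ p) = enc_tree S @ drop r ?z @ p"
    using S n(1) by (simp only: drop_append append_assoc) simp
  \<comment> \<open>The tree is complete within \<open>x @ [b]\<close>, and by prefix-freeness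
    appending \<open>p\<close> cannot move its end.\<close>
  then have "r' = r" using t' tree_word_unique[of "n + 1" "?z @ p" S] tree_word_unique[OF S] t \<open>n' = n\<close> by metis
  \<comment> \<open>What follows the parameters has at most
    \<open>type_bound l n + 2 * n + 2\<close> bits. The parameters end within
    \<open>x @ [b]\<close>, so \<open>p\<close> is no longer than that, and \<open>b\<close> adds
    1.\<close>
  have "type_bound l n \<le> (length x + 1) ^ (3 * 3 ^ l)" "n \<le> length x"
    using n(1) by (auto simp: type_bound_def intro!: power_mono)
  then show ?thesis using r r' \<open>n' = n\<close> \<open>r' = r\<close> by (simp add: algebra_simps)
qed

lemma greedy_bound:
  assumes "p \<noteq> []" "greedy (query_language k \<phi> l \<rho>) x p"
  shows "length p \<le> poly ([:3, 2:] + [:1, 1:] ^ (3 * 3 ^ l)) (length x)"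
proof -
  obtain b p' where p: "p = b # p'" using assms(1) by (cases p) auto
  show ?thesis unfolding p
    by (rule query_extension_bound) (use greedy_first[OF assms(2,1)] greedy_query[OF assms(2,1)] p in simp_all)
qed

theorem theorem10:
  fixes \<Psi> :: opt_formula
  assumes "opt_dt_foil \<Psi>"
  shows "Comp \<Psi> \<in> FP_NP"
proof -
  obtain k \<phi> l \<rho> where \<Psi>: "\<Psi> = MinOf k \<phi> l \<rho>" by (cases \<Psi>)
  let ?A = "query_language k \<phi> l \<rho>"
  have "\<exists>f \<in> FP_with_oracle ?A. \<forall>x. \<exists>p. greedy_max ?A x p \<and> f x = result p"
    by (rule greedy_in_FP) (rule greedy_bound)
  then obtain f where f: "f \<in> FP_with_oracle ?A" "\<And>x. \<exists>p. greedy_max ?A x p \<and> f x = result p"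
    by blast
  have "(x, f x) \<in> Comp \<Psi>" if x: "x \<in> Domain (Comp \<Psi>)" for x
  proof -
    obtain n T us vs where "x = enc_input n T us vs" "valid_input \<Psi> n T us vs"
      using x unfolding Comp_def by blast
    then show ?thesis using f(2)[of x] greedy_correct[of k \<phi> l \<rho> n T us vs] assms unfolding \<Psi> by metis
  qed
  then show ?thesis unfolding FP_NP_def using query_language_NP f(1) by blast
qed

end
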